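(* Let $M_1,M_2$ be two tropical regular functions on $\mathbb{R}^n$ such that $\dim(\mathrm{Newt}(M_1)+\mathrm{Newt}(M_2))=n$ (Minkowski sum). Then there are only finitely many $2$-cycles $[F]$ in $\mathbb{R}^n$ such that $M_1\cdot M_1\cdot[F]\le1$, $M_1\cdot M_2\cdot[F]\le1$ and $M_2\cdot M_2\cdot[F]\le1$.
   Context: A $k$-dimensional tropical fan $F$ in $\mathbb{R}^n$ is a finite pure $k$-dimensional fan of strongly convex rational polyhedral cones, with a positive integer weight $\omega_F(\sigma)$ for each $\sigma\in F^{(k)}$ ($F^{(i)}$ = set of $i$-dimensional cones), satisfying the balancing condition: for every $\tau\in F^{(k-1)}$, $\sum_{\sigma>\tau}\omega_F(\sigma)v_{\sigma/\tau}\in\langle\tau\rangle$, where $\langle\cdot\rangle$ is linear span and $v_{\sigma/\tau}\in\mathbb{Z}^n$ represents the primitive generator of $(\mathbb{Z}^n\cap\langle\sigma\rangle)/(\mathbb{Z}^n\cap\langle\tau\rangle)$ pointing towards $\sigma$. A refinement of $F$ is a tropical fan with the same support whose cones are contained in cones of $F$, with induced weights. Two tropical fans are equivalent if they have a common refinement; an (affine tropical) $k$-cycle $[F]$ is an equivalence class. Cones of weight $0$ are discarded; the zero cycle is allowed. A tropical regular (TR) function on $\mathbb{R}^n$ is $T=\max(l_1,\dots,l_m)$ with $l_i\in(\mathbb{Z}^n)^\vee$; its Newton polytope is $\mathrm{Newt}(T)=\mathrm{conv}(l_1,\dots,l_m)$. The product $T\cdot[F]$ with a $k$-cycle is the $(k-1)$-cycle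 obtained by choosing a representative $F$ such that $T$ is linear on each cone, and giving $\tau\in F^{(k-1)}$ the weight $\sum_{\sigma>\tau}\omega_F(\sigma)T_\sigma(v_{\sigma/\tau})-T_\tau\big(\sum_{\sigma>\tau}\omega_F(\sigma)v_{\sigma/\tau}\big)$, where $T_\sigma,T_\tau$ are the linear extensions of $T|_\sigma,T|_\tau$ to $\langle\sigma\rangle,\langle\tau\rangle$; this is independent of all choices. A $0$-cycle is identified with the weight of the origin, and products are iterated: $T_1\cdot T_2\cdot[F]=T_1\cdot(T_2\cdot[F])$. *)

theory Defs
  imports "HOL-Analysis.Analysis"
begin

section \<open>Rational cones and fans\<close>

definition lattice_points :: "(real^'n) set" where
  "lattice_points = {x. \<forall>i. x $ i \<in> \<int>}"

text \<open>A \<^const>\<open>convex_cone\<close> contains the origin, so the hull of the empty set is the cone {0}.\<close>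

definition rational_polyhedral_cone :: "(real^'n) set \<Rightarrow> bool" where
  "rational_polyhedral_cone \<sigma> \<longleftrightarrow>
     (\<exists>S. finite S \<and> S \<subseteq> lattice_points \<and> \<sigma> = convex_cone hull S)"

definition strongly_convex_cone :: "(real^'n) set \<Rightarrow> bool" where
  "strongly_convex_cone \<sigma> \<longleftrightarrow> \<sigma> \<inter> uminus ` \<sigma> = {0}"

text \<open>The library counts the empty set as a face; it is not a face of a cone in the sense of fans.\<close>

definition rational_fan :: "(real^'n) set set \<Rightarrow> bool" where
  "rational_fan \<Phi> \<longleftrightarrow>
     finite \<Phi> \<and>
     (\<forall>\<sigma>\<in>\<Phi>. rational_polyhedral_cone \<sigma> \<and> strongly_convex_cone \<sigma>) \<and>
     (\<forall>\<sigma>\<in>\<Phi>. \<forall>\<tau>. \<tau> face_of \<sigma> \<and> \<tau> \<noteq> {} \<longrightarrow> \<tau> \<in> \<Phi>) \<and>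
     (\<forall>\<sigma>\<in>\<Phi>. \<forall>\<sigma>'\<in>\<Phi>. \<sigma> \<inter> \<sigma>' face_of \<sigma> \<and> \<sigma> \<inter> \<sigma>' face_of \<sigma>')"

text \<open>For a cone, \<^const>\<open>dim\<close> (the dimension of the linear span) is the dimension.\<close>

definition cones_of_dim :: "(real^'n) set set \<Rightarrow> nat \<Rightarrow> (real^'n) set set" where
  "cones_of_dim \<Phi> i = {\<sigma>\<in>\<Phi>. dim \<sigma> = i}"

definition pure_fan :: "nat \<Rightarrow> (real^'n) set set \<Rightarrow> bool" where
  "pure_fan k \<Phi> \<longleftrightarrow> rational_fan \<Phi> \<and> (\<forall>\<tau>\<in>\<Phi>. \<exists>\<sigma>\<in>cones_of_dim \<Phi> k. \<tau> \<subseteq> \<sigma>)"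

definition facet_star :: "(real^'n) set set \<Rightarrow> (real^'n) set \<Rightarrow> (real^'n) set set" where
  "facet_star \<Phi> \<tau> = {\<sigma>\<in>cones_of_dim \<Phi> (Suc (dim \<tau>)). \<tau> face_of \<sigma>}"


section \<open>Tropical fans\<close>

text \<open>
  \<open>v\<close> represents a generator of the quotient of the lattice of \<open>\<sigma>\<close> by the lattice of \<open>\<tau>\<close>, and its
  class lies in the image of \<open>\<sigma>\<close>, that is, it points towards \<open>\<sigma>\<close>.  Such a \<open>v\<close> is unique up to
  lattice points of the span of \<open>\<tau>\<close>, on which neither balancing nor products depend.
\<close>

definition is_lattice_normal :: "(real^'n) set \<Rightarrow> (real^'n) set \<Rightarrow> real^'n \<Rightarrow> bool" where
  "is_lattice_normal \<sigma> \<tau> v \<longleftrightarrow>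
     v \<in> lattice_points \<inter> span \<sigma> \<and>
     (\<forall>z \<in> lattice_points \<inter> span \<sigma>. \<exists>m::int. z - of_int m *\<^sub>R v \<in> span \<tau>) \<and>
     (\<exists>s\<in>\<sigma>. \<exists>t\<in>span \<tau>. v = s + t)"

definition lattice_normal :: "(real^'n) set \<Rightarrow> (real^'n) set \<Rightarrow> real^'n" where
  "lattice_normal \<sigma> \<tau> = (SOME v. is_lattice_normal \<sigma> \<tau> v)"

text \<open>
  Weights are stored as real numbers, constrained below to be positive integers on the maximal
  cones, so that the defining formula of a product weight needs no rounding.  All other sets get
  weight 0.
\<close>

datatype 'n weighted_fan =
  Weighted_Fan (cones: "(real^'n) set set") (weight: "(real^'n) set \<Rightarrow> real")

definition tropical_fan :: "nat \<Rightarrow> 'n::finite weighted_fan \<Rightarrow> bool" where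
  "tropical_fan k F \<longleftrightarrow>
     pure_fan k (cones F) \<and>
     (\<forall>\<sigma>\<in>cones_of_dim (cones F) k. weight F \<sigma> \<in> \<nat> \<and> weight F \<sigma> > 0) \<and>
     (\<forall>\<sigma>. \<sigma> \<notin> cones_of_dim (cones F) k \<longrightarrow> weight F \<sigma> = 0) \<and>
     (\<forall>\<tau>\<in>cones F. Suc (dim \<tau>) = k \<longrightarrow>
        (\<Sum>\<sigma>\<in>facet_star (cones F) \<tau>. weight F \<sigma> *\<^sub>R lattice_normal \<sigma> \<tau>) \<in> span \<tau>)"


section \<open>Cycles\<close>

definition refines :: "nat \<Rightarrow> 'n::finite weighted_fan \<Rightarrow> 'n weighted_fan \<Rightarrow> bool" where
  "refines k G F \<longleftrightarrow>
     tropical_fan k G \<and> tropical_fan k F \<and>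
     \<Union>(cones G) = \<Union>(cones F) \<and>
     (\<forall>\<sigma>'\<in>cones G. \<exists>\<sigma>\<in>cones F. \<sigma>' \<subseteq> \<sigma>) \<and>
     (\<forall>\<sigma>'\<in>cones_of_dim (cones G) k. \<forall>\<sigma>\<in>cones_of_dim (cones F) k.
        \<sigma>' \<subseteq> \<sigma> \<longrightarrow> weight G \<sigma>' = weight F \<sigma>)"

definition fan_equiv :: "nat \<Rightarrow> ('n::finite weighted_fan \<times> 'n weighted_fan) set" where
  "fan_equiv k = {(F, G). \<exists>H. refines k H F \<and> refines k H G}"

text \<open>The zero cycle is the class of the fan without cones, which is pure of every dimension.\<close>

definition cycles :: "nat \<Rightarrow> 'n::finite weighted_fan set set" where
  "cycles k = {F. tropical_fan k F} // fan_equiv k"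


section \<open>Tropical regular functions\<close>

text \<open>The dual lattice is identified with the lattice via the inner product.\<close>

definition is_max_of :: "(real^'n \<Rightarrow> real) \<Rightarrow> (real^'n) set \<Rightarrow> bool" where
  "is_max_of T A \<longleftrightarrow>
     finite A \<and> A \<noteq> {} \<and> A \<subseteq> lattice_points \<and> (\<forall>x. T x = Max ((\<lambda>l. l \<bullet> x) ` A))"

definition tropical_regular :: "(real^'n \<Rightarrow> real) \<Rightarrow> bool" where
  "tropical_regular T \<longleftrightarrow> (\<exists>A. is_max_of T A)"

definition Newt :: "(real^'n \<Rightarrow> real) \<Rightarrow> (real^'n) set" where
  "Newt T = convex hull (SOME A. is_max_of T A)"

lemma is_max_of_hull_subset:
  assumes A: "is_max_of T A" and B: "is_max_of T B"
  shows "convex hull A \<subseteq> convex hull B"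
proof (rule hull_minimal)
  show "A \<subseteq> convex hull B"
  proof
    fix a assume a: "a \<in> A"
    show "a \<in> convex hull B"
    proof (rule ccontr)
      assume "a \<notin> convex hull B"
      moreover have "closed (convex hull B)"
        using B compact_imp_closed finite_imp_compact_convex_hull unfolding is_max_of_def by blast
      ultimately obtain u b where u: "u \<bullet> a < b" "\<forall>x\<in>convex hull B. u \<bullet> x > b"
        using separating_hyperplane_closed_point[OF convex_convex_hull] by blast
      have finB: "finite ((\<lambda>l. l \<bullet> (- u)) ` B)" and neB: "(\<lambda>l. l \<bullet> (- u)) ` B \<noteq> {}"
        and TB: "T (- u) = Max ((\<lambda>l. l \<bullet> (- u)) ` B)"
        using B unfolding is_max_of_def by blast+
      from Max_in[OF finB neB] obtain l where l: "l \<in> B" "T (- u) = l \<bullet> (- u)"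
        unfolding TB by blast
      have finA: "finite ((\<lambda>l. l \<bullet> (- u)) ` A)" and TA: "T (- u) = Max ((\<lambda>l. l \<bullet> (- u)) ` A)"
        using A unfolding is_max_of_def by blast+
      have "a \<bullet> (- u) \<le> T (- u)"
        unfolding TA by (rule Max_ge[OF finA imageI[OF a]])
      then have "u \<bullet> l \<le> u \<bullet> a"
        unfolding l(2) inner_minus_right neg_le_iff_le inner_commute[of l u] inner_commute[of a u] .
      moreover have "u \<bullet> l > b"
        using u(2) l(1) hull_inc[of l B convex] by blast
      ultimately show False
        using u(1) by linarith
    qed
  qed
qed (rule convex_convex_hull)

text \<open>The Newton polytope does not depend on the presentation as a maximum.\<close>

lemma Newt_eq:
  assumes "is_max_of T A"
  shows "Newt T = convex hull A"
proof -
  have "is_max_of T (SOME A. is_max_of T A)"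
    using assms by (rule someI)
  then show ?thesis
    unfolding Newt_def using assms is_max_of_hull_subset by blast
qed


section \<open>Products\<close>

definition linear_on_cone :: "(real^'n) set \<Rightarrow> (real^'n \<Rightarrow> real) \<Rightarrow> bool" where
  "linear_on_cone \<sigma> T \<longleftrightarrow> (\<exists>L. linear L \<and> (\<forall>x\<in>\<sigma>. L x = T x))"

text \<open>Only the values on the span of \<open>\<sigma>\<close> are meaningful; there the choice of \<open>L\<close> is irrelevant.\<close>

definition linear_extension :: "(real^'n) set \<Rightarrow> (real^'n \<Rightarrow> real) \<Rightarrow> real^'n \<Rightarrow> real" where
  "linear_extension \<sigma> T = (SOME L. linear L \<and> (\<forall>x\<in>\<sigma>. L x = T x))"

definition product_weight ::
  "(real^'n \<Rightarrow> real) \<Rightarrow> 'n::finite weighted_fan \<Rightarrow> (real^'n) set \<Rightarrow> real" where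
  "product_weight T F \<tau> =
     (\<Sum>\<sigma>\<in>facet_star (cones F) \<tau>. weight F \<sigma> * linear_extension \<sigma> T (lattice_normal \<sigma> \<tau>))
     - linear_extension \<tau> T
         (\<Sum>\<sigma>\<in>facet_star (cones F) \<tau>. weight F \<sigma> *\<^sub>R lattice_normal \<sigma> \<tau>)"

text \<open>
  The dimension \<open>k\<close> is that of the product: \<open>F\<close> has dimension \<open>Suc k\<close>.  Discarding the
  \<open>k\<close>-dimensional cones of weight 0 leaves the faces of the remaining ones.
\<close>

definition product_fan ::
  "nat \<Rightarrow> (real^'n \<Rightarrow> real) \<Rightarrow> 'n::finite weighted_fan \<Rightarrow> 'n weighted_fan" where
  "product_fan k T F =
     Weighted_Fan
       {\<rho>\<in>cones F. \<exists>\<tau>\<in>cones_of_dim (cones F) k. product_weight T F \<tau> \<noteq> 0 \<and> \<rho> \<subseteq> \<tau>}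
       (\<lambda>\<tau>. if \<tau> \<in> cones_of_dim (cones F) k then product_weight T F \<tau> else 0)"

definition cycle_product ::
  "nat \<Rightarrow> (real^'n \<Rightarrow> real) \<Rightarrow> 'n::finite weighted_fan set \<Rightarrow> 'n weighted_fan set" where
  "cycle_product k T C =
     fan_equiv k ``
       {product_fan k T (SOME F. F \<in> C \<and> (\<forall>\<sigma>\<in>cones F. linear_on_cone \<sigma> T))}"

text \<open>All representatives of a 0-cycle give the origin the same weight (0 for the zero cycle).\<close>

definition origin_weight :: "'n::finite weighted_fan set \<Rightarrow> real" where
  "origin_weight C = weight (SOME F. F \<in> C) {0}"

definition intersection_number ::
  "(real^'n \<Rightarrow> real) \<Rightarrow> (real^'n \<Rightarrow> real) \<Rightarrow> 'n::finite weighted_fan set \<Rightarrow> real" where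
  "intersection_number T\<^sub>1 T\<^sub>2 C = origin_weight (cycle_product 0 T\<^sub>1 (cycle_product 1 T\<^sub>2 C))"

end

theory Submission
  imports Defs
begin

text \<open>
  On fans refined so that the functions involved are linear on their cones, the product of two
  functions with a 2-fan is a bilinear form in the values of the functions on the primitive
  generators of the rays.  The form is symmetric because the lattice index of a two-dimensional cone
  does not depend on which of its two rays it is computed from, and linear functions are in its
  kernel by balancing.  Subtracting from \<open>M\<^sub>1 + M\<^sub>2\<close> a linear function given by an interior point of
  the Newton polytope leaves a function \<open>M\<close> with \<open>M x \<ge> e * norm x\<close> and \<open>M \<cdot> M \<cdot> F \<le> 4\<close>.  This
  bounds the 1-cycle \<open>M \<cdot> F\<close>, and by symmetry the 1-cycle \<open>max 0 l \<cdot> F\<close> for every covector \<open>l\<close>.  If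
  \<open>l\<close> vanishes on a ray of a cone and has its gradient in the plane of the cone, the bound reads
  (weight of the cone) times (covolume of the lattice in its plane) \<open>\<le> 4 / e\<^sup>2\<close>.  So only finitely
  many planes and weights occur.  By balancing, the weight is locally constant on a plane away from
  the other planes, so the planes and weights leave only finitely many cycles.
\<close>

section \<open>Planar cones\<close>

text \<open>The obstacle is that the two functions behind the estimate do not fit the definition of
  a product: \<open>M\<close> contains a real vector \<open>p\<close>, so in general it is not
  tropical regular, and \<open>max 0 l\<close> need not be linear on the cones at hand. The form is
  therefore built from values at ray generators only and makes sense for arbitrary functions; a
  linear minorant touching a function at a generator already makes its weight there nonnegative.
  Only for \<open>M\<^sub>1\<close> and \<open>M\<^sub>2\<close> is the form compared with
  intersection numbers. Each of these is computed on its own chosen representative, so fans are cut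
  along hyperplanes until the representatives coincide. The 4 counts the pairings in the expansion
  of the square of \<open>M\<^sub>1 + M\<^sub>2\<close>. One factor \<open>e\<close> is lost when
  the mass of the 1-cycle of \<open>M\<close> is bounded by its pairing with \<open>M\<close>, the
  other when one ray of the 1-cycle of \<open>max 0 l\<close> is bounded by its pairing with
  \<open>M\<close>. A plane is recorded by its integral Pluecker matrix, whose entries are bounded
  by the covolume.\<close>

definition cone2 :: "'a::real_inner \<Rightarrow> 'a \<Rightarrow> 'a set" where
  "cone2 a b = {s *\<^sub>R a + t *\<^sub>R b | s t. 0 \<le> s \<and> 0 \<le> t}"

definition ray :: "'a::real_inner \<Rightarrow> 'a set" where
  "ray a = {s *\<^sub>R a | s. 0 \<le> s}"

text \<open>The Gram determinant, that is, the squared area of the parallelogram spanned by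
  \<open>a\<close> and \<open>b\<close>. For a lattice basis of a plane it is the squared
  covolume.\<close>

definition gram :: "'a::real_inner \<Rightarrow> 'a \<Rightarrow> real" where
  "gram a b = (a \<bullet> a) * (b \<bullet> b) - (a \<bullet> b)\<^sup>2"

text \<open>The component of \<open>b\<close> orthogonal to \<open>a\<close>, multiplied by
  \<open>a \<bullet> a\<close> so that lattice vectors give a lattice vector. In the plane of
  \<open>a\<close> and \<open>b\<close> it is an inner normal of \<open>cone2 a b\<close> along
  \<open>ray a\<close>.\<close>

definition perp :: "'a::real_inner \<Rightarrow> 'a \<Rightarrow> 'a" where
  "perp a b = (a \<bullet> a) *\<^sub>R b - (a \<bullet> b) *\<^sub>R a"

lemma gram_commute: "gram a b = gram b a"
  by (simp add: gram_def inner_commute mult.commute)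

lemma gram_nonneg: "0 \<le> gram a b"
  using Cauchy_Schwarz_ineq[of a b] by (simp add: gram_def)

lemma gram_0 [simp]: "gram 0 b = 0" "gram a 0 = 0" "gram a a = 0"
  by (simp_all add: gram_def power2_eq_square)

lemma gram_comb:
  "gram (p *\<^sub>R a + q *\<^sub>R b) (r *\<^sub>R a + s *\<^sub>R b) = (p * s - q * r)\<^sup>2 * gram a b"
  by (simp add: gram_def inner_add_left inner_add_right inner_commute[of b a] power2_eq_square algebra_simps)

lemma perp_left [simp]: "perp a b \<bullet> a = 0" "a \<bullet> perp a b = 0"
  by (simp_all add: perp_def inner_diff_left inner_diff_right inner_commute)

lemma perp_right [simp]: "perp a b \<bullet> b = gram a b" "b \<bullet> perp a b = gram a b"
  by (simp_all add: perp_def gram_def inner_diff_left inner_diff_right inner_commute power2_eq_square)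

lemma perp_comb [simp]:
  "perp a b \<bullet> (s *\<^sub>R a + t *\<^sub>R b) = t * gram a b"
  "perp b a \<bullet> (s *\<^sub>R a + t *\<^sub>R b) = s * gram a b"
  by (simp_all add: inner_add_right gram_commute[of b a])

lemma norm_perp: "(norm (perp a b))\<^sup>2 = (norm a)\<^sup>2 * gram a b"
  unfolding power2_norm_eq_inner perp_def gram_def
  by (simp add: inner_diff_left inner_diff_right inner_commute[of b a] power2_eq_square algebra_simps)

text \<open>The equality case of Cauchy-Schwarz: by \<open>norm_perp\<close> the vector
  \<open>perp a b\<close> vanishes, and this is the linear relation.\<close>

lemma gram_eq_0D:
  assumes "gram a b = 0"
  obtains s t where "s \<noteq> 0 \<or> t \<noteq> 0" "s *\<^sub>R a + t *\<^sub>R b = 0"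
proof (cases "a = 0")
  case True
  then show ?thesis by (intro that[of 1 0]) auto
next
  case False
  have "perp a b = 0" using norm_perp[of a b] assms by simp
  then show ?thesis using False
    by (intro that[of "- (a \<bullet> b)" "a \<bullet> a"]) (auto simp: perp_def)
qed

lemma comb_unique:
  assumes "gram a b > 0" "s *\<^sub>R a + t *\<^sub>R b = s' *\<^sub>R a + t' *\<^sub>R b"
  shows "s = s' \<and> t = t'"
proof -
  have "t * gram a b = t' * gram a b" "s * gram a b = s' * gram a b"
    using assms(2) perp_comb by metis+
  then show ?thesis using assms(1) by simp
qed

lemma gram_pos_nz: "gram a b > 0 \<Longrightarrow> a \<noteq> 0 \<and> b \<noteq> 0 \<and> a \<noteq> b"
  by auto

lemma in_span2: "x \<in> span {a, b} \<longleftrightarrow> (\<exists>s t. x = s *\<^sub>R a + t *\<^sub>R b)"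
proof
  assume "x \<in> span {a, b}"
  then obtain s where "x - s *\<^sub>R a \<in> span {b}" by (auto simp: span_insert)
  then obtain t where "x - s *\<^sub>R a = t *\<^sub>R b" by (auto simp: span_singleton)
  then have "x = s *\<^sub>R a + t *\<^sub>R b" by (simp add: algebra_simps)
  then show "\<exists>s t. x = s *\<^sub>R a + t *\<^sub>R b" by blast
qed (auto intro!: span_add span_scale intro: span_base)

lemma in_span1: "x \<in> span {a} \<longleftrightarrow> (\<exists>s. x = s *\<^sub>R a)"
  by (auto simp: span_singleton)

lemma cone2I: "0 \<le> s \<Longrightarrow> 0 \<le> t \<Longrightarrow> s *\<^sub>R a + t *\<^sub>R b \<in> cone2 a b"
  by (auto simp: cone2_def)

lemma rayI: "0 \<le> s \<Longrightarrow> s *\<^sub>R a \<in> ray a"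
  by (auto simp: ray_def)

lemma cone2_mem [simp]: "a \<in> cone2 a b" "b \<in> cone2 a b" "0 \<in> cone2 a b"
  using cone2I[of 1 0 a b] cone2I[of 0 1 a b] cone2I[of 0 0 a b] by simp_all

lemma ray_mem [simp]: "a \<in> ray a" "0 \<in> ray a"
  using rayI[of 1 a] rayI[of 0 a] by simp_all

lemma cone2_commute: "cone2 a b = cone2 b a"
  unfolding cone2_def by (subst add.commute) blast

lemma convex_cone_cone2: "convex_cone (cone2 a b)"
  unfolding convex_cone_iff
proof (intro conjI ballI allI impI)
  fix x y assume "x \<in> cone2 a b" "y \<in> cone2 a b"
  then obtain s t s' t' where "x = s *\<^sub>R a + t *\<^sub>R b" "y = s' *\<^sub>R a + t' *\<^sub>R b"
    "0 \<le> s" "0 \<le> t" "0 \<le> s'" "0 \<le> t'" by (auto simp: cone2_def)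
  then show "x + y \<in> cone2 a b"
    using cone2I[of "s + s'" "t + t'" a b] by (simp add: algebra_simps)
next
  fix x and c :: real assume "x \<in> cone2 a b" "0 \<le> c"
  then obtain s t where "x = s *\<^sub>R a + t *\<^sub>R b" "0 \<le> s" "0 \<le> t" by (auto simp: cone2_def)
  then show "c *\<^sub>R x \<in> cone2 a b"
    using cone2I[of "c * s" "c * t" a b] \<open>0 \<le> c\<close> by (simp add: algebra_simps)
qed simp

lemma ray_eq_cone2: "ray a = cone2 a 0"
  by (auto simp: ray_def cone2_def)

lemma convex_cone_ray: "convex_cone (ray a)"
  by (simp add: ray_eq_cone2 convex_cone_cone2)

lemma convex_cone_hull_insert2: "convex_cone hull {a, b} = cone2 a b"
proof (rule hull_unique)
  show "{a, b} \<subseteq> cone2 a b" by simp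
  show "convex_cone (cone2 a b)" by (rule convex_cone_cone2)
  fix T assume T: "{a, b} \<subseteq> T" "convex_cone T"
  then show "cone2 a b \<subseteq> T"
    unfolding cone2_def using convex_cone_add[OF T(2)] convex_cone_scaleR[OF T(2)] by auto
qed

lemma convex_cone_hull_sing: "convex_cone hull {a} = ray a"
proof (rule hull_unique)
  show "{a} \<subseteq> ray a" by simp
  show "convex_cone (ray a)" by (rule convex_cone_ray)
  fix T assume T: "{a} \<subseteq> T" "convex_cone T"
  then show "ray a \<subseteq> T"
    unfolding ray_def using convex_cone_scaleR[OF T(2)] by auto
qed

lemma ray_subset_cone2: "ray a \<subseteq> cone2 a b" "ray b \<subseteq> cone2 a b"
  unfolding convex_cone_hull_sing[symmetric] convex_cone_hull_insert2[symmetric]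
  by (auto intro!: hull_mono)

lemma closed_cone2: "closed (cone2 a (b::'a::euclidean_space))"
  unfolding convex_cone_hull_insert2[symmetric] by (intro closed_convex_cone_hull) auto

lemma span_cone2: "span (cone2 a b) = span {a, b}"
proof
  show "span (cone2 a b) \<subseteq> span {a, b}"
    by (rule span_minimal) (auto simp: cone2_def intro!: span_add span_scale intro: span_base)
  show "span {a, b} \<subseteq> span (cone2 a b)" by (rule span_mono) simp
qed

lemma span_ray: "span (ray a) = span {a}"
proof
  show "span (ray a) \<subseteq> span {a}"
    by (rule span_minimal) (auto simp: ray_def in_span1)
  show "span {a} \<subseteq> span (ray a)" by (rule span_mono) simp
qed

lemma independent_pair:
  assumes "gram a b > 0" shows "independent {a, b}"
proof -
  have "a \<notin> span {b}"
  proof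
    assume "a \<in> span {b}"
    then obtain s where "a = s *\<^sub>R b" by (auto simp: in_span1)
    then have "1 *\<^sub>R a + (0::real) *\<^sub>R b = 0 *\<^sub>R a + s *\<^sub>R b" by simp
    from comb_unique[OF assms this] show False by simp
  qed
  then show ?thesis using assms gram_pos_nz[OF assms]
    by (simp add: independent_insert)
qed

lemma dim_cone2:
  fixes a b :: "'a::euclidean_space"
  assumes "gram a b > 0" shows "dim (cone2 a b) = 2"
proof -
  have "dim (cone2 a b) = dim {a, b}" by (metis span_cone2 dim_span)
  also have "\<dots> = card {a, b}" by (rule dim_eq_card_independent[OF independent_pair[OF assms]])
  finally show ?thesis using gram_pos_nz[OF assms] by simp
qed

lemma dim_ray: 
  fixes a :: "'a::euclidean_space"
  assumes "a \<noteq> 0" shows "dim (ray a) = 1"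
proof -
  have "dim (ray a) = dim {a}" by (metis span_ray dim_span)
  also have "\<dots> = card {a}" using assms by (intro dim_eq_card_independent) auto
  finally show ?thesis by simp
qed

text \<open>On the plane, \<open>perp a b\<close> and \<open>perp b a\<close> read off the two
  coordinates up to the positive factor \<open>gram a b\<close>.\<close>

lemma cone2_functionals:
  assumes "gram a b > 0" "x \<in> span {a, b}"
  shows "x \<in> cone2 a b \<longleftrightarrow> perp a b \<bullet> x \<ge> 0 \<and> perp b a \<bullet> x \<ge> 0"
proof -
  obtain s t where x: "x = s *\<^sub>R a + t *\<^sub>R b" using assms(2) by (auto simp: in_span2)
  have "x \<in> cone2 a b \<longleftrightarrow> 0 \<le> s \<and> 0 \<le> t"
    unfolding cone2_def mem_Collect_eq x using comb_unique[OF assms(1)] by blast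
  then show ?thesis using assms(1) by (auto simp: x zero_le_mult_iff)
qed

lemma perp_nonneg_cone2: 
  assumes "x \<in> cone2 a b" shows "perp a b \<bullet> x \<ge> 0" "perp b a \<bullet> x \<ge> 0"
  using assms gram_nonneg[of a b] by (auto simp: cone2_def)

lemma pointed_subset:
  assumes "strongly_convex_cone \<sigma>" "\<tau> \<subseteq> \<sigma>" "0 \<in> \<tau>"
  shows "strongly_convex_cone \<tau>"
proof -
  have "\<tau> \<inter> uminus ` \<tau> \<subseteq> {0}" using assms(1,2) unfolding strongly_convex_cone_def by blast
  moreover have "0 \<in> uminus ` \<tau>" using assms(3) by (auto intro!: image_eqI[where x=0])
  ultimately show ?thesis using assms(3) unfolding strongly_convex_cone_def by blast
qed

section \<open>Faces\<close>

text \<open>Faces are defined by open segments, and \<open>p + q\<close> is the midpoint of the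
  segment from \<open>2 *\<^sub>R p\<close> to \<open>2 *\<^sub>R q\<close>; scaling back uses that
  a face of a cone is conic.\<close>

lemma face_of_add:
  fixes S :: "'a::euclidean_space set"
  assumes "convex_cone S" "T face_of S" "p \<in> S" "q \<in> S" "p + q \<in> T"
  shows "p \<in> T"
proof -
  have con: "conic T" using face_of_conic[OF _ assms(2)] assms(1) by (simp add: convex_cone_def)
  have "(2::real) *\<^sub>R p \<in> T"
  proof (cases "p = q")
    case True
    then show ?thesis using assms(5) by (simp add: scaleR_2)
  next
    case False
    have "p + q \<in> open_segment (2 *\<^sub>R p) (2 *\<^sub>R q)"
      using False by (auto simp: in_segment intro!: exI[of _ "1/2"])
    moreover have "2 *\<^sub>R p \<in> S" "2 *\<^sub>R q \<in> S"
      using assms(1,3,4) by (auto intro: convex_cone_scaleR)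
    ultimately show ?thesis using assms(2,5) unfolding face_of_def by blast
  qed
  then have "(1/2::real) *\<^sub>R (2::real) *\<^sub>R p \<in> T" using con conicD[of T _ "1/2"] by fastforce
  then show ?thesis by simp
qed

text \<open>A face containing a point with positive coefficient at a generator contains this
  generator by \<open>face_of_add\<close>, so it is determined by which of \<open>a\<close> and
  \<open>b\<close> it contains. The degenerate choice \<open>b = 0\<close> yields the faces of a
  ray.\<close>

lemma face_cone2_cases:
  fixes a b :: "'a::euclidean_space"
  assumes "T face_of cone2 a b" "T \<noteq> {}"
  shows "T = {0} \<or> T = ray a \<or> T = ray b \<or> T = cone2 a b"
proof -
  have con: "conic T" using face_of_conic[OF _ assms(1)] convex_cone_cone2[of a b] by (simp add: convex_cone_def)
  have cT: "convex_cone T"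
    using con assms(2) face_of_imp_convex[OF assms(1)] by (simp add: convex_cone_def)
  have T0: "0 \<in> T" using cT by (rule convex_cone_contains_0)
  have *: "(s > 0 \<longrightarrow> a \<in> T) \<and> (t > 0 \<longrightarrow> b \<in> T)"
    if "s *\<^sub>R a + t *\<^sub>R b \<in> T" "0 \<le> s" "0 \<le> t" for s t
  proof -
    have S: "s *\<^sub>R a \<in> cone2 a b" "t *\<^sub>R b \<in> cone2 a b"
      using cone2I[of s 0 a b] cone2I[of 0 t a b] that by auto
    have "s *\<^sub>R a \<in> T" "t *\<^sub>R b \<in> T"
      using face_of_add[OF convex_cone_cone2 assms(1)] S that(1) by (metis add.commute)+
    moreover have "y \<in> T" if "r *\<^sub>R y \<in> T" "r > 0" for r :: real and y
      using conicD[OF con that(1), of "1/r"] that(2) by simp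
    ultimately show ?thesis by blast
  qed
  have sub: "T \<subseteq> cone2 a b" using assms(1) face_of_imp_subset by blast
  have ab: "T = cone2 a b" if "a \<in> T" "b \<in> T"
    using sub that cT hull_minimal[of "{a,b}" T convex_cone] by (auto simp: convex_cone_hull_insert2)
  have ra: "ray a \<subseteq> T" if "a \<in> T"
    using that cT hull_minimal[of "{a}" T convex_cone] by (auto simp: convex_cone_hull_sing)
  have rb: "ray b \<subseteq> T" if "b \<in> T"
    using that cT hull_minimal[of "{b}" T convex_cone] by (auto simp: convex_cone_hull_sing)
  have sh: "\<exists>s t. x = s *\<^sub>R a + t *\<^sub>R b \<and> 0 \<le> s \<and> 0 \<le> t \<and> (a \<notin> T \<longrightarrow> s = 0) \<and> (b \<notin> T \<longrightarrow> t = 0)" if "x \<in> T" for x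
  proof -
    have "x \<in> cone2 a b" using sub that by blast
    then obtain s t where x: "x = s *\<^sub>R a + t *\<^sub>R b" "0 \<le> s" "0 \<le> t"
      unfolding cone2_def by blast
    then show ?thesis using *[of s t] that by force
  qed
  show ?thesis
  proof (cases "a \<in> T"; cases "b \<in> T")
    assume "a \<in> T" "b \<notin> T"
    then have "T \<subseteq> ray a" using sh by (fastforce intro: rayI)
    then show ?thesis using ra \<open>a \<in> T\<close> by blast
  next
    assume "a \<notin> T" "b \<in> T"
    then have "T \<subseteq> ray b" using sh by (fastforce intro: rayI)
    then show ?thesis using rb \<open>b \<in> T\<close> by blast
  next
    assume "a \<notin> T" "b \<notin> T"
    then have "T \<subseteq> {0}" using sh by fastforce
    then show ?thesis using T0 by blast
  qed (use ab in blast)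
qed

lemma ray_0 [simp]: "ray 0 = {0}"
  by (auto simp: ray_def)

lemma face_ray_cases:
  fixes a :: "'a::euclidean_space"
  assumes "T face_of ray a" "T \<noteq> {}"
  shows "T = {0} \<or> T = ray a"
  using face_cone2_cases[of T a 0] assms by (auto simp: ray_eq_cone2[symmetric])

lemma ray_face_cone2:
  fixes a b :: "'a::euclidean_space"
  assumes "gram a b > 0"
  shows "ray a face_of cone2 a b"
proof -
  have "ray a = cone2 a b \<inter> {x. perp a b \<bullet> x = 0}"
  proof (intro set_eqI iffI)
    fix x assume "x \<in> cone2 a b \<inter> {x. perp a b \<bullet> x = 0}"
    then obtain s t where x: "x = s *\<^sub>R a + t *\<^sub>R b" "0 \<le> s" "0 \<le> t" "perp a b \<bullet> x = 0"
      by (auto simp: cone2_def)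
    then have "t = 0" using assms by simp
    then show "x \<in> ray a" using x by (simp add: rayI)
  qed (use ray_subset_cone2 in \<open>auto simp: ray_def\<close>)
  moreover have "cone2 a b \<inter> {x. perp a b \<bullet> x = 0} face_of cone2 a b"
    using convex_cone_cone2[of a b] perp_nonneg_cone2[of _ a b]
    by (intro face_of_Int_supporting_hyperplane_ge) (auto simp: convex_cone_def)
  ultimately show ?thesis by simp
qed

lemma zero_face_ray:
  fixes a :: "'a::euclidean_space"
  shows "{0} face_of ray a"
proof -
  have "{0} = ray a \<inter> {x. a \<bullet> x = 0}" by (auto simp: ray_def)
  moreover have "ray a \<inter> {x. a \<bullet> x = 0} face_of ray a"
    using convex_cone_ray[of a]
    by (intro face_of_Int_supporting_hyperplane_ge) (auto simp: convex_cone_def ray_def)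
  ultimately show ?thesis by simp
qed

lemma zero_face_cone2:
  fixes a b :: "'a::euclidean_space"
  assumes "gram a b > 0"
  shows "{0} face_of cone2 a b"
  using zero_face_ray ray_face_cone2[OF assms] face_of_trans by blast

section \<open>Lattice vectors and rational cones\<close>

lemma lattice_0 [simp]: "0 \<in> lattice_points"
  by (simp add: lattice_points_def)

lemma lattice_add: "x \<in> lattice_points \<Longrightarrow> y \<in> lattice_points \<Longrightarrow> x + y \<in> lattice_points"
  by (simp add: lattice_points_def)

lemma lattice_diff: "x \<in> lattice_points \<Longrightarrow> y \<in> lattice_points \<Longrightarrow> x - y \<in> lattice_points"
  by (simp add: lattice_points_def)

lemma lattice_scaleR: "c \<in> \<int> \<Longrightarrow> x \<in> lattice_points \<Longrightarrow> c *\<^sub>R x \<in> lattice_points"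
  by (simp add: lattice_points_def)

lemma lattice_sum: "(\<And>i. i \<in> I \<Longrightarrow> f i \<in> lattice_points) \<Longrightarrow> sum f I \<in> lattice_points"
  by (induction I rule: infinite_finite_induct) (auto intro: lattice_add)

lemma lattice_inner: "x \<in> lattice_points \<Longrightarrow> y \<in> lattice_points \<Longrightarrow> x \<bullet> y \<in> \<int>"
  by (auto simp: lattice_points_def inner_vec_def intro!: Ints_sum)

lemma lattice_perp: "a \<in> lattice_points \<Longrightarrow> b \<in> lattice_points \<Longrightarrow> perp a b \<in> lattice_points"
  unfolding perp_def by (intro lattice_diff lattice_scaleR lattice_inner)

lemma lattice_gram: "a \<in> lattice_points \<Longrightarrow> b \<in> lattice_points \<Longrightarrow> gram a b \<in> \<int>"
  unfolding gram_def by (intro Ints_diff Ints_mult Ints_power lattice_inner)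

lemma lattice_axis: "axis i 1 \<in> (lattice_points :: (real^'n) set)"
  by (simp add: lattice_points_def axis_def)

lemma Ints_ge_1: "(x::real) \<in> \<int> \<Longrightarrow> x > 0 \<Longrightarrow> x \<ge> 1"
  by (auto elim!: Ints_cases)

lemma convex_cone_sum:
  assumes "convex_cone S" "\<And>i. i \<in> I \<Longrightarrow> f i \<in> S"
  shows "sum f I \<in> S"
  using assms(2) by (induction I rule: infinite_finite_induct)
    (auto intro: convex_cone_add[OF assms(1)] simp: convex_cone_contains_0[OF assms(1)])

text \<open>In a relation among at most three vectors in which both signs occur, one sign occurs
  exactly once, and solving for that vector writes it as a nonnegative combination of the others. If
  only one sign occurs, pointedness forces a vector with nonzero coefficient to be 0, which lies in
  every hull.\<close>

lemma redundant_generator: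
  fixes S :: "'a::real_vector set"
  assumes "finite S" "dependent S" "card S \<le> 3"
    and pt: "\<And>x. x \<in> convex_cone hull S \<Longrightarrow> - x \<in> convex_cone hull S \<Longrightarrow> x = 0"
  shows "\<exists>x\<in>S. x \<in> convex_cone hull (S - {x})"
proof -
  obtain u where u: "\<exists>v\<in>S. u v \<noteq> 0" "(\<Sum>v\<in>S. u v *\<^sub>R v) = 0"
    using assms(1,2) by (auto simp: dependent_finite)
  have solve: "\<exists>x\<in>S. x \<in> convex_cone hull (S - {x})"
    if "(\<Sum>v\<in>S. u v *\<^sub>R v) = 0" "x \<in> S" "u x < 0" "\<And>y. y \<in> S \<Longrightarrow> y \<noteq> x \<Longrightarrow> u y \<ge> 0" for u x
  proof -
    have "(\<Sum>v\<in>S. u v *\<^sub>R v) = u x *\<^sub>R x + (\<Sum>v\<in>S-{x}. u v *\<^sub>R v)"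
      using assms(1) that(2) by (rule sum.remove)
    then have "(\<Sum>v\<in>S-{x}. u v *\<^sub>R v) = (- u x) *\<^sub>R x" using that(1)
      by (simp add: eq_neg_iff_add_eq_0 add.commute)
    moreover have "(\<Sum>v\<in>S-{x}. u v *\<^sub>R v) \<in> convex_cone hull (S - {x})"
      by (rule convex_cone_sum[OF convex_cone_convex_cone_hull])
        (use that in \<open>force intro: convex_cone_hull_mul hull_inc\<close>)
    ultimately have "(- u x) *\<^sub>R x \<in> convex_cone hull (S - {x})" by simp
    then have "(1 / - u x) *\<^sub>R (- u x) *\<^sub>R x \<in> convex_cone hull (S - {x})"
      by (rule convex_cone_hull_mul) (use that(3) in simp)
    moreover have "(1 / - u x) *\<^sub>R (- u x) *\<^sub>R x = x" using that(3) by simp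
    ultimately show ?thesis using that(2) by auto
  qed
  have negs: "\<exists>x\<in>S. x \<in> convex_cone hull (S - {x})"
    if rel: "(\<Sum>v\<in>S. u v *\<^sub>R v) = 0" and ge: "\<And>y. y \<in> S \<Longrightarrow> u y \<ge> 0" and nz: "x \<in> S" "u x \<noteq> 0" for u x
  proof -
    have "(\<Sum>v\<in>S. u v *\<^sub>R v) = u x *\<^sub>R x + (\<Sum>v\<in>S-{x}. u v *\<^sub>R v)"
      using assms(1) that(3) by (rule sum.remove)
    then have "(\<Sum>v\<in>S-{x}. u v *\<^sub>R v) = - (u x *\<^sub>R x)" using rel
      by (simp add: eq_neg_iff_add_eq_0 add.commute)
    moreover have "(\<Sum>v\<in>S-{x}. u v *\<^sub>R v) \<in> convex_cone hull S"
      by (rule convex_cone_sum[OF convex_cone_convex_cone_hull])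
        (use ge in \<open>force intro: convex_cone_hull_mul hull_inc\<close>)
    moreover have "u x *\<^sub>R x \<in> convex_cone hull S"
      using ge nz by (intro convex_cone_hull_mul hull_inc) auto
    ultimately have "u x *\<^sub>R x = 0" using pt by metis
    then have "x = 0" using nz by simp
    then show ?thesis using nz convex_cone_hull_contains_0 by blast
  qed
  define Pos Neg where "Pos = {v\<in>S. u v > 0}" and "Neg = {v\<in>S. u v < 0}"
  have fin: "finite Pos" "finite Neg" using assms(1) by (auto simp: Pos_def Neg_def)
  have rel': "(\<Sum>v\<in>S. (- u v) *\<^sub>R v) = 0" using u(2) by (simp add: sum_negf)
  consider "Neg = {}" | "Pos = {}" | "card Neg \<ge> 1" "card Pos \<ge> 1"
    using fin by (metis One_nat_def Suc_leI card_gt_0_iff)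
  then show ?thesis
  proof cases
    case 1
    then have "\<And>y. y \<in> S \<Longrightarrow> u y \<ge> 0" by (force simp: Neg_def)
    then show ?thesis using negs[of u] u by blast
  next
    case 2
    then have "\<And>y. y \<in> S \<Longrightarrow> - u y \<ge> 0" by (force simp: Pos_def)
    then show ?thesis using negs[of "\<lambda>v. - u v"] u rel' by fastforce
  next
    case 3
    have "card Neg + card Pos = card (Neg \<union> Pos)"
      using fin by (subst card_Un_disjoint) (auto simp: Neg_def Pos_def)
    also have "\<dots> \<le> card S" using assms(1) by (intro card_mono) (auto simp: Neg_def Pos_def)
    finally have "card Neg = 1 \<or> card Pos = 1" using 3 assms(3) by linarith
    then show ?thesis
    proof
      assume "card Neg = 1"
      then obtain x where x: "Neg = {x}" by (rule card_1_singletonE)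
      then show ?thesis by (intro solve[of u x] u) (auto simp: Neg_def not_less[symmetric])
    next
      assume "card Pos = 1"
      then obtain x where x: "Pos = {x}" by (rule card_1_singletonE)
      then show ?thesis
        by (intro solve[of "\<lambda>v. - u v" x] rel') (auto simp: Pos_def not_less[symmetric])
    qed
  qed
qed

text \<open>A generating set of least size has no redundant element, so by
  \<open>redundant_generator\<close> its subsets of at most three elements are independent. Three
  elements would then exceed the dimension.\<close>

lemma rational_cone_cases:
  fixes \<sigma> :: "(real^'n) set"
  assumes "rational_polyhedral_cone \<sigma>" "strongly_convex_cone \<sigma>" "dim \<sigma> \<le> 2"
  obtains "\<sigma> = {0}"
    | a where "a \<in> lattice_points" "a \<noteq> 0" "\<sigma> = ray a"
    | a b where "a \<in> lattice_points" "b \<in> lattice_points" "gram a b > 0" "\<sigma> = cone2 a b"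
proof -
  define Q where "Q S \<longleftrightarrow> finite S \<and> S \<subseteq> lattice_points \<and> \<sigma> = convex_cone hull S" for S
  obtain S where S: "Q S" "\<And>T. Q T \<Longrightarrow> card S \<le> card T"
    using assms(1) ex_has_least_nat[of Q _ card] unfolding rational_polyhedral_cone_def Q_def by metis
  have fin: "finite S" and lat: "S \<subseteq> lattice_points" and \<sigma>: "\<sigma> = convex_cone hull S"
    using S(1) by (auto simp: Q_def)
  have pt: "x = 0" if "x \<in> \<sigma>" "- x \<in> \<sigma>" for x
  proof -
    have "x \<in> uminus ` \<sigma>" using that(2) by (metis imageI minus_minus)
    then show ?thesis using that(1) assms(2) unfolding strongly_convex_cone_def by blast
  qed
  have irr: "x \<notin> convex_cone hull (T - {x})" if "x \<in> T" "T \<subseteq> S" for x T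
  proof
    assume "x \<in> convex_cone hull (T - {x})"
    then have "x \<in> convex_cone hull (S - {x})"
      using that hull_mono[of "T - {x}" "S - {x}" convex_cone] by blast
    then have "convex_cone hull (insert x (S - {x})) = convex_cone hull (S - {x})"
      by (rule hull_redundant)
    then have "Q (S - {x})" using that fin lat \<sigma> by (auto simp: Q_def insert_absorb)
    then have "card S \<le> card (S - {x})" by (rule S(2))
    then show False using that fin by (metis card_Diff1_less in_mono not_less)
  qed
  have ind: "independent T" if "T \<subseteq> S" "card T \<le> 3" for T
  proof (rule ccontr)
    assume "\<not> independent T"
    have "convex_cone hull T \<subseteq> \<sigma>" unfolding \<sigma> using that by (intro hull_mono)
    then have "\<exists>x\<in>T. x \<in> convex_cone hull (T - {x})"
      using that \<open>\<not> independent T\<close> finite_subset[OF that(1) fin] pt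
      by (intro redundant_generator) auto
    then show False using irr that by blast
  qed
  have "card S \<le> 2"
  proof (rule ccontr)
    assume "\<not> card S \<le> 2"
    then obtain T where T: "T \<subseteq> S" "card T = 3" by (metis obtain_subset_with_card_n nat_le_linear not_less_eq_eq numeral_3_eq_3 numeral_2_eq_2)
    then have "card T \<le> dim \<sigma>" using ind[of T] hull_subset[of S convex_cone] \<sigma>
      by (intro independent_card_le_dim) auto
    then show False using T assms(3) by simp
  qed
  then consider "card S = 0" | "card S = 1" | "card S = 2" by linarith
  then show ?thesis
  proof cases
    case 1
    then show ?thesis using that(1) fin \<sigma> by simp
  next
    case 2
    then obtain a where a: "S = {a}" by (rule card_1_singletonE)
    then have "a \<noteq> 0" using ind[of S] by auto
    then show ?thesis using that(2)[of a] a lat \<sigma> by (simp add: convex_cone_hull_sing)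
  next
    case 3
    then obtain a b where a: "S = {a, b}" "a \<noteq> b" by (auto simp: card_2_iff)
    have "independent {a,b}" using ind[of S] a 3 by simp
    have "gram a b \<noteq> 0"
    proof
      assume "gram a b = 0"
      then obtain s t where st: "s \<noteq> 0 \<or> t \<noteq> 0" "s *\<^sub>R a + t *\<^sub>R b = 0" by (rule gram_eq_0D)
      have "dependent {a,b}" unfolding dependent_finite[OF finite.insertI[OF finite.insertI[OF finite.emptyI]]]
        using st a(2) by (intro exI[of _ "\<lambda>x. if x = a then s else t"]) auto
      then show False using \<open>independent {a,b}\<close> by simp
    qed
    then have "gram a b > 0" using gram_nonneg[of a b] by simp
    then show ?thesis using that(3)[of a b] a lat \<sigma> by (simp add: convex_cone_hull_insert2)
  qed
qed

text \<open>The values of \<open>q\<close> on the group \<open>L\<close> form a nonzero subgroup of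
  the integers. The vector \<open>v\<close> attains the least positive value, and Euclidean division
  shows that it generates.\<close>

lemma lattice_functional_generator:
  fixes L :: "(real^'n) set"
  assumes "L \<subseteq> lattice_points" "\<And>x y m. x \<in> L \<Longrightarrow> y \<in> L \<Longrightarrow> x - of_int m *\<^sub>R y \<in> L"
    and "q \<in> lattice_points" "z0 \<in> L" "q \<bullet> z0 > 0"
  obtains v where "v \<in> L" "q \<bullet> v > 0" "\<And>z. z \<in> L \<Longrightarrow> \<exists>m::int. q \<bullet> z = of_int m * (q \<bullet> v)"
proof -
  define P where "P n \<longleftrightarrow> n > 0 \<and> (\<exists>v\<in>L. q \<bullet> v = real n)" for n
  have int: "\<exists>k::int. q \<bullet> z = of_int k" if "z \<in> L" for z
    using lattice_inner[of q z] assms(1,3) that by (auto elim!: Ints_cases)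
  obtain k :: int where k: "q \<bullet> z0 = of_int k" using int assms(4) by blast
  then have "P (nat k)" using assms(4,5) by (auto simp: P_def)
  then have "P (LEAST n. P n)" by (rule LeastI)
  moreover define n where "n = (LEAST n. P n)"
  ultimately obtain v where v: "n > 0" "v \<in> L" "q \<bullet> v = real n" by (auto simp: P_def)
  have "\<exists>m::int. q \<bullet> z = of_int m * (q \<bullet> v)" if z: "z \<in> L" for z
  proof -
    obtain k :: int where k: "q \<bullet> z = of_int k" using int z by blast
    define w where "w = z - of_int (k div int n) *\<^sub>R v"
    have "w \<in> L" unfolding w_def by (rule assms(2)[OF z v(2)])
    have "q \<bullet> w = of_int (k - (k div int n) * int n)"
      by (simp add: w_def inner_diff_right k v(3))
    also have "\<dots> = of_int (k mod int n)" by (simp only: minus_div_mult_eq_mod)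
    finally have qw: "q \<bullet> w = of_int (k mod int n)" .
    have "k mod int n = 0"
    proof (rule ccontr)
      assume "k mod int n \<noteq> 0"
      then have pos: "k mod int n > 0" using v(1) pos_mod_sign[of "int n" k] by linarith
      then have "P (nat (k mod int n))" unfolding P_def using qw \<open>w \<in> L\<close> by (auto intro!: bexI[of _ w])
      then have "n \<le> nat (k mod int n)" unfolding n_def by (rule Least_le)
      moreover have "k mod int n < int n" using v(1) by simp
      ultimately show False using pos by linarith
    qed
    then have "k = (k div int n) * int n" by (metis add.right_neutral div_mult_mod_eq)
    then show ?thesis using k v(3) by (intro exI[of _ "k div int n"]) (metis of_int_mult of_int_of_nat_eq)
  qed
  then show ?thesis using that[of v] v by simp
qed

section \<open>Primitive generators and lattice normals\<close>

definition prim :: "real^'n \<Rightarrow> bool" where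
  "prim u \<longleftrightarrow> u \<in> lattice_points \<and> u \<noteq> 0 \<and>
     (\<forall>z \<in> lattice_points \<inter> span {u}. \<exists>m::int. z = of_int m *\<^sub>R u)"

lemma span_rays_eq:
  assumes "ray a = ray b" shows "span {a} = span {b}"
  using assms span_ray by metis

text \<open>Two primitive vectors on one line are integer multiples of each other, so they agree up
  to sign; the common ray excludes the minus sign.\<close>

lemma prim_unique:
  assumes "prim u" "prim w" "ray u = ray w" shows "u = w"
proof -
  have "w \<in> span {u}" "u \<in> span {w}" using span_rays_eq[OF assms(3)] by (metis singletonI span_base)+
  then have "\<exists>m::int. w = of_int m *\<^sub>R u" "\<exists>k::int. u = of_int k *\<^sub>R w"
    using assms(1,2) unfolding prim_def by simp_all
  then obtain m k :: int where m: "w = of_int m *\<^sub>R u" "u = of_int k *\<^sub>R w" by metis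
  have "(of_int (k * m) - 1) *\<^sub>R u = 0" using arg_cong[OF m(1), of "\<lambda>x. of_int k *\<^sub>R x"]
    unfolding m(2)[symmetric] by (simp add: scaleR_diff_left)
  then have "of_int (k * m) = (1::real)" using assms(1) unfolding prim_def scaleR_eq_0_iff by simp
  then have "k * m = 1" by linarith
  then have "m = 1 \<or> m = - 1" by (metis zmult_eq_1_iff)
  moreover have "m \<noteq> - 1"
  proof
    assume "m = - 1"
    then have "w = - u" using m by simp
    moreover have "w \<in> ray u" using assms(3) by simp
    ultimately obtain s where "- u = s *\<^sub>R u" "0 \<le> s" by (auto simp: ray_def)
    then have "(s + 1) *\<^sub>R u = 0" by (simp add: scaleR_add_left) (metis add.left_inverse)
    then show False using assms(1) \<open>0 \<le> s\<close> by (auto simp: prim_def)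
  qed
  ultimately show ?thesis using m by simp
qed

lemma prim_is_lattice_normal: "prim u \<Longrightarrow> is_lattice_normal (ray u) {0} u"
  unfolding is_lattice_normal_def span_ray prim_def
  by (auto simp: span_base intro!: bexI[of _ u])

lemma is_lattice_normal_prim:
  assumes "is_lattice_normal (ray a) {0} u" "a \<in> lattice_points" "a \<noteq> 0"
  shows "prim u \<and> ray u = ray a"
proof -
  have u: "u \<in> lattice_points" "u \<in> ray a"
    and gen: "\<And>z. z \<in> lattice_points \<inter> span {a} \<Longrightarrow> \<exists>m::int. z = of_int m *\<^sub>R u"
    using assms(1) by (auto simp: is_lattice_normal_def span_ray)
  then obtain s where s: "u = s *\<^sub>R a" "0 \<le> s" by (auto simp: ray_def)
  have "u \<noteq> 0" using gen[of a] assms(2,3) by (auto simp: span_base)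
  then have "s > 0" using s by auto
  have "ray u = ray a"
  proof
    show "ray u \<subseteq> ray a" using s by (auto simp: ray_def)
    show "ray a \<subseteq> ray u"
    proof
      fix x assume "x \<in> ray a"
      then obtain r where "x = r *\<^sub>R a" "0 \<le> r" by (auto simp: ray_def)
      then have "x = (r / s) *\<^sub>R u" "0 \<le> r / s" using s \<open>s > 0\<close> by auto
      then show "x \<in> ray u" by (metis rayI)
    qed
  qed
  moreover have "span {u} = span {a}" using span_rays_eq[OF calculation] .
  ultimately show ?thesis using u(1) \<open>u \<noteq> 0\<close> gen by (auto simp: prim_def)
qed

lemma ex_prim:
  fixes a :: "real^'n"
  assumes "a \<in> lattice_points" "a \<noteq> 0"
  obtains u where "prim u" "ray u = ray a"
proof -
  let ?L = "lattice_points \<inter> span {a}"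
  obtain v where v: "v \<in> ?L" "a \<bullet> v > 0" "\<And>z. z \<in> ?L \<Longrightarrow> \<exists>m::int. a \<bullet> z = of_int m * (a \<bullet> v)"
  proof (rule lattice_functional_generator[of ?L a a])
    show "x - of_int m *\<^sub>R y \<in> ?L" if "x \<in> ?L" "y \<in> ?L" for x y and m :: int
      using that by (simp add: lattice_diff lattice_scaleR span_diff span_scale)
    show "a \<in> ?L" using assms(1) by (simp add: span_base)
  qed (use assms in auto)
  obtain r where r: "v = r *\<^sub>R a" using v(1) by (auto simp: in_span1)
  have "r > 0" 
  proof -
    have "r * (a \<bullet> a) > 0" using v(2) r by simp
    then show ?thesis by (meson inner_ge_zero zero_less_mult_pos2 less_le_not_le mult_nonneg_nonneg not_less mult_nonpos_nonneg)
  qed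
  have "is_lattice_normal (ray a) {0} v"
    unfolding is_lattice_normal_def span_ray
  proof (intro conjI ballI)
    show "v \<in> lattice_points \<inter> span {a}" by (rule v)
    show "\<exists>s\<in>ray a. \<exists>t\<in>span {0}. v = s + t" using r \<open>r > 0\<close> by (auto intro!: rayI)
    fix z assume z: "z \<in> lattice_points \<inter> span {a}"
    then obtain m :: int where m: "a \<bullet> z = of_int m * (a \<bullet> v)" using v(3) by blast
    obtain r' where r': "z = r' *\<^sub>R a" using z by (auto simp: in_span1)
    have "r' * (a \<bullet> a) = (of_int m * r) * (a \<bullet> a)" using m r r' by simp
    then have "r' = of_int m * r" using assms(2) by simp
    then show "\<exists>m::int. z - of_int m *\<^sub>R v \<in> span {0}" using r r' by (auto intro!: exI[of _ m])
  qed
  then show ?thesis using is_lattice_normal_prim assms that by blast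
qed

text \<open>Modulo the trivial span of \<open>{0}\<close> a lattice normal is unique, which removes
  the choice hidden in \<open>lattice_normal\<close>.\<close>

lemma lattice_normal_prim: 
  assumes "prim u" shows "lattice_normal (ray u) {0} = u"
proof -
  have "is_lattice_normal (ray u) {0} (lattice_normal (ray u) {0})"
    unfolding lattice_normal_def using prim_is_lattice_normal[OF assms] by (rule someI)
  then show ?thesis
    using is_lattice_normal_prim[of u] assms prim_unique[of _ u] by (auto simp: prim_def)
qed

text \<open>Within the plane, \<open>perp a b\<close> vanishes exactly on the span of
  \<open>a\<close>, so a lattice vector whose value generates all values of \<open>perp a b\<close>
  generates the quotient lattice.\<close>

lemma ex_lattice_normal_cone2:
  fixes a b :: "real^'n"
  assumes "a \<in> lattice_points" "b \<in> lattice_points" "gram a b > 0"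
  shows "\<exists>v. is_lattice_normal (cone2 a b) (ray a) v"
proof -
  let ?L = "lattice_points \<inter> span {a, b}"
  obtain v where v: "v \<in> ?L" "perp a b \<bullet> v > 0"
      "\<And>z. z \<in> ?L \<Longrightarrow> \<exists>m::int. perp a b \<bullet> z = of_int m * (perp a b \<bullet> v)"
  proof (rule lattice_functional_generator[of ?L "perp a b" b])
    show "x - of_int m *\<^sub>R y \<in> ?L" if "x \<in> ?L" "y \<in> ?L" for x y and m :: int
      using that by (simp add: lattice_diff lattice_scaleR span_diff span_scale)
    show "b \<in> ?L" using assms(2) by (simp add: span_base)
  qed (use assms in \<open>auto simp: lattice_perp\<close>)
  obtain r t where r: "v = r *\<^sub>R a + t *\<^sub>R b" using v(1) by (auto simp: in_span2)
  have "t > 0" using v(2) assms(3) r by (auto simp: zero_less_mult_iff)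
  have "is_lattice_normal (cone2 a b) (ray a) v"
    unfolding is_lattice_normal_def span_ray span_cone2
  proof (intro conjI ballI)
    show "v \<in> lattice_points \<inter> span {a, b}" by (rule v)
    show "\<exists>p\<in>cone2 a b. \<exists>q\<in>span {a}. v = p + q"
      using r \<open>t > 0\<close> cone2I[of 0 t a b]
      by (intro bexI[of _ "t *\<^sub>R b"] bexI[of _ "r *\<^sub>R a"]) (auto simp: in_span1)
    fix z assume z: "z \<in> lattice_points \<inter> span {a, b}"
    then obtain m :: int where m: "perp a b \<bullet> z = of_int m * (perp a b \<bullet> v)" using v(3) by blast
    obtain r' t' where r': "z = r' *\<^sub>R a + t' *\<^sub>R b" using z by (auto simp: in_span2)
    have "t' * gram a b = (of_int m * t) * gram a b" using m r r' by simp
    then have "t' = of_int m * t" using assms(3) by simp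
    then have "z - of_int m *\<^sub>R v = (r' - of_int m * r) *\<^sub>R a" using r r' by (simp add: algebra_simps)
    then show "\<exists>m::int. z - of_int m *\<^sub>R v \<in> span {a}" by (metis in_span1)
  qed
  then show ?thesis by blast
qed

lemma lattice_normal_cone2:
  fixes a b :: "real^'n"
  assumes "a \<in> lattice_points" "b \<in> lattice_points" "gram a b > 0"
  defines "v \<equiv> lattice_normal (cone2 a b) (ray a)"
  shows "v \<in> lattice_points" "v \<in> span {a, b}"
    "\<And>z. z \<in> lattice_points \<Longrightarrow> z \<in> span {a, b} \<Longrightarrow> \<exists>m::int. z - of_int m *\<^sub>R v \<in> span {a}"
    "\<exists>s t. v = s *\<^sub>R a + t *\<^sub>R b \<and> t > 0"
    "perp a b \<bullet> v > 0"
proof -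
  have "is_lattice_normal (cone2 a b) (ray a) v"
    unfolding v_def lattice_normal_def using ex_lattice_normal_cone2[OF assms(1-3)] by (rule someI_ex)
  note * = this[unfolded is_lattice_normal_def span_ray span_cone2]
  from * show "v \<in> lattice_points" "v \<in> span {a, b}"
    "\<And>z. z \<in> lattice_points \<Longrightarrow> z \<in> span {a, b} \<Longrightarrow> \<exists>m::int. z - of_int m *\<^sub>R v \<in> span {a}"
    by auto
  from * obtain p q where pq: "p \<in> cone2 a b" "q \<in> span {a}" "v = p + q" by blast
  then obtain s t r where p: "p = s *\<^sub>R a + t *\<^sub>R b" "0 \<le> t" "q = r *\<^sub>R a"
    by (auto simp: cone2_def in_span1)
  then have v: "v = (s + r) *\<^sub>R a + t *\<^sub>R b" using pq by (simp add: algebra_simps)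
  \<comment> \<open>Otherwise \<open>v\<close> lies on the line of \<open>a\<close>, and then so
    does \<open>b\<close>.\<close>
  have "t \<noteq> 0"
  proof
    assume "t = 0"
    have "b \<in> lattice_points \<inter> span {a, b}" using assms(2) by (simp add: span_base)
    then obtain m :: int where "b - of_int m *\<^sub>R v \<in> span {a}" using * by blast
    then obtain k where "b - of_int m *\<^sub>R v = k *\<^sub>R a" by (auto simp: in_span1)
    then have "0 *\<^sub>R a + 1 *\<^sub>R b = (k + of_int m * (s + r)) *\<^sub>R a + 0 *\<^sub>R b"
      using v \<open>t = 0\<close> by (simp add: algebra_simps)
    from comb_unique[OF assms(3) this] show False by simp
  qed
  then show "\<exists>s t. v = s *\<^sub>R a + t *\<^sub>R b \<and> t > 0" using v p(2) by force
  then show "perp a b \<bullet> v > 0" using assms(3) by auto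
qed

text \<open>Both normals generate the same quotient lattice of rank 1, so modulo the span of
  \<open>a\<close> they agree up to sign. The functional \<open>perp a b\<close> shows that the sign
  is negative.\<close>

lemma opposite_lattice_normals:
  fixes a b b' :: "real^'n"
  assumes "a \<in> lattice_points" "b \<in> lattice_points" "b' \<in> lattice_points" "gram a b > 0" "gram a b' > 0"
    and span: "span {a, b} = span {a, b'}" and opp: "perp a b \<bullet> b' < 0"
  shows "lattice_normal (cone2 a b) (ray a) + lattice_normal (cone2 a b') (ray a) \<in> span {a}"
proof -
  let ?v = "lattice_normal (cone2 a b) (ray a)" and ?v' = "lattice_normal (cone2 a b') (ray a)"
  note V = lattice_normal_cone2[OF assms(1,2,4)] and V' = lattice_normal_cone2[OF assms(1,3,5)]
  obtain m m' :: int where m: "?v' - of_int m *\<^sub>R ?v \<in> span {a}" "?v - of_int m' *\<^sub>R ?v' \<in> span {a}"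
    using V(3)[of ?v'] V'(3)[of ?v] V(1,2) V'(1,2) span by blast
  have z: "perp a b \<bullet> x = 0" if "x \<in> span {a}" for x using that by (auto simp: in_span1)
  have e: "perp a b \<bullet> ?v' = of_int m * (perp a b \<bullet> ?v)" "perp a b \<bullet> ?v = of_int m' * (perp a b \<bullet> ?v')"
    using z[OF m(1)] z[OF m(2)] by (simp_all add: inner_diff_right)
  have pos: "perp a b \<bullet> ?v > 0" using V(5) .
  have neg: "perp a b \<bullet> ?v' < 0"
    using V'(4) opp by (auto simp: inner_add_right mult_pos_neg)
  have "perp a b \<bullet> ?v = of_int m' * (of_int m * (perp a b \<bullet> ?v))" by (subst e(1)[symmetric]) (rule e(2))
  then have "of_int (m' * m) = (1::real)" using pos by simp
  then have "m' * m = 1" by linarith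
  then have "m = 1 \<or> m = -1" by (metis zmult_eq_1_iff)
  moreover have "m \<noteq> 1" using e pos neg by auto
  ultimately have "m = -1" by simp
  then show ?thesis using m(1) by (simp add: add.commute)
qed

text \<open>For primitive \<open>a\<close>, the vector \<open>a\<close> and the lattice normal form
  a lattice basis of the plane. Any other independent lattice pair has a Gram determinant that is a
  nonzero integer square times that of the basis.\<close>

lemma gram_lattice_normal_le:
  fixes a b :: "real^'n"
  assumes "prim a" "b \<in> lattice_points" "gram a b > 0"
    and "x \<in> lattice_points" "y \<in> lattice_points" "x \<in> span {a, b}" "y \<in> span {a, b}" "gram x y > 0"
  shows "gram a (lattice_normal (cone2 a b) (ray a)) \<le> gram x y"
proof -
  let ?v = "lattice_normal (cone2 a b) (ray a)"
  have al: "a \<in> lattice_points" using assms(1) by (simp add: prim_def)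
  note V = lattice_normal_cone2[OF al assms(2,3)]
  have coords: "\<exists>i j::int. z = of_int i *\<^sub>R a + of_int j *\<^sub>R ?v"
    if z: "z \<in> lattice_points" "z \<in> span {a, b}" for z
  proof -
    obtain j :: int where j: "z - of_int j *\<^sub>R ?v \<in> span {a}" using V(3)[OF z] by blast
    moreover have "z - of_int j *\<^sub>R ?v \<in> lattice_points"
      using z V(1) by (intro lattice_diff lattice_scaleR) auto
    ultimately obtain i :: int where "z - of_int j *\<^sub>R ?v = of_int i *\<^sub>R a"
      using assms(1) unfolding prim_def by blast
    then show ?thesis by (auto simp: algebra_simps)
  qed
  obtain i j k l :: int where "x = of_int i *\<^sub>R a + of_int j *\<^sub>R ?v" "y = of_int k *\<^sub>R a + of_int l *\<^sub>R ?v"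
    using coords assms(4-7) by metis
  then have g: "gram x y = (of_int (i * l - j * k))\<^sup>2 * gram a ?v" by (simp add: gram_comb)
  then have "i * l - j * k \<noteq> 0" using assms(8) by (metis less_irrefl mult_zero_left of_int_0 zero_power2)
  then have "(1::int) \<le> (i * l - j * k)\<^sup>2" by (metis One_nat_def int_one_le_iff_zero_less zero_less_power2)
  then have "(1::real) \<le> (of_int (i * l - j * k))\<^sup>2" by (metis of_int_1_le_iff of_int_power)
  then show ?thesis unfolding g using gram_nonneg[of a ?v] by (simp add: mult_le_cancel_right1)
qed

text \<open>For primitive \<open>a\<close> and \<open>b\<close> this is the reciprocal of the lattice index of the cone.\<close>

definition tcoef :: "real^'n \<Rightarrow> real^'n \<Rightarrow> real" where
  "tcoef a b = perp a b \<bullet> lattice_normal (cone2 a b) (ray a) / gram a b"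

lemma lattice_normal_tcoef:
  fixes a b :: "real^'n"
  assumes "a \<in> lattice_points" "b \<in> lattice_points" "gram a b > 0"
  obtains s where "lattice_normal (cone2 a b) (ray a) = s *\<^sub>R a + tcoef a b *\<^sub>R b" "tcoef a b > 0"
proof -
  obtain s t where st: "lattice_normal (cone2 a b) (ray a) = s *\<^sub>R a + t *\<^sub>R b" "t > 0"
    using lattice_normal_cone2(4)[OF assms] by blast
  have "tcoef a b = t" using assms(3) by (simp add: tcoef_def st(1))
  then show ?thesis using that st by blast
qed

text \<open>Each ray together with its normal gives a lattice basis of the same plane, so the two
  Gram determinants agree. They are the squares of the two coefficients times
  \<open>gram a b\<close>.\<close>

lemma tcoef_commute:
  assumes "prim a" "prim b" "gram a b > 0"
  shows "tcoef a b = tcoef b a"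
proof -
  have al: "a \<in> lattice_points" and bl: "b \<in> lattice_points" using assms by (auto simp: prim_def)
  have g': "gram b a > 0" using assms(3) gram_commute by metis
  let ?v = "lattice_normal (cone2 a b) (ray a)" and ?w = "lattice_normal (cone2 b a) (ray b)"
  note V = lattice_normal_cone2[OF al bl assms(3)] and W = lattice_normal_cone2[OF bl al g']
  obtain s where s: "?v = s *\<^sub>R a + tcoef a b *\<^sub>R b" "tcoef a b > 0"
    using lattice_normal_tcoef[OF al bl assms(3)] by blast
  obtain r where r: "?w = r *\<^sub>R b + tcoef b a *\<^sub>R a" "tcoef b a > 0"
    using lattice_normal_tcoef[OF bl al g'] by blast
  have gv: "gram a ?v = (tcoef a b)\<^sup>2 * gram a b"
    using gram_comb[of 1 a 0 b s "tcoef a b"] s(1) by simp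
  have gw: "gram b ?w = (tcoef b a)\<^sup>2 * gram a b"
    using gram_comb[of 1 b 0 a r "tcoef b a"] r(1) gram_commute[of a b] by simp
  have sp: "span {b, a} = span {a, b}" by (simp add: insert_commute)
  have pos: "gram a ?v > 0" "gram b ?w > 0" using gv gw s r assms(3) by simp_all
  have "gram a ?v \<le> gram b ?w"
    using gram_lattice_normal_le[OF assms(1) bl assms(3) bl W(1) _ _ pos(2)] W(2) sp by (auto simp: span_base)
  moreover have "gram b ?w \<le> gram a ?v"
    using gram_lattice_normal_le[OF assms(2) al g' al V(1) _ _ pos(1)] V(2) sp by (auto simp: span_base)
  ultimately have "(tcoef a b)\<^sup>2 = (tcoef b a)\<^sup>2" using gv gw assms(3) by simp
  then show ?thesis using s r by (simp add: power2_eq_iff)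
qed

section \<open>Two-dimensional fans\<close>

lemma ray_eq_scale:
  assumes "ray u = ray a" "a \<noteq> 0"
  obtains s where "s > 0" "u = s *\<^sub>R a"
proof -
  have "u \<in> ray a" using assms(1) ray_mem(1)[of u] by simp
  then obtain s where s: "u = s *\<^sub>R a" "0 \<le> s" by (auto simp: ray_def)
  have "s \<noteq> 0"
  proof
    assume "s = 0"
    then have "ray a = {0}" using s assms(1) by simp
    then show False using ray_mem(1)[of a] assms(2) by simp
  qed
  then show ?thesis using s that[of s] by simp
qed

lemma ray_scale: "s > 0 \<Longrightarrow> ray (s *\<^sub>R a) = ray a"
  unfolding convex_cone_hull_sing[symmetric]
proof (intro equalityI hull_minimal)
  assume "s > 0"
  then have "(1 / s) *\<^sub>R s *\<^sub>R a \<in> convex_cone hull {s *\<^sub>R a}"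
    by (intro convex_cone_hull_mul hull_inc) auto
  then show "{a} \<subseteq> convex_cone hull {s *\<^sub>R a}" using \<open>s > 0\<close> by simp
next
  assume "s > 0"
  then have "s *\<^sub>R a \<in> convex_cone hull {a}"
    by (intro convex_cone_hull_mul hull_inc) auto
  then show "{s *\<^sub>R a} \<subseteq> convex_cone hull {a}" by simp
qed (rule convex_cone_convex_cone_hull)+

lemma cone2_subset: "convex_cone S \<Longrightarrow> a \<in> S \<Longrightarrow> b \<in> S \<Longrightarrow> cone2 a b \<subseteq> S"
  unfolding convex_cone_hull_insert2[symmetric] by (intro hull_minimal) auto

lemma ray_subset: "convex_cone S \<Longrightarrow> a \<in> S \<Longrightarrow> ray a \<subseteq> S"
  unfolding convex_cone_hull_sing[symmetric] by (intro hull_minimal) auto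

lemma cone2_cong_ray:
  assumes "ray a = ray a'" "ray b = ray b'"
  shows "cone2 a b = cone2 a' b'"
proof -
  have "a \<in> ray a'" "a' \<in> ray a" "b \<in> ray b'" "b' \<in> ray b" using assms ray_mem(1) by metis+
  then have "a \<in> cone2 a' b'" "b \<in> cone2 a' b'" "a' \<in> cone2 a b" "b' \<in> cone2 a b"
    using ray_subset_cone2 by blast+
  then show ?thesis by (intro equalityI cone2_subset convex_cone_cone2)
qed

lemma gram_scale: "gram (s *\<^sub>R a) (t *\<^sub>R b) = (s * t)\<^sup>2 * gram a b"
  using gram_comb[of s a 0 b 0 t] by simp

lemma fan_finite: "pure_fan k \<Phi> \<Longrightarrow> finite \<Phi>"
  by (simp add: pure_fan_def rational_fan_def)

lemma fan_face: "pure_fan k \<Phi> \<Longrightarrow> \<sigma> \<in> \<Phi> \<Longrightarrow> T face_of \<sigma> \<Longrightarrow> T \<noteq> {} \<Longrightarrow> T \<in> \<Phi>"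
  unfolding pure_fan_def rational_fan_def by blast

lemma fan_Int_face:
  "pure_fan k \<Phi> \<Longrightarrow> \<sigma> \<in> \<Phi> \<Longrightarrow> \<sigma>' \<in> \<Phi> \<Longrightarrow> \<sigma> \<inter> \<sigma>' face_of \<sigma>"
  unfolding pure_fan_def rational_fan_def by blast

lemma fan_subset_face:
  assumes "pure_fan k \<Phi>" "\<sigma> \<in> \<Phi>" "\<sigma>' \<in> \<Phi>" "\<sigma> \<subseteq> \<sigma>'"
  shows "\<sigma> face_of \<sigma>'"
  using fan_Int_face[OF assms(1,3,2)] assms(4) by (simp add: Int_absorb1)

lemma cones_of_dimD: "\<sigma> \<in> cones_of_dim \<Phi> k \<Longrightarrow> \<sigma> \<in> \<Phi> \<and> dim \<sigma> = k"
  by (simp add: cones_of_dim_def)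

lemma fan_maximal:
  assumes "pure_fan k \<Phi>" "\<tau> \<in> \<Phi>" obtains \<sigma> where "\<sigma> \<in> cones_of_dim \<Phi> k" "\<tau> \<subseteq> \<sigma>"
  using assms unfolding pure_fan_def by blast

lemma fan_dim_le:
  assumes "pure_fan k \<Phi>" "\<tau> \<in> \<Phi>" shows "dim \<tau> \<le> k"
  using fan_maximal[OF assms] dim_subset cones_of_dimD by metis

lemma fan_0_mem:
  assumes "pure_fan k \<Phi>" "\<tau> \<in> \<Phi>" shows "0 \<in> \<tau>"
  using assms unfolding pure_fan_def rational_fan_def strongly_convex_cone_def by blast

lemma fan_convex_cone:
  assumes "pure_fan k \<Phi>" "\<tau> \<in> \<Phi>" shows "convex_cone \<tau>"
proof -
  have "rational_polyhedral_cone \<tau>" using assms unfolding pure_fan_def rational_fan_def by blast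
  then show ?thesis unfolding rational_polyhedral_cone_def using convex_cone_convex_cone_hull by auto
qed

lemma fan_cone_cases:
  assumes "pure_fan k \<Phi>" "k \<le> 2" "\<sigma> \<in> \<Phi>"
  obtains "\<sigma> = {0}" "dim \<sigma> = 0"
    | u where "prim u" "\<sigma> = ray u" "dim \<sigma> = 1"
    | u w where "prim u" "prim w" "gram u w > 0" "\<sigma> = cone2 u w" "dim \<sigma> = 2"
proof -
  have "rational_polyhedral_cone \<sigma>" "strongly_convex_cone \<sigma>" "dim \<sigma> \<le> 2"
    using assms fan_dim_le[OF assms(1,3)] unfolding pure_fan_def rational_fan_def by auto
  then show ?thesis
  proof (cases rule: rational_cone_cases)
    case 1
    then show ?thesis using that(1) by simp
  next
    case (2 a)
    then obtain u where "prim u" "ray u = ray a" using ex_prim by blast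
    then show ?thesis using that(2)[of u] 2 dim_ray[of a] by simp
  next
    case (3 a b)
    have nz: "a \<noteq> 0" "b \<noteq> 0" using 3(3) gram_pos_nz by blast+
    obtain u where u: "prim u" "ray u = ray a" using ex_prim 3 nz by blast
    obtain w where w: "prim w" "ray w = ray b" using ex_prim 3 nz by blast
    obtain s where s: "s > 0" "u = s *\<^sub>R a" using u nz ray_eq_scale by blast
    obtain t where t: "t > 0" "w = t *\<^sub>R b" using w nz ray_eq_scale by blast
    have "gram u w > 0" using s t 3(3) by (simp add: gram_scale)
    then show ?thesis using that(3)[of u w] u(1) w(1) 3(4) cone2_cong_ray[OF u(2) w(2)] dim_cone2[OF 3(3)] by simp
  qed
qed

lemma fan_2cone:
  assumes "pure_fan 2 \<Phi>" "\<sigma> \<in> cones_of_dim \<Phi> 2"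
  obtains u w where "prim u" "prim w" "gram u w > 0" "\<sigma> = cone2 u w"
  using fan_cone_cases[OF assms(1)] cones_of_dimD[OF assms(2)] by (metis le_refl numeral_eq_one_iff semiring_norm(85) zero_neq_numeral)

lemma fan_1cone:
  assumes "pure_fan k \<Phi>" "k \<le> 2" "\<sigma> \<in> cones_of_dim \<Phi> 1"
  obtains u where "prim u" "\<sigma> = ray u"
proof (rule fan_cone_cases[OF assms(1,2)])
  show "\<sigma> \<in> \<Phi>" using cones_of_dimD[OF assms(3)] by simp
qed (use cones_of_dimD[OF assms(3)] that in auto)

lemma prim_lattice: "prim u \<Longrightarrow> u \<in> lattice_points"
  and prim_nz: "prim u \<Longrightarrow> u \<noteq> 0"
  by (auto simp: prim_def)

lemma fan_faces_of_cone2: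
  assumes "pure_fan k \<Phi>" "cone2 a b \<in> \<Phi>" "gram a b > 0"
  shows "ray a \<in> \<Phi>" "ray b \<in> \<Phi>" "{0} \<in> \<Phi>"
proof -
  show "ray a \<in> \<Phi>" using fan_face[OF assms(1,2) ray_face_cone2[OF assms(3)]] ray_mem(1)[of a] by blast
  show "{0} \<in> \<Phi>" using fan_face[OF assms(1,2) zero_face_cone2[OF assms(3)]] by blast
  have "ray b face_of cone2 a b"
    using ray_face_cone2[of b a] assms(3) by (simp add: gram_commute cone2_commute)
  then show "ray b \<in> \<Phi>" using fan_face[OF assms(1,2)] ray_mem(1)[of b] by blast
qed

lemma fan_zero_mem:
  fixes \<Phi> :: "(real^'n) set set"
  assumes "pure_fan k \<Phi>" "k \<le> 2" "\<sigma> \<in> \<Phi>" shows "{0} \<in> \<Phi>" "{0} face_of \<sigma>"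
proof -
  show f: "{0} face_of \<sigma>"
    using assms
  proof (cases rule: fan_cone_cases)
    case 1
    then show ?thesis by (simp add: face_of_refl)
  qed (auto simp: zero_face_ray zero_face_cone2)
  show "{0} \<in> \<Phi>" using fan_face[OF assms(1,3) f] by simp
qed

lemma ray_cone2_neq:
  fixes a b :: "real^'n"
  assumes "gram a b > 0" shows "ray c \<noteq> cone2 a b"
proof
  assume "ray c = cone2 a b"
  then have "a \<in> ray c" "b \<in> ray c" by simp_all
  then obtain s t where "a = s *\<^sub>R c" "b = t *\<^sub>R c" by (auto simp: ray_def)
  then have "gram a b = 0" by (simp add: gram_scale)
  then show False using assms by simp
qed

text \<open>The intersection with \<open>\<sigma>\<close> is a face of \<open>cone2 a b\<close>
  containing a point off both boundary rays, and only the whole cone is such a face.\<close>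

lemma interior_cone_subset:
  fixes a b :: "real^'n"
  assumes "pure_fan k \<Phi>" "cone2 a b \<in> \<Phi>" "gram a b > 0" "\<sigma> \<in> \<Phi>"
    and "s > 0" "t > 0" "s *\<^sub>R a + t *\<^sub>R b \<in> \<sigma>"
  shows "cone2 a b \<subseteq> \<sigma>"
proof -
  let ?x = "s *\<^sub>R a + t *\<^sub>R b"
  have f: "cone2 a b \<inter> \<sigma> face_of cone2 a b" by (rule fan_Int_face[OF assms(1,2,4)])
  have x: "?x \<in> cone2 a b \<inter> \<sigma>" using assms cone2I[of s t a b] by simp
  have "cone2 a b \<inter> \<sigma> = cone2 a b"
  proof -
    have "\<not> (s *\<^sub>R a + t *\<^sub>R b \<in> ray a)"
    proof
      assume "?x \<in> ray a"
      then obtain r where "s *\<^sub>R a + t *\<^sub>R b = r *\<^sub>R a + 0 *\<^sub>R b" by (auto simp: ray_def)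
      from comb_unique[OF assms(3) this] show False using assms(6) by simp
    qed
    moreover have "\<not> (s *\<^sub>R a + t *\<^sub>R b \<in> ray b)"
    proof
      assume "?x \<in> ray b"
      then obtain r where "s *\<^sub>R a + t *\<^sub>R b = 0 *\<^sub>R a + r *\<^sub>R b" by (auto simp: ray_def)
      from comb_unique[OF assms(3) this] show False using assms(5) by simp
    qed
    moreover have "?x \<noteq> 0" using calculation(1) by auto
    moreover have "cone2 a b \<inter> \<sigma> \<noteq> {}" using x by blast
    ultimately show ?thesis using face_cone2_cases[OF f] x by (metis singletonD)
  qed
  then show ?thesis by blast
qed

lemma cone2_subset_eq:
  fixes a b :: "real^'n"
  assumes "pure_fan k \<Phi>" "k \<le> 2" "\<tau> \<in> \<Phi>" "dim \<tau> = 2" "\<sigma> \<in> \<Phi>" "\<tau> \<subseteq> \<sigma>"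
  shows "\<tau> = \<sigma>"
proof -
  have f: "\<tau> face_of \<sigma>" using fan_subset_face assms by blast
  have "dim \<sigma> = 2" using dim_subset[OF assms(6)] assms(2,4) fan_dim_le[OF assms(1,5)] by simp
  then obtain u w where u: "gram u w > 0" "\<sigma> = cone2 u w"
    using fan_cone_cases[OF assms(1,2,5)] by (metis numeral_eq_one_iff semiring_norm(85) zero_neq_numeral)
  have "dim (ray u) \<noteq> 2" "dim (ray w) \<noteq> 2" "dim {0::real^'n} \<noteq> 2"
    using gram_pos_nz[OF u(1)] dim_ray[of u] dim_ray[of w] by simp_all
  moreover have "\<tau> \<noteq> {}" using assms(4) by auto
  ultimately show ?thesis using face_cone2_cases[of \<tau> u w] f assms(4) u by auto
qed

lemma interior_cone_eq:
  fixes a b :: "real^'n"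
  assumes "pure_fan 2 \<Phi>" "cone2 a b \<in> \<Phi>" "gram a b > 0" "\<sigma> \<in> \<Phi>"
    and "s > 0" "t > 0" "s *\<^sub>R a + t *\<^sub>R b \<in> \<sigma>"
  shows "\<sigma> = cone2 a b"
  using cone2_subset_eq[OF assms(1) order_refl assms(2) dim_cone2[OF assms(3)] assms(4)]
    interior_cone_subset[OF assms] by simp

lemma ray_in_cone_face:
  assumes "pure_fan k \<Phi>" "ray a \<in> \<Phi>" "\<sigma> \<in> \<Phi>" "a \<in> \<sigma>"
  shows "ray a face_of \<sigma>"
  using fan_subset_face[OF assms(1,2,3)] ray_subset[OF fan_convex_cone[OF assms(1,3)] assms(4)] by blast

text \<open>The star of a ray is recorded by the neighbouring primitive generators instead of the
  cones, so that sums over the star become sums over vectors.\<close>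

definition link :: "(real^'n) set set \<Rightarrow> real^'n \<Rightarrow> (real^'n) set" where
  "link \<Phi> a = {b. prim b \<and> gram a b > 0 \<and> cone2 a b \<in> \<Phi>}"

lemma cone2_ray_face:
  fixes a :: "real^'n"
  assumes "pure_fan 2 \<Phi>" "prim a" "ray a face_of \<sigma>" "\<sigma> \<in> cones_of_dim \<Phi> 2"
  obtains b where "b \<in> link \<Phi> a" "\<sigma> = cone2 a b"
proof -
  obtain u w where u: "prim u" "prim w" "gram u w > 0" "\<sigma> = cone2 u w"
    using fan_2cone[OF assms(1,4)] by blast
  have "ray a \<noteq> {}" "ray a \<noteq> {0}" using ray_mem(1)[of a] prim_nz[OF assms(2)] by blast+
  then have "ray a = ray u \<or> ray a = ray w"
    using face_cone2_cases[of "ray a" u w] assms(3) u ray_cone2_neq[OF u(3)] by auto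
  then have "a = u \<or> a = w" using prim_unique assms(2) u by blast
  then show ?thesis
  proof
    assume "a = u"
    then show ?thesis using u cones_of_dimD[OF assms(4)] that[of w] by (simp add: link_def)
  next
    assume "a = w"
    then show ?thesis using u cones_of_dimD[OF assms(4)] that[of u]
      by (simp add: link_def gram_commute cone2_commute)
  qed
qed

lemma facet_star_ray:
  fixes a :: "real^'n"
  assumes "pure_fan 2 \<Phi>" "prim a"
  shows "facet_star \<Phi> (ray a) = cone2 a ` link \<Phi> a"
proof -
  have d: "Suc (dim (ray a)) = 2" using dim_ray[of a] prim_nz[OF assms(2)] by simp
  show ?thesis
  proof (intro equalityI subsetI)
    fix \<sigma> assume "\<sigma> \<in> facet_star \<Phi> (ray a)"
    then have "\<sigma> \<in> cones_of_dim \<Phi> 2" "ray a face_of \<sigma>" unfolding facet_star_def d by auto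
    then show "\<sigma> \<in> cone2 a ` link \<Phi> a" using cone2_ray_face[OF assms] by blast
  next
    fix \<sigma> assume "\<sigma> \<in> cone2 a ` link \<Phi> a"
    then show "\<sigma> \<in> facet_star \<Phi> (ray a)"
      unfolding facet_star_def d cones_of_dim_def
      by (auto simp: link_def dim_cone2 ray_face_cone2)
  qed
qed

text \<open>A 2-cone determines its two rays and a ray its primitive generator; this is what allows
  sums over \<open>facet_star\<close> to be reindexed by \<open>link\<close>.\<close>

lemma link_inj:
  fixes a :: "real^'n"
  shows "inj_on (cone2 a) (link \<Phi> a)"
proof
  fix b c assume bc: "b \<in> link \<Phi> a" "c \<in> link \<Phi> a" "cone2 a b = cone2 a c"
  have g: "gram a b > 0" "gram a c > 0" "prim b" "prim c" using bc by (auto simp: link_def)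
  have "ray c face_of cone2 a c"
    using ray_face_cone2[of c a] g by (simp add: gram_commute cone2_commute)
  then have "ray c face_of cone2 a b" using bc by simp
  moreover have "ray c \<noteq> {}" "ray c \<noteq> {0}" using ray_mem(1)[of c] prim_nz[OF g(4)] by blast+
  ultimately have "ray c = ray a \<or> ray c = ray b"
    using face_cone2_cases[of "ray c" a b] ray_cone2_neq[OF g(1), of c] by auto
  moreover have "ray c \<noteq> ray a"
  proof
    assume "ray c = ray a"
    moreover have "a \<noteq> 0" using g gram_pos_nz by blast
    ultimately obtain s where "c = s *\<^sub>R a" using ray_eq_scale by blast
    then have "gram a c = 0" using gram_scale[of 1 a s a] by simp
    then show False using g by simp
  qed
  ultimately show "b = c" using prim_unique g by metis
qed

lemma finite_link:
  fixes a :: "real^'n"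
  assumes "pure_fan k \<Phi>" shows "finite (link \<Phi> a)"
proof -
  have "cone2 a ` link \<Phi> a \<subseteq> \<Phi>" by (auto simp: link_def)
  then show ?thesis using finite_imageD[OF _ link_inj] finite_subset fan_finite[OF assms] by blast
qed

text \<open>Moving \<open>c\<close> far enough in the direction of \<open>a\<close> makes both
  coordinates with respect to \<open>a\<close> and \<open>b\<close> positive. The resulting point of
  \<open>cone2 a c\<close> is interior to \<open>cone2 a b\<close>.\<close>

lemma same_side_cone_eq:
  fixes a b c :: "real^'n"
  assumes "pure_fan 2 \<Phi>" "cone2 a b \<in> \<Phi>" "cone2 a c \<in> \<Phi>" "gram a b > 0" "gram a c > 0"
    "c \<in> span {a, b}" "perp a b \<bullet> c > 0"
  shows "cone2 a c = cone2 a b"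
proof -
  obtain p q where c: "c = p *\<^sub>R a + q *\<^sub>R b" using assms(6) by (auto simp: in_span2)
  have q: "q > 0" using assms(4,7) c by (auto simp: zero_less_mult_iff)
  have "(\<bar>p\<bar> + 1) *\<^sub>R a + 1 *\<^sub>R c = (\<bar>p\<bar> + 1 + p) *\<^sub>R a + q *\<^sub>R b"
    using c by (simp add: algebra_simps)
  moreover have "(\<bar>p\<bar> + 1) *\<^sub>R a + 1 *\<^sub>R c \<in> cone2 a c" by (rule cone2I) auto
  ultimately show ?thesis
    using interior_cone_eq[OF assms(1,2,4,3), of "\<bar>p\<bar> + 1 + p" q] q by auto
qed

section \<open>Subdivision by a hyperplane\<close>

text \<open>The hyperplane belongs to the family because the cut creates new faces in it.\<close>

definition halves :: "real^'n \<Rightarrow> (real^'n) set set" where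
  "halves l = {{x. l \<bullet> x \<ge> 0}, {x. l \<bullet> x \<le> 0}, {x. l \<bullet> x = 0}}"

definition cut_cones :: "real^'n \<Rightarrow> (real^'n) set set \<Rightarrow> (real^'n) set set" where
  "cut_cones l \<Phi> = {\<sigma> \<inter> A | \<sigma> A. \<sigma> \<in> \<Phi> \<and> A \<in> halves l}"

definition signed :: "real^'n \<Rightarrow> (real^'n) set \<Rightarrow> bool" where
  "signed l \<sigma> \<longleftrightarrow> (\<forall>x\<in>\<sigma>. l \<bullet> x \<ge> 0) \<or> (\<forall>x\<in>\<sigma>. l \<bullet> x \<le> 0)"

text \<open>If \<open>l\<close> is positive at \<open>a\<close> and negative at \<open>b\<close>,
  this vector spans the ray in which the hyperplane of \<open>l\<close> crosses
  \<open>cone2 a b\<close>. Denominators are cleared to stay in the lattice.\<close>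

definition cross :: "real^'n \<Rightarrow> real^'n \<Rightarrow> real^'n \<Rightarrow> real^'n" where
  "cross l a b = (- (l \<bullet> b)) *\<^sub>R a + (l \<bullet> a) *\<^sub>R b"

lemma cut_conesI: "\<sigma> \<in> \<Phi> \<Longrightarrow> A \<in> halves l \<Longrightarrow> \<sigma> \<inter> A \<in> cut_cones l \<Phi>"
  by (auto simp: cut_cones_def)

lemma signed_cut: "\<sigma> \<in> cut_cones l \<Phi> \<Longrightarrow> signed l \<sigma>"
  by (auto simp: cut_cones_def halves_def signed_def)

lemma signed_subset: "signed l \<sigma> \<Longrightarrow> \<tau> \<subseteq> \<sigma> \<Longrightarrow> signed l \<tau>"
  by (auto simp: signed_def)

lemma subset_half_cut: "\<sigma> \<in> \<Phi> \<Longrightarrow> \<sigma> \<subseteq> A \<Longrightarrow> A \<in> halves l \<Longrightarrow> \<sigma> \<in> cut_cones l \<Phi>"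
  using cut_conesI[of \<sigma> \<Phi> A l] by (simp add: Int_absorb2)

lemma signed_half: "signed l \<sigma> \<Longrightarrow> \<exists>A\<in>halves l. \<sigma> \<subseteq> A"
  by (auto simp: signed_def halves_def)

lemma signed_mem_cut: "\<sigma> \<in> \<Phi> \<Longrightarrow> signed l \<sigma> \<Longrightarrow> \<sigma> \<in> cut_cones l \<Phi>"
  using subset_half_cut[of \<sigma> \<Phi> _ l] signed_half[of l \<sigma>] by auto

lemma halves_0: "A \<in> halves l \<Longrightarrow> 0 \<in> A"
  by (auto simp: halves_def)

text \<open>If \<open>l\<close> does not change sign on \<open>\<sigma>\<close>, its hyperplane is
  supporting, so each half meets \<open>\<sigma>\<close> in \<open>\<sigma>\<close> itself or in a
  face.\<close>

lemma signed_Int_half: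
  assumes "pure_fan k \<Phi>" "\<sigma> \<in> \<Phi>" "signed l \<sigma>" "A \<in> halves l"
  shows "\<sigma> \<inter> A \<in> \<Phi>"
proof -
  have conv: "convex \<sigma>" using fan_convex_cone[OF assms(1,2)] by (simp add: convex_cone_def)
  have z: "\<sigma> \<inter> {x. l \<bullet> x = 0} \<in> \<Phi>"
  proof (rule fan_face[OF assms(1,2)])
    show "\<sigma> \<inter> {x. l \<bullet> x = 0} face_of \<sigma>"
      using assms(3) unfolding signed_def
    proof
      assume "\<forall>x\<in>\<sigma>. 0 \<le> l \<bullet> x"
      then show ?thesis by (intro face_of_Int_supporting_hyperplane_ge conv) auto
    next
      assume "\<forall>x\<in>\<sigma>. l \<bullet> x \<le> 0"
      then show ?thesis by (intro face_of_Int_supporting_hyperplane_le conv) auto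
    qed
    show "\<sigma> \<inter> {x. l \<bullet> x = 0} \<noteq> {}" using fan_0_mem[OF assms(1,2)] by auto
  qed
  have "\<sigma> \<inter> A = \<sigma> \<or> \<sigma> \<inter> A = \<sigma> \<inter> {x. l \<bullet> x = 0}"
    using assms(3,4) unfolding signed_def halves_def by (force intro: antisym)
  then show ?thesis using z assms(2) by auto
qed

lemma unsigned_cone:
  fixes \<Phi> :: "(real^'n) set set"
  assumes "pure_fan 2 \<Phi>" "\<sigma> \<in> \<Phi>" "\<not> signed l \<sigma>"
  obtains a b where "prim a" "prim b" "gram a b > 0" "\<sigma> = cone2 a b" "l \<bullet> a > 0" "l \<bullet> b < 0"
proof (rule fan_cone_cases[OF assms(1) order_refl assms(2)])
  assume "\<sigma> = {0}"
  then show ?thesis using assms(3) by (auto simp: signed_def)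
next
  fix u assume "\<sigma> = ray u"
  then have "signed l \<sigma>" by (auto simp: signed_def ray_def zero_le_mult_iff mult_le_0_iff)
  then show ?thesis using assms(3) by simp
next
  fix u w assume u: "prim u" "prim w" "gram u w > 0" "\<sigma> = cone2 u w"
  have "\<not> (l \<bullet> u \<ge> 0 \<and> l \<bullet> w \<ge> 0)" "\<not> (l \<bullet> u \<le> 0 \<and> l \<bullet> w \<le> 0)"
    using assms(3) unfolding signed_def u(4) cone2_def
    by (auto simp: inner_add_right mult_nonneg_nonpos add_nonpos_nonpos)
  then have "l \<bullet> u > 0 \<and> l \<bullet> w < 0 \<or> l \<bullet> w > 0 \<and> l \<bullet> u < 0" by linarith
  then show ?thesis using that[of u w] that[of w u] u by (auto simp: gram_commute cone2_commute)
qed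

lemma cross_inner [simp]: "l \<bullet> cross l a b = 0"
  unfolding cross_def by (simp add: inner_add_right inner_diff_right)

lemma gram_cross: "gram a (cross l a b) = (l \<bullet> a)\<^sup>2 * gram a b" "gram (cross l a b) b = (l \<bullet> b)\<^sup>2 * gram a b"
  using gram_comb[of 1 a 0 b "- (l \<bullet> b)" "l \<bullet> a"] gram_comb[of "- (l \<bullet> b)" a "l \<bullet> a" b 0 1]
  by (simp_all add: cross_def)

lemma cross_in_cone2: "l \<bullet> a > 0 \<Longrightarrow> l \<bullet> b < 0 \<Longrightarrow> cross l a b \<in> cone2 a b"
  unfolding cross_def by (intro cone2I) auto

lemma cross_lattice:
  "l \<in> lattice_points \<Longrightarrow> a \<in> lattice_points \<Longrightarrow> b \<in> lattice_points \<Longrightarrow> cross l a b \<in> lattice_points"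
  unfolding cross_def by (intro lattice_add lattice_scaleR Ints_minus lattice_inner)

lemma cut_cone2:
  fixes a b :: "real^'n"
  assumes "l \<bullet> a > 0" "l \<bullet> b < 0"
  shows "cone2 a b \<inter> {x. l \<bullet> x \<ge> 0} = cone2 a (cross l a b)"
    and "cone2 a b \<inter> {x. l \<bullet> x \<le> 0} = cone2 (cross l a b) b"
    and "cone2 a b \<inter> {x. l \<bullet> x = 0} = ray (cross l a b)"
proof -
  let ?d = "cross l a b" and ?p = "l \<bullet> a" and ?q = "- (l \<bullet> b)"
  have q: "?q > 0" using assms by simp
  have d: "?d \<in> cone2 a b" using cross_in_cone2 assms by blast
  have ge: "convex_cone (cone2 a b \<inter> {x. l \<bullet> x \<ge> 0})" "convex_cone (cone2 a b \<inter> {x. l \<bullet> x \<le> 0})"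
    using convex_cone_cone2[of a b] by (auto simp: convex_cone_iff inner_add_right mult_nonneg_nonpos)
  have eq: "s *\<^sub>R a + t *\<^sub>R b = (s - t * ?q / ?p) *\<^sub>R a + (t / ?p) *\<^sub>R ?d"
     "s *\<^sub>R a + t *\<^sub>R b = (s / ?q) *\<^sub>R ?d + (t - s * ?p / ?q) *\<^sub>R b" for s t
    using assms by (simp_all add: cross_def algebra_simps)
  show 1: "cone2 a b \<inter> {x. l \<bullet> x \<ge> 0} = cone2 a ?d"
  proof
    show "cone2 a ?d \<subseteq> cone2 a b \<inter> {x. l \<bullet> x \<ge> 0}"
      using assms d by (intro cone2_subset ge) auto
    show "cone2 a b \<inter> {x. l \<bullet> x \<ge> 0} \<subseteq> cone2 a ?d"
    proof
      fix x assume "x \<in> cone2 a b \<inter> {x. l \<bullet> x \<ge> 0}"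
      then obtain s t where x: "x = s *\<^sub>R a + t *\<^sub>R b" "0 \<le> s" "0 \<le> t" "l \<bullet> x \<ge> 0"
        by (auto simp: cone2_def)
      then have "s * ?p \<ge> t * ?q" by (simp add: inner_add_right)
      then have "s - t * ?q / ?p \<ge> 0" using assms by (simp add: field_simps)
      moreover have "t / ?p \<ge> 0" using x assms by simp
      ultimately show "x \<in> cone2 a ?d" unfolding x(1) eq(1)[of s t] by (rule cone2I)
    qed
  qed
  show 2: "cone2 a b \<inter> {x. l \<bullet> x \<le> 0} = cone2 ?d b"
  proof
    show "cone2 ?d b \<subseteq> cone2 a b \<inter> {x. l \<bullet> x \<le> 0}"
      using assms d by (intro cone2_subset ge) auto
    show "cone2 a b \<inter> {x. l \<bullet> x \<le> 0} \<subseteq> cone2 ?d b"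
    proof
      fix x assume "x \<in> cone2 a b \<inter> {x. l \<bullet> x \<le> 0}"
      then obtain s t where x: "x = s *\<^sub>R a + t *\<^sub>R b" "0 \<le> s" "0 \<le> t" "l \<bullet> x \<le> 0"
        by (auto simp: cone2_def)
      then have "s * ?p \<le> t * ?q" by (simp add: inner_add_right)
      then have "t - s * ?p / ?q \<ge> 0" using q by (simp add: field_simps)
      moreover have "s / ?q \<ge> 0" using x(2) q by (rule divide_nonneg_pos)
      ultimately show "x \<in> cone2 ?d b" unfolding x(1) eq(2)[of s t] by (intro cone2I)
    qed
  qed
  show "cone2 a b \<inter> {x. l \<bullet> x = 0} = ray ?d"
  proof
    show "ray ?d \<subseteq> cone2 a b \<inter> {x. l \<bullet> x = 0}"
      using ray_subset[OF convex_cone_cone2 d] by (auto simp: ray_def)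
    show "cone2 a b \<inter> {x. l \<bullet> x = 0} \<subseteq> ray ?d"
    proof
      fix x assume x: "x \<in> cone2 a b \<inter> {x. l \<bullet> x = 0}"
      then have "x \<in> cone2 a b \<inter> {x. l \<bullet> x \<ge> 0}" by simp
      then have "x \<in> cone2 a ?d" unfolding 1 .
      then obtain s t where x': "x = s *\<^sub>R a + t *\<^sub>R ?d" "0 \<le> t" by (auto simp: cone2_def)
      then have "s * (l \<bullet> a) = 0" using x by (simp add: inner_add_right)
      then have "s = 0" using assms by simp
      then show "x \<in> ray ?d" using x' by (simp add: rayI)
    qed
  qed
qed

lemma cut_cases:
  fixes \<Phi> :: "(real^'n) set set"
  assumes "pure_fan 2 \<Phi>" "\<sigma> \<in> \<Phi>" "A \<in> halves l"
  obtains "\<sigma> \<inter> A \<in> \<Phi>"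
    | a b where "prim a" "prim b" "gram a b > 0" "\<sigma> = cone2 a b" "l \<bullet> a > 0" "l \<bullet> b < 0"
      "A = {x. l \<bullet> x \<ge> 0} \<and> \<sigma> \<inter> A = cone2 a (cross l a b) \<or>
       A = {x. l \<bullet> x \<le> 0} \<and> \<sigma> \<inter> A = cone2 (cross l a b) b \<or>
       A = {x. l \<bullet> x = 0} \<and> \<sigma> \<inter> A = ray (cross l a b)"
proof (cases "signed l \<sigma>")
  case True
  then show ?thesis using that(1) signed_Int_half[OF assms(1,2) True assms(3)] by simp
next
  case False
  then obtain a b where ab: "prim a" "prim b" "gram a b > 0" "\<sigma> = cone2 a b" "l \<bullet> a > 0" "l \<bullet> b < 0"
    using unsigned_cone[OF assms(1,2)] by blast
  show ?thesis
    by (rule that(2)[OF ab]) (use assms(3) cut_cone2[OF ab(5,6)] in \<open>auto simp: halves_def ab(4)\<close>)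
qed

lemma rational_cone2:
  "a \<in> lattice_points \<Longrightarrow> b \<in> lattice_points \<Longrightarrow> rational_polyhedral_cone (cone2 a b)"
  unfolding rational_polyhedral_cone_def convex_cone_hull_insert2[symmetric]
  by (intro exI[of _ "{a, b}"]) auto

lemma rational_ray: "a \<in> lattice_points \<Longrightarrow> rational_polyhedral_cone (ray a)"
  unfolding ray_eq_cone2 by (intro rational_cone2) auto

lemma halves_Int_face:
  assumes "A \<in> halves l" "A' \<in> halves l" shows "A \<inter> A' face_of A"
proof -
  have "A \<inter> A' = A \<or> A \<inter> A' = {x. l \<bullet> x = 0}"
    using assms unfolding halves_def by auto
  moreover have "A face_of A"
    using assms(1) by (auto simp: halves_def face_of_refl_eq convex_halfspace_ge convex_halfspace_le convex_hyperplane)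
  moreover have "{x. l \<bullet> x = 0} face_of A"
    using assms(1) unfolding halves_def
    by (auto simp: face_of_refl_eq convex_hyperplane hyperplane_face_of_halfspace_le hyperplane_face_of_halfspace_ge)
  ultimately show ?thesis by auto
qed

text \<open>Intersections are uniform: cones meet in common faces, halves meet in common faces, and
  \<open>face_of_Int_Int\<close> combines the two. For faces the explicit pieces are used: a face
  outside the old fan is the piece itself or the crossing ray. Purity holds because both
  full-dimensional pieces of a crossed 2-cone are again 2-dimensional.\<close>

lemma pure_fan_cut:
  fixes \<Phi> :: "(real^'n) set set"
  assumes P: "pure_fan 2 \<Phi>" and l: "l \<in> lattice_points"
  shows "pure_fan 2 (cut_cones l \<Phi>)"
  unfolding pure_fan_def rational_fan_def
proof (intro conjI ballI allI impI)
  have "cut_cones l \<Phi> = (\<lambda>(\<sigma>, A). \<sigma> \<inter> A) ` (\<Phi> \<times> halves l)" by (auto simp: cut_cones_def)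
  then show "finite (cut_cones l \<Phi>)" using fan_finite[OF P] by (simp add: halves_def)
next
  fix \<tau> assume "\<tau> \<in> cut_cones l \<Phi>"
  then obtain \<sigma> A where \<tau>: "\<tau> = \<sigma> \<inter> A" "\<sigma> \<in> \<Phi>" "A \<in> halves l" by (auto simp: cut_cones_def)
  show "rational_polyhedral_cone \<tau>"
    using P \<tau>(2,3)
  proof (cases rule: cut_cases)
    case 1
    then show ?thesis using P \<tau>(1) unfolding pure_fan_def rational_fan_def by auto
  next
    case (2 a b)
    have "a \<in> lattice_points" "b \<in> lattice_points" "cross l a b \<in> lattice_points"
      using cross_lattice[OF l] 2(1,2) by (auto dest: prim_lattice)
    then show ?thesis using 2(7) \<tau>(1) rational_cone2 rational_ray by auto
  qed
  have "strongly_convex_cone \<sigma>" using P \<tau>(2) unfolding pure_fan_def rational_fan_def by blast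
  then show "strongly_convex_cone \<tau>"
    by (rule pointed_subset) (use fan_0_mem[OF P \<tau>(2)] halves_0[OF \<tau>(3)] \<tau>(1) in auto)
next
  fix \<tau> T assume "\<tau> \<in> cut_cones l \<Phi>" and T: "T face_of \<tau> \<and> T \<noteq> {}"
  then obtain \<sigma> A where \<tau>: "\<tau> = \<sigma> \<inter> A" "\<sigma> \<in> \<Phi>" "A \<in> halves l" by (auto simp: cut_cones_def)
  have TA: "T \<subseteq> A" using T \<tau>(1) face_of_imp_subset by blast
  show "T \<in> cut_cones l \<Phi>"
  proof (cases "T \<in> \<Phi>")
    case True
    then show ?thesis using subset_half_cut TA \<tau>(3) by blast
  next
    case False
    show ?thesis
      using P \<tau>(2,3)
    proof (cases rule: cut_cases)
      case 1
      then show ?thesis using False T fan_face[OF P] \<tau>(1) by blast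
    next
      case (2 a b)
      have mem: "ray a \<in> \<Phi>" "ray b \<in> \<Phi>" "{0} \<in> \<Phi>"
        using fan_faces_of_cone2[OF P _ 2(3)] \<tau>(2) 2(4) by auto
      have Z: "{x. l \<bullet> x = 0} \<in> halves l" by (simp add: halves_def)
      have d: "ray (cross l a b) \<in> cut_cones l \<Phi>"
        using cut_cone2(3)[OF 2(5,6)] cut_conesI[OF \<tau>(2) Z] 2(4) by simp
      have "T = \<tau> \<or> T = {0} \<or> T = ray a \<or> T = ray b \<or> T = ray (cross l a b)"
        using 2(7)
      proof (elim disjE conjE)
        assume "\<sigma> \<inter> A = cone2 a (cross l a b)"
        then show ?thesis using face_cone2_cases[of T a "cross l a b"] T \<tau>(1) by metis
      next
        assume "\<sigma> \<inter> A = cone2 (cross l a b) b"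
        then show ?thesis using face_cone2_cases[of T "cross l a b" b] T \<tau>(1) by metis
      next
        assume "\<sigma> \<inter> A = ray (cross l a b)"
        then show ?thesis using face_ray_cases[of T "cross l a b"] T \<tau>(1) by metis
      qed
      then show ?thesis using d mem False cut_conesI[OF \<tau>(2,3)] \<tau>(1) by metis
    qed
  qed
next
  fix \<tau> \<tau>' assume "\<tau> \<in> cut_cones l \<Phi>" "\<tau>' \<in> cut_cones l \<Phi>"
  then obtain \<sigma> A \<sigma>' A' where \<tau>: "\<tau> = \<sigma> \<inter> A" "\<sigma> \<in> \<Phi>" "A \<in> halves l"
    "\<tau>' = \<sigma>' \<inter> A'" "\<sigma>' \<in> \<Phi>" "A' \<in> halves l" unfolding cut_cones_def by blast
  have "(\<sigma> \<inter> \<sigma>') \<inter> (A \<inter> A') face_of \<sigma> \<inter> A"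
    using fan_Int_face[OF P \<tau>(2,5)] halves_Int_face[OF \<tau>(3,6)] by (rule face_of_Int_Int)
  moreover have "(\<sigma>' \<inter> \<sigma>) \<inter> (A' \<inter> A) face_of \<sigma>' \<inter> A'"
    using fan_Int_face[OF P \<tau>(5,2)] halves_Int_face[OF \<tau>(6,3)] by (rule face_of_Int_Int)
  moreover have "(\<sigma> \<inter> \<sigma>') \<inter> (A \<inter> A') = \<tau> \<inter> \<tau>'" "(\<sigma>' \<inter> \<sigma>) \<inter> (A' \<inter> A) = \<tau> \<inter> \<tau>'"
    using \<tau> by auto
  ultimately show "\<tau> \<inter> \<tau>' face_of \<tau>" "\<tau> \<inter> \<tau>' face_of \<tau>'" using \<tau>(1,4) by simp_all
next
  fix \<tau> assume "\<tau> \<in> cut_cones l \<Phi>"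
  then obtain \<sigma> A where \<tau>: "\<tau> = \<sigma> \<inter> A" "\<sigma> \<in> \<Phi>" "A \<in> halves l" by (auto simp: cut_cones_def)
  obtain \<rho> where \<rho>: "\<rho> \<in> cones_of_dim \<Phi> 2" "\<sigma> \<subseteq> \<rho>" using fan_maximal[OF P \<tau>(2)] by blast
  note \<rho>' = cones_of_dimD[OF \<rho>(1)]
  show "\<exists>\<rho>\<in>cones_of_dim (cut_cones l \<Phi>) 2. \<tau> \<subseteq> \<rho>"
  proof (cases "signed l \<rho>")
    case True
    then show ?thesis using signed_mem_cut \<rho>' \<rho>(2) \<tau>(1) unfolding cones_of_dim_def by blast
  next
    case False
    obtain a b where ab: "prim a" "prim b" "gram a b > 0" "\<rho> = cone2 a b" "l \<bullet> a > 0" "l \<bullet> b < 0"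
      using unsigned_cone[OF P _ False] \<rho>' by blast
    have h: "{x. l \<bullet> x \<ge> 0} \<in> halves l" "{x. l \<bullet> x \<le> 0} \<in> halves l" by (simp_all add: halves_def)
    have "dim (\<rho> \<inter> {x. l \<bullet> x \<ge> 0}) = 2" "dim (\<rho> \<inter> {x. l \<bullet> x \<le> 0}) = 2"
      unfolding ab(4) cut_cone2[OF ab(5,6)] using ab by (auto intro!: dim_cone2 simp: gram_cross)
    then have "\<rho> \<inter> {x. l \<bullet> x \<ge> 0} \<in> cones_of_dim (cut_cones l \<Phi>) 2"
      "\<rho> \<inter> {x. l \<bullet> x \<le> 0} \<in> cones_of_dim (cut_cones l \<Phi>) 2"
      using cut_conesI h \<rho>' by (auto simp: cones_of_dim_def)
    moreover have "A \<subseteq> {x. l \<bullet> x \<ge> 0} \<or> A \<subseteq> {x. l \<bullet> x \<le> 0}" using \<tau>(3) by (auto simp: halves_def)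
    ultimately show ?thesis using \<rho>(2) \<tau>(1) by blast
  qed
qed

section \<open>Stars of rays after a cut\<close>

lemma perp_shift: "perp a (p *\<^sub>R a + q *\<^sub>R b) = q *\<^sub>R perp a b"
  by (simp add: perp_def inner_add_right algebra_simps)

lemma gram_shift: "gram a (p *\<^sub>R a + q *\<^sub>R b) = q\<^sup>2 * gram a b"
  using gram_comb[of 1 a 0 b p q] by simp

lemma span_shift:
  assumes "q \<noteq> 0" shows "span {a, p *\<^sub>R a + q *\<^sub>R b} = span {a, b}"
proof (rule span_eq[THEN iffD2, OF conjI])
  show "{a, p *\<^sub>R a + q *\<^sub>R b} \<subseteq> span {a, b}"
    by (auto intro!: span_add span_scale intro: span_base)
  have "b = (- p / q) *\<^sub>R a + (1 / q) *\<^sub>R (p *\<^sub>R a + q *\<^sub>R b)"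
    using assms by (simp add: algebra_simps)
  then have "b \<in> span {a, p *\<^sub>R a + q *\<^sub>R b}" unfolding in_span2 by blast
  then show "{a, b} \<subseteq> span {a, p *\<^sub>R a + q *\<^sub>R b}" by (simp add: span_base)
qed

text \<open>Being a lattice normal depends on the cone only through its span and its image modulo
  the span of \<open>a\<close>, and both are unchanged. The two predicates are equal, so the chosen
  normals are equal and not just congruent.\<close>

lemma lattice_normal_shift:
  fixes a b :: "real^'n"
  assumes "q > 0"
  shows "lattice_normal (cone2 a (p *\<^sub>R a + q *\<^sub>R b)) (ray a) = lattice_normal (cone2 a b) (ray a)"
proof -
  have "(\<exists>x\<in>cone2 a (p *\<^sub>R a + q *\<^sub>R b). \<exists>y\<in>span {a}. v = x + y) \<longleftrightarrow>
        (\<exists>x\<in>cone2 a b. \<exists>y\<in>span {a}. v = x + y)" for v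
  proof
    assume "\<exists>x\<in>cone2 a (p *\<^sub>R a + q *\<^sub>R b). \<exists>y\<in>span {a}. v = x + y"
    then obtain s t r where v: "v = s *\<^sub>R a + t *\<^sub>R (p *\<^sub>R a + q *\<^sub>R b) + r *\<^sub>R a" "t \<ge> 0"
      by (auto simp: cone2_def in_span1)
    have "(t * q) *\<^sub>R b \<in> cone2 a b" using cone2I[of 0 "t * q" a b] v(2) assms by simp
    moreover have "(s + t * p + r) *\<^sub>R a \<in> span {a}" by (simp add: in_span1)
    moreover have "v = (t * q) *\<^sub>R b + (s + t * p + r) *\<^sub>R a" unfolding v(1) by (simp add: algebra_simps)
    ultimately show "\<exists>x\<in>cone2 a b. \<exists>y\<in>span {a}. v = x + y" by blast
  next
    assume "\<exists>x\<in>cone2 a b. \<exists>y\<in>span {a}. v = x + y"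
    then obtain s t r where v: "v = s *\<^sub>R a + t *\<^sub>R b + r *\<^sub>R a" "t \<ge> 0"
      by (auto simp: cone2_def in_span1)
    have "(t / q) *\<^sub>R (p *\<^sub>R a + q *\<^sub>R b) \<in> cone2 a (p *\<^sub>R a + q *\<^sub>R b)"
      using cone2I[of 0 "t / q" a "p *\<^sub>R a + q *\<^sub>R b"] v(2) assms by simp
    moreover have "(s - t / q * p + r) *\<^sub>R a \<in> span {a}" by (simp add: in_span1)
    moreover have "v = (t / q) *\<^sub>R (p *\<^sub>R a + q *\<^sub>R b) + (s - t / q * p + r) *\<^sub>R a"
      using assms unfolding v(1) by (simp add: algebra_simps)
    ultimately show "\<exists>x\<in>cone2 a (p *\<^sub>R a + q *\<^sub>R b). \<exists>y\<in>span {a}. v = x + y" by blast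
  qed
  then have "is_lattice_normal (cone2 a (p *\<^sub>R a + q *\<^sub>R b)) (ray a) = is_lattice_normal (cone2 a b) (ray a)"
    unfolding is_lattice_normal_def span_ray span_cone2 using span_shift[of q a p b] assms by (intro ext) simp
  then show ?thesis by (simp add: lattice_normal_def)
qed

text \<open>In a pure fan the sum has a single term, since a 2-dimensional piece lies in only one
  2-cone (\<open>overlap_eq\<close>); writing a sum avoids a choice of that cone.\<close>

definition cut :: "real^'n \<Rightarrow> 'n::finite weighted_fan \<Rightarrow> 'n weighted_fan" where
  "cut l F = Weighted_Fan (cut_cones l (cones F))
     (\<lambda>\<tau>. if \<tau> \<in> cones_of_dim (cut_cones l (cones F)) 2
       then \<Sum>\<sigma> | \<sigma> \<in> cones_of_dim (cones F) 2 \<and> \<tau> \<subseteq> \<sigma>. weight F \<sigma> else 0)"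

lemma cones_cut [simp]: "cones (cut l F) = cut_cones l (cones F)"
  by (simp add: cut_def)

lemma overlap_eq:
  fixes \<Phi> :: "(real^'n) set set"
  assumes "pure_fan 2 \<Phi>" "dim \<tau> = 2" "\<sigma> \<in> \<Phi>" "\<sigma>' \<in> \<Phi>" "\<tau> \<subseteq> \<sigma>" "\<tau> \<subseteq> \<sigma>'"
  shows "\<sigma> = \<sigma>'"
proof -
  have "\<tau> \<noteq> {}" using assms(2) by auto
  then have m: "\<sigma> \<inter> \<sigma>' \<in> \<Phi>" using fan_face[OF assms(1,3) fan_Int_face[OF assms(1,3,4)]] assms(5,6) by blast
  have "2 \<le> dim (\<sigma> \<inter> \<sigma>')" using dim_subset[of \<tau> "\<sigma> \<inter> \<sigma>'"] assms by simp
  then have "dim (\<sigma> \<inter> \<sigma>') = 2" using fan_dim_le[OF assms(1) m] by simp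
  then have "\<sigma> \<inter> \<sigma>' = \<sigma>" "\<sigma> \<inter> \<sigma>' = \<sigma>'"
    using cone2_subset_eq[OF assms(1) order_refl m] assms(3,4) by auto
  then show ?thesis by simp
qed

lemma cut_parent:
  fixes \<Phi> :: "(real^'n) set set"
  assumes "pure_fan 2 \<Phi>" "\<tau> \<in> cones_of_dim (cut_cones l \<Phi>) 2"
  obtains \<sigma> where "\<sigma> \<in> cones_of_dim \<Phi> 2" "\<tau> \<subseteq> \<sigma>"
proof -
  obtain \<sigma> where \<sigma>: "\<sigma> \<in> \<Phi>" "\<tau> \<subseteq> \<sigma>" using assms(2) by (auto simp: cones_of_dim_def cut_cones_def)
  obtain \<rho> where "\<rho> \<in> cones_of_dim \<Phi> 2" "\<sigma> \<subseteq> \<rho>" using fan_maximal[OF assms(1) \<sigma>(1)] by blast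
  then show ?thesis using that[of \<rho>] \<sigma>(2) by simp
qed

lemma weight_cut:
  assumes P: "pure_fan 2 (cones F)" and \<tau>: "\<tau> \<in> cones_of_dim (cut_cones l (cones F)) 2"
    and \<sigma>: "\<sigma> \<in> cones_of_dim (cones F) 2" "\<tau> \<subseteq> \<sigma>"
  shows "weight (cut l F) \<tau> = weight F \<sigma>"
proof -
  have "{\<sigma>'. \<sigma>' \<in> cones_of_dim (cones F) 2 \<and> \<tau> \<subseteq> \<sigma>'} = {\<sigma>}"
    using overlap_eq[OF P, of \<tau>] \<tau> \<sigma> by (auto simp: cones_of_dim_def)
  then show ?thesis using \<tau> by (simp add: cut_def)
qed

text \<open>\<open>cone2 a (near_gen l a b)\<close> is the piece of \<open>cone2 a b\<close> that contains \<open>a\<close>.\<close>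

definition near_gen :: "real^'n \<Rightarrow> real^'n \<Rightarrow> real^'n \<Rightarrow> real^'n" where
  "near_gen l a b = (if (l \<bullet> a) * (l \<bullet> b) < 0 then \<bar>l \<bullet> b\<bar> *\<^sub>R a + \<bar>l \<bullet> a\<bar> *\<^sub>R b else b)"

lemma near_gen_comb:
  obtains p q where "near_gen l a b = p *\<^sub>R a + q *\<^sub>R b" "0 \<le> p" "0 < q"
proof (cases "(l \<bullet> a) * (l \<bullet> b) < 0")
  case True
  then have "l \<bullet> a \<noteq> 0" by auto
  then show ?thesis using True that[of "\<bar>l \<bullet> b\<bar>" "\<bar>l \<bullet> a\<bar>"] by (simp add: near_gen_def)
next
  case False
  then show ?thesis using that[of 0 1] by (simp add: near_gen_def)
qed

lemma cone2_near_gen: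
  fixes a b :: "real^'n"
  assumes "gram a b > 0"
  shows "gram a (near_gen l a b) > 0" "cone2 a (near_gen l a b) \<subseteq> cone2 a b"
    "span (cone2 a (near_gen l a b)) = span (cone2 a b)"
    "lattice_normal (cone2 a (near_gen l a b)) (ray a) = lattice_normal (cone2 a b) (ray a)"
proof -
  obtain p q where pq: "near_gen l a b = p *\<^sub>R a + q *\<^sub>R b" "0 \<le> p" "0 < q" by (rule near_gen_comb)
  show "gram a (near_gen l a b) > 0" unfolding pq(1) gram_shift using assms pq by simp
  show "cone2 a (near_gen l a b) \<subseteq> cone2 a b"
    unfolding pq(1) using pq by (intro cone2_subset convex_cone_cone2) (auto intro: cone2I)
  show "span (cone2 a (near_gen l a b)) = span (cone2 a b)"
    unfolding pq(1) span_cone2 using pq by (simp add: span_shift)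
  show "lattice_normal (cone2 a (near_gen l a b)) (ray a) = lattice_normal (cone2 a b) (ray a)"
    unfolding pq(1) using pq by (simp add: lattice_normal_shift)
qed

lemma signed_cone2:
  assumes "(l \<bullet> a) * (l \<bullet> b) \<ge> 0" shows "signed l (cone2 a b)"
proof -
  have "(l \<bullet> a \<ge> 0 \<and> l \<bullet> b \<ge> 0) \<or> (l \<bullet> a \<le> 0 \<and> l \<bullet> b \<le> 0)"
    using assms by (auto simp: zero_le_mult_iff)
  then show ?thesis
    by (auto simp: signed_def cone2_def inner_add_right mult_nonneg_nonpos add_nonpos_nonpos)
qed

lemma near_gen_mem_cut:
  assumes "cone2 a b \<in> \<Phi>" shows "cone2 a (near_gen l a b) \<in> cut_cones l \<Phi>"
proof -
  have h: "{x. l \<bullet> x \<ge> 0} \<in> halves l" "{x. l \<bullet> x \<le> 0} \<in> halves l" by (simp_all add: halves_def)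
  consider "(l \<bullet> a) * (l \<bullet> b) \<ge> 0" | "l \<bullet> a > 0" "l \<bullet> b < 0" | "l \<bullet> a < 0" "l \<bullet> b > 0"
    by (smt (verit) mult_nonneg_nonneg mult_nonpos_nonpos)
  then show ?thesis
  proof cases
    case 1
    then show ?thesis using signed_mem_cut[OF assms signed_cone2[OF 1]] by (simp add: near_gen_def)
  next
    case 2
    then have "near_gen l a b = cross l a b" by (simp add: near_gen_def cross_def mult_pos_neg)
    then show ?thesis using cut_conesI[OF assms h(1)] cut_cone2(1)[OF 2] by simp
  next
    case 3
    then have "near_gen l a b = cross l b a" by (simp add: near_gen_def cross_def mult_neg_pos)
    then show ?thesis using cut_conesI[OF assms h(2)] cut_cone2(2)[of l b a] 3
      by (simp add: cone2_commute)
  qed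
qed

text \<open>Around an old ray the cut neither creates nor destroys 2-cones; each one shrinks to its
  piece at the ray. A 2-cone of the cut fan at this ray lies on the same side of it as the near
  piece of its parent, so \<open>same_side_cone_eq\<close> identifies the two.\<close>

lemma facet_star_cut_old:
  fixes \<Phi> :: "(real^'n) set set"
  assumes P: "pure_fan 2 \<Phi>" and l: "l \<in> lattice_points" and a: "prim a" "ray a \<in> \<Phi>"
  shows "facet_star (cut_cones l \<Phi>) (ray a) = (\<lambda>b. cone2 a (near_gen l a b)) ` link \<Phi> a"
    and "inj_on (\<lambda>b. cone2 a (near_gen l a b)) (link \<Phi> a)"
proof -
  note P' = pure_fan_cut[OF P l]
  have d: "Suc (dim (ray a)) = 2" using dim_ray[of a] prim_nz[OF a(1)] by simp
  show "facet_star (cut_cones l \<Phi>) (ray a) = (\<lambda>b. cone2 a (near_gen l a b)) ` link \<Phi> a"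
  proof (intro equalityI subsetI)
    fix \<tau> assume "\<tau> \<in> (\<lambda>b. cone2 a (near_gen l a b)) ` link \<Phi> a"
    then obtain b where b: "b \<in> link \<Phi> a" "\<tau> = cone2 a (near_gen l a b)" by blast
    then have "cone2 a b \<in> \<Phi>" "gram a b > 0" by (auto simp: link_def)
    then show "\<tau> \<in> facet_star (cut_cones l \<Phi>) (ray a)"
      unfolding facet_star_def d cones_of_dim_def b(2)
      using near_gen_mem_cut[of a b \<Phi> l] cone2_near_gen(1)[of a b l] by (auto simp: dim_cone2 ray_face_cone2)
  next
    fix \<tau> assume "\<tau> \<in> facet_star (cut_cones l \<Phi>) (ray a)"
    then have \<tau>: "\<tau> \<in> cones_of_dim (cut_cones l \<Phi>) 2" "ray a face_of \<tau>" unfolding facet_star_def d by auto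
    obtain c where c: "c \<in> link (cut_cones l \<Phi>) a" "\<tau> = cone2 a c"
      using cone2_ray_face[OF P' a(1) \<tau>(2,1)] by blast
    obtain \<sigma> where \<sigma>: "\<sigma> \<in> cones_of_dim \<Phi> 2" "\<tau> \<subseteq> \<sigma>" using cut_parent[OF P \<tau>(1)] by blast
    have "a \<in> \<sigma>" using \<sigma>(2) c(2) by auto
    then have "ray a face_of \<sigma>" using ray_in_cone_face[OF P a(2)] \<sigma>(1) by (auto simp: cones_of_dim_def)
    then obtain b where b: "b \<in> link \<Phi> a" "\<sigma> = cone2 a b"
      using cone2_ray_face[OF P a(1) _ \<sigma>(1)] by blast
    have g: "gram a b > 0" "gram a c > 0" "cone2 a b \<in> \<Phi>" "cone2 a c \<in> cut_cones l \<Phi>"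
      using b(1) c(1) by (auto simp: link_def)
    have "c \<in> cone2 a b" using \<sigma>(2) c(2) b(2) by auto
    then obtain s t where st: "c = s *\<^sub>R a + t *\<^sub>R b" "0 \<le> t" by (auto simp: cone2_def)
    have "t \<noteq> 0" using g(2) unfolding st(1) gram_shift by auto
    then have t: "t > 0" using st by simp
    obtain p q where pq: "near_gen l a b = p *\<^sub>R a + q *\<^sub>R b" "0 \<le> p" "0 < q" by (rule near_gen_comb)
    have "perp a (near_gen l a b) \<bullet> c > 0" unfolding pq(1) perp_shift st(1) using pq t g(1) by simp
    moreover have "c \<in> span {a, near_gen l a b}" unfolding pq(1) using pq
      by (subst span_shift) (auto simp: in_span2 st(1))
    ultimately have "cone2 a c = cone2 a (near_gen l a b)"
      using same_side_cone_eq[OF P' near_gen_mem_cut[OF g(3)] g(4) cone2_near_gen(1)[OF g(1)] g(2)] by blast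
    then show "\<tau> \<in> (\<lambda>b. cone2 a (near_gen l a b)) ` link \<Phi> a" using b c by blast
  qed
  show "inj_on (\<lambda>b. cone2 a (near_gen l a b)) (link \<Phi> a)"
  proof
    fix b c assume bc: "b \<in> link \<Phi> a" "c \<in> link \<Phi> a" "cone2 a (near_gen l a b) = cone2 a (near_gen l a c)"
    then have g: "gram a b > 0" "gram a c > 0" "cone2 a b \<in> \<Phi>" "cone2 a c \<in> \<Phi>" by (auto simp: link_def)
    have "cone2 a b = cone2 a c"
      using overlap_eq[OF P dim_cone2[OF cone2_near_gen(1)[OF g(1)]] g(3,4) cone2_near_gen(2)[OF g(1)]]
        cone2_near_gen(2)[OF g(2)] bc(3) by blast
    then show "b = c" using link_inj[of a \<Phi>] bc by (auto dest: inj_onD)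
  qed
qed

text \<open>A new ray runs through the interior of one old 2-cone. Every 2-cone around it has a
  parent containing that interior point, so the parent is this cone, and only its two pieces
  remain.\<close>

lemma new_ray_cut:
  fixes \<Phi> :: "(real^'n) set set"
  assumes P: "pure_fan 2 \<Phi>" and l: "l \<in> lattice_points" and e: "prim e" "ray e \<in> cut_cones l \<Phi>" "ray e \<notin> \<Phi>"
  obtains a b p q where "prim a" "prim b" "gram a b > 0" "cone2 a b \<in> \<Phi>" "p > 0" "q > 0"
    "e = p *\<^sub>R a + q *\<^sub>R b" "facet_star (cut_cones l \<Phi>) (ray e) = {cone2 e a, cone2 e b}"
proof -
  note P' = pure_fan_cut[OF P l]
  have d: "Suc (dim (ray e)) = 2" using dim_ray[of e] prim_nz[OF e(1)] by simp
  obtain \<sigma> A where \<sigma>: "ray e = \<sigma> \<inter> A" "\<sigma> \<in> \<Phi>" "A \<in> halves l" using e(2) by (auto simp: cut_cones_def)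
  obtain a b where ab: "prim a" "prim b" "gram a b > 0" "\<sigma> = cone2 a b" "l \<bullet> a > 0" "l \<bullet> b < 0"
    and cs: "ray e = cone2 a (cross l a b) \<or> ray e = cone2 (cross l a b) b \<or> ray e = ray (cross l a b)"
    using P \<sigma>(2,3)
  proof (cases rule: cut_cases)
    case 1
    then show ?thesis using e(3) \<sigma>(1) by simp
  next
    case (2 a b)
    then show ?thesis using that[of a b] \<sigma>(1) by auto
  qed
  have gc: "gram a (cross l a b) > 0" "gram (cross l a b) b > 0" using ab by (auto simp: gram_cross)
  have re: "ray e = ray (cross l a b)"
    using cs ray_cone2_neq[OF gc(1), of e] ray_cone2_neq[OF gc(2), of e] by auto
  have "cross l a b \<noteq> 0" using gc by auto
  then obtain r where r: "r > 0" "e = r *\<^sub>R cross l a b" using ray_eq_scale[OF re] by blast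
  define p q where "p = r * (- (l \<bullet> b))" and "q = r * (l \<bullet> a)"
  have pq: "p > 0" "q > 0" "e = p *\<^sub>R a + q *\<^sub>R b"
    using r ab by (auto simp: p_def q_def cross_def scaleR_right_diff_distrib mult_pos_neg)
  have ge: "gram e a > 0" "gram e b > 0"
    using ab(3) pq(1,2) gram_comb[of p a q b 1 0] gram_comb[of p a q b 0 1] by (simp_all add: pq(3))
  have h: "{x. l \<bullet> x \<ge> 0} \<in> halves l" "{x. l \<bullet> x \<le> 0} \<in> halves l" by (simp_all add: halves_def)
  have "cone2 e a = cone2 a (cross l a b)" "cone2 e b = cone2 (cross l a b) b"
    using cone2_cong_ray[OF re refl] by (simp_all add: cone2_commute)
  then have mem: "cone2 e a \<in> cut_cones l \<Phi>" "cone2 e b \<in> cut_cones l \<Phi>"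
    using cut_conesI[OF \<sigma>(2) h(1)] cut_conesI[OF \<sigma>(2) h(2)] cut_cone2[OF ab(5,6)] ab(4) by simp_all
  have "facet_star (cut_cones l \<Phi>) (ray e) = {cone2 e a, cone2 e b}"
  proof (intro equalityI subsetI)
    fix \<tau> assume "\<tau> \<in> {cone2 e a, cone2 e b}"
    then show "\<tau> \<in> facet_star (cut_cones l \<Phi>) (ray e)"
      using mem ge unfolding facet_star_def d cones_of_dim_def by (auto simp: dim_cone2 ray_face_cone2)
  next
    fix \<tau> assume "\<tau> \<in> facet_star (cut_cones l \<Phi>) (ray e)"
    then have \<tau>: "\<tau> \<in> cones_of_dim (cut_cones l \<Phi>) 2" "ray e face_of \<tau>" unfolding facet_star_def d by auto
    obtain c where c: "c \<in> link (cut_cones l \<Phi>) e" "\<tau> = cone2 e c"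
      using cone2_ray_face[OF P' e(1) \<tau>(2,1)] by blast
    obtain \<sigma>' where \<sigma>': "\<sigma>' \<in> cones_of_dim \<Phi> 2" "\<tau> \<subseteq> \<sigma>'" using cut_parent[OF P \<tau>(1)] by blast
    have "e \<in> \<sigma>'" using \<sigma>'(2) c(2) by auto
    then have "\<sigma>' = cone2 a b"
      using interior_cone_eq[OF P _ ab(3) _ pq(1,2)] \<sigma>(2) ab(4) \<sigma>'(1) pq(3) by (auto simp: cones_of_dim_def)
    then have "c \<in> cone2 a b" using \<sigma>'(2) c(2) by auto
    then obtain s t where st: "c = s *\<^sub>R a + t *\<^sub>R b" by (auto simp: cone2_def)
    have g: "gram e c > 0" "cone2 e c \<in> cut_cones l \<Phi>" using c(1) by (auto simp: link_def)
    have sp: "span {e, a} = span {a, b}" "span {e, b} = span {a, b}"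
      using span_shift[of q a p b] span_shift[of p b q a] pq by (simp_all add: insert_commute add.commute)
    have cs: "c \<in> span {e, a}" "c \<in> span {e, b}" unfolding sp by (auto simp: in_span2 st)
    obtain x y where xy: "c = x *\<^sub>R e + y *\<^sub>R a" using cs(1) by (auto simp: in_span2)
    \<comment> \<open>Seen from \<open>e\<close>, the generators \<open>a\<close> and
      \<open>b\<close> lie on opposite sides, so the sign of \<open>y\<close> decides which piece
      contains \<open>c\<close>.\<close>
    have "a = (1 / p) *\<^sub>R e + (- q / p) *\<^sub>R b" using pq by (simp add: algebra_simps)
    then have pa: "perp e b \<bullet> a = (- q / p) * gram e b" by (metis perp_comb(1))
    have y: "y \<noteq> 0" using g(1) unfolding xy gram_shift by auto
    show "\<tau> \<in> {cone2 e a, cone2 e b}"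
    proof (cases "y > 0")
      case True
      then have "perp e a \<bullet> c > 0" unfolding xy using ge by simp
      then show ?thesis using same_side_cone_eq[OF P' mem(1) g(2) ge(1) g(1) cs(1)] c(2) by simp
    next
      case False
      have "perp e b \<bullet> c = y * ((- q / p) * gram e b)"
        unfolding xy inner_add_right inner_scaleR_right pa perp_left by simp
      moreover have "(- q / p) * gram e b < 0" using ge(2) pq(1,2) by (simp add: divide_neg_pos mult_neg_pos)
      moreover have "y < 0" using False y by simp
      ultimately have "perp e b \<bullet> c > 0" by (metis mult_neg_neg)
      then show ?thesis using same_side_cone_eq[OF P' mem(2) g(2) ge(2) g(1) cs(2)] c(2) by simp
    qed
  qed
  then show ?thesis using that ab \<sigma>(2) pq by blast
qed

section \<open>Balancing and product weights under a cut\<close>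

lemma tropical_pure: "tropical_fan k F \<Longrightarrow> pure_fan k (cones F)"
  by (simp add: tropical_fan_def)

lemma tropical_weight_pos:
  "tropical_fan k F \<Longrightarrow> \<sigma> \<in> cones_of_dim (cones F) k \<Longrightarrow> weight F \<sigma> \<in> \<nat> \<and> weight F \<sigma> > 0"
  by (simp add: tropical_fan_def)

lemma tropical_weight_0:
  "tropical_fan k F \<Longrightarrow> \<sigma> \<notin> cones_of_dim (cones F) k \<Longrightarrow> weight F \<sigma> = 0"
  by (simp add: tropical_fan_def)

lemma linear_extension_eq:
  assumes "linear L" "\<And>x. x \<in> \<sigma> \<Longrightarrow> L x = T x" "x \<in> span \<sigma>"
  shows "linear_extension \<sigma> T x = L x"
proof -
  have "linear (linear_extension \<sigma> T) \<and> (\<forall>x\<in>\<sigma>. linear_extension \<sigma> T x = T x)"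
    unfolding linear_extension_def by (rule someI[of _ L]) (use assms in auto)
  then show ?thesis using linear_eq_on[of "linear_extension \<sigma> T" L x \<sigma>] assms by auto
qed

lemma link_prim:
  assumes "b \<in> link \<Phi> a"
  shows "prim b" "b \<in> lattice_points" "gram a b > 0" "cone2 a b \<in> \<Phi>" "cone2 a b \<in> cones_of_dim \<Phi> 2"
  using assms by (auto simp: link_def prim_lattice cones_of_dim_def dim_cone2)

lemma linear_on_subset: "linear_on_cone \<sigma> T \<Longrightarrow> \<tau> \<subseteq> \<sigma> \<Longrightarrow> linear_on_cone \<tau> T"
  by (auto simp: linear_on_cone_def)

context
  fixes F :: "'n::finite weighted_fan" and l :: "real^'n"
  assumes F: "tropical_fan 2 F" and l: "l \<in> lattice_points"
begin

lemma pure_F: "pure_fan 2 (cones F)"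
  using F by (rule tropical_pure)

text \<open>The summand \<open>g\<close> is left open so that the same reindexing serves both the
  vector sum of the balancing condition and the scalar sum of a product weight.\<close>

lemma cut_star_sum_old:
  fixes h :: "(real^'n) set \<Rightarrow> 'b::comm_monoid_add"
  assumes a: "prim a" "ray a \<in> cones F"
    and g: "\<And>b. b \<in> link (cones F) a \<Longrightarrow>
      g (weight F (cone2 a b)) (cone2 a (near_gen l a b)) = h (cone2 a b)"
  shows "(\<Sum>\<sigma>\<in>facet_star (cut_cones l (cones F)) (ray a). g (weight (cut l F) \<sigma>) \<sigma>) =
     (\<Sum>\<sigma>\<in>facet_star (cones F) (ray a). h \<sigma>)"
proof -
  note FS = facet_star_cut_old[OF pure_F l a]
  have w: "weight (cut l F) (cone2 a (near_gen l a b)) = weight F (cone2 a b)" if "b \<in> link (cones F) a" for b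
  proof -
    note b = link_prim[OF that]
    show ?thesis
      using weight_cut[OF pure_F _ b(5) cone2_near_gen(2)[OF b(3)], of l l] near_gen_mem_cut[OF b(4), of l]
        dim_cone2[OF cone2_near_gen(1)[OF b(3), of l]] by (simp add: cones_of_dim_def)
  qed
  show ?thesis
    unfolding FS(1) facet_star_ray[OF pure_F a(1)]
    by (subst sum.reindex[OF FS(2)], subst sum.reindex[OF link_inj], rule sum.cong) (auto simp: w g)
qed

text \<open>The star consists of two halves of one old cone with the weight of that cone and with
  normals that are opposite modulo the ray, so every weighted sum over it collapses to two
  terms.\<close>

lemma cut_star_sum_new:
  assumes e: "prim e" "ray e \<in> cut_cones l (cones F)" "ray e \<notin> cones F"
  obtains \<sigma> v v' where "\<sigma> \<in> cones F" "ray e \<subseteq> \<sigma>" "v \<in> span \<sigma>" "v' \<in> span \<sigma>" "v + v' \<in> span {e}"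
    "\<And>\<tau>. \<tau> \<in> facet_star (cut_cones l (cones F)) (ray e) \<Longrightarrow> \<tau> \<subseteq> \<sigma> \<and> span \<tau> = span \<sigma>"
    "\<And>g :: real \<Rightarrow> real^'n \<Rightarrow> 'c::comm_monoid_add. (\<Sum>\<tau>\<in>facet_star (cut_cones l (cones F)) (ray e).
       g (weight (cut l F) \<tau>) (lattice_normal \<tau> (ray e))) = g (weight F \<sigma>) v + g (weight F \<sigma>) v'"
proof -
  obtain a b p q where ab: "prim a" "prim b" "gram a b > 0" "cone2 a b \<in> cones F" and pq: "p > 0" "q > 0"
    "e = p *\<^sub>R a + q *\<^sub>R b" and fs: "facet_star (cut_cones l (cones F)) (ray e) = {cone2 e a, cone2 e b}"
    using new_ray_cut[OF pure_F l e] by blast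
  let ?\<sigma> = "cone2 a b" and ?v = "lattice_normal (cone2 e a) (ray e)" and ?v' = "lattice_normal (cone2 e b) (ray e)"
  have ge: "gram e a > 0" "gram e b > 0"
    using ab(3) pq(1,2) gram_comb[of p a q b 1 0] gram_comb[of p a q b 0 1] by (simp_all add: pq(3))
  have lat: "a \<in> lattice_points" "b \<in> lattice_points" "e \<in> lattice_points"
    using ab e prim_lattice by auto
  have sp: "span {e, a} = span {a, b}" "span {e, b} = span {a, b}"
    using span_shift[of q a p b] span_shift[of p b q a] pq by (simp_all add: insert_commute add.commute)
  have em: "e \<in> ?\<sigma>" unfolding pq(3) using pq by (intro cone2I) auto
  have sub: "cone2 e a \<subseteq> ?\<sigma>" "cone2 e b \<subseteq> ?\<sigma>" using em by (simp_all add: cone2_subset convex_cone_cone2)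
  have "b = (1 / q) *\<^sub>R e + (- p / q) *\<^sub>R a" using pq by (simp add: algebra_simps)
  then have "perp e a \<bullet> b = (- p / q) * gram e a" by (metis perp_comb(1))
  then have neg: "perp e a \<bullet> b < 0" using ge pq by (simp add: divide_neg_pos mult_neg_pos)
  have opp: "?v + ?v' \<in> span {e}"
    by (rule opposite_lattice_normals[OF lat(3,1,2) ge _ neg]) (simp add: sp)
  have vs: "?v \<in> span ?\<sigma>" "?v' \<in> span ?\<sigma>"
    using lattice_normal_cone2(2)[OF lat(3,1) ge(1)] lattice_normal_cone2(2)[OF lat(3,2) ge(2)] sp
    by (simp_all add: span_cone2)
  have neq: "cone2 e a \<noteq> cone2 e b"
  proof
    assume "cone2 e a = cone2 e b"
    then have "b \<in> cone2 e a" by simp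
    then show False using perp_nonneg_cone2(1)[of b e a] neg by simp
  qed
  have c2: "?\<sigma> \<in> cones_of_dim (cones F) 2" using ab by (simp add: cones_of_dim_def dim_cone2)
  have "facet_star (cut_cones l (cones F)) (ray e) \<subseteq> cones_of_dim (cut_cones l (cones F)) (Suc (dim (ray e)))"
    unfolding facet_star_def by blast
  moreover have "Suc (dim (ray e)) = 2" using dim_ray[of e] prim_nz[OF e(1)] by simp
  ultimately have "{cone2 e a, cone2 e b} \<subseteq> cones_of_dim (cut_cones l (cones F)) 2"
    unfolding fs by simp
  then have w: "weight (cut l F) (cone2 e a) = weight F ?\<sigma>" "weight (cut l F) (cone2 e b) = weight F ?\<sigma>"
    using weight_cut[OF pure_F _ c2 sub(1)] weight_cut[OF pure_F _ c2 sub(2)] by auto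
  show ?thesis
  proof (rule that[of ?\<sigma> ?v ?v'])
    show "ray e \<subseteq> ?\<sigma>" using em by (intro ray_subset convex_cone_cone2)
    show "\<tau> \<subseteq> ?\<sigma> \<and> span \<tau> = span ?\<sigma>" if "\<tau> \<in> facet_star (cut_cones l (cones F)) (ray e)" for \<tau>
      using that sub sp unfolding fs by (auto simp: span_cone2)
    show "(\<Sum>\<tau>\<in>facet_star (cut_cones l (cones F)) (ray e). g (weight (cut l F) \<tau>) (lattice_normal \<tau> (ray e)))
      = g (weight F ?\<sigma>) ?v + g (weight F ?\<sigma>) ?v'" for g :: "real \<Rightarrow> real^'n \<Rightarrow> 'c"
      unfolding fs using neq w by simp
  qed (use ab vs opp in auto)
qed

text \<open>At an old ray the balancing sum is unchanged; at a new ray the two normals have equal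
  weights and cancel modulo the ray.\<close>

lemma tropical_cut: "tropical_fan 2 (cut l F)"
proof -
  note P' = pure_fan_cut[OF pure_F l]
  have bal: "(\<Sum>\<sigma>\<in>facet_star (cut_cones l (cones F)) \<tau>. weight (cut l F) \<sigma> *\<^sub>R lattice_normal \<sigma> \<tau>) \<in> span \<tau>"
    if \<tau>: "\<tau> \<in> cut_cones l (cones F)" "dim \<tau> = 1" for \<tau>
  proof -
    obtain a where a: "prim a" "\<tau> = ray a"
      using fan_1cone[OF P' order_refl, of \<tau>] \<tau> by (auto simp: cones_of_dim_def)
    show ?thesis
    proof (cases "ray a \<in> cones F")
      case True
      have "(\<Sum>\<sigma>\<in>facet_star (cut_cones l (cones F)) (ray a). weight (cut l F) \<sigma> *\<^sub>R lattice_normal \<sigma> (ray a)) =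
        (\<Sum>\<sigma>\<in>facet_star (cones F) (ray a). weight F \<sigma> *\<^sub>R lattice_normal \<sigma> (ray a))"
        by (rule cut_star_sum_old[OF a(1) True, where g = "\<lambda>w \<sigma>. w *\<^sub>R lattice_normal \<sigma> (ray a)"])
          (simp add: cone2_near_gen(4)[OF link_prim(3)])
      also have "\<dots> \<in> span (ray a)" using F True \<tau>(2) a(2) unfolding tropical_fan_def by simp
      finally show ?thesis unfolding a(2) .
    next
      case False
      obtain \<sigma> v v' where s: "v + v' \<in> span {a}" and \<sigma>:
        "\<And>g :: real \<Rightarrow> real^'n \<Rightarrow> real^'n. (\<Sum>\<tau>\<in>facet_star (cut_cones l (cones F)) (ray a).
       g (weight (cut l F) \<tau>) (lattice_normal \<tau> (ray a))) = g (weight F \<sigma>) v + g (weight F \<sigma>) v'"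
      proof -
        have "ray a \<in> cut_cones l (cones F)" using \<tau>(1) a(2) by simp
        show thesis
          by (rule cut_star_sum_new[OF a(1) \<open>ray a \<in> cut_cones l (cones F)\<close> False, where 'c = "real^'n"])
            (rule that)
      qed
      have "weight F \<sigma> *\<^sub>R v + weight F \<sigma> *\<^sub>R v' = weight F \<sigma> *\<^sub>R (v + v')"
        by (simp add: scaleR_add_right)
      then show ?thesis unfolding a(2) \<sigma>[of "\<lambda>w v. w *\<^sub>R v"] span_ray using s
        by (simp add: span_scale)
    qed
  qed
  have w: "weight (cut l F) \<sigma> \<in> \<nat> \<and> weight (cut l F) \<sigma> > 0"
    if \<sigma>: "\<sigma> \<in> cones_of_dim (cut_cones l (cones F)) 2" for \<sigma>
  proof -
    obtain \<rho> where "\<rho> \<in> cones_of_dim (cones F) 2" "\<sigma> \<subseteq> \<rho>" using cut_parent[OF pure_F \<sigma>] by blast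
    then show ?thesis using weight_cut[OF pure_F \<sigma>] tropical_weight_pos[OF F] by metis
  qed
  show ?thesis unfolding tropical_fan_def cones_cut
    using P' bal w by (auto simp: cut_def)
qed

lemma Union_cut: "\<Union>(cut_cones l (cones F)) = \<Union>(cones F)"
proof
  show "\<Union>(cut_cones l (cones F)) \<subseteq> \<Union>(cones F)" by (auto simp: cut_cones_def)
  show "\<Union>(cones F) \<subseteq> \<Union>(cut_cones l (cones F))"
  proof
    fix x assume "x \<in> \<Union>(cones F)"
    then obtain \<sigma> where \<sigma>: "\<sigma> \<in> cones F" "x \<in> \<sigma>" by blast
    have h: "{x. l \<bullet> x \<ge> 0} \<in> halves l" "{x. l \<bullet> x \<le> 0} \<in> halves l" by (simp_all add: halves_def)
    have "x \<in> \<sigma> \<inter> {x. l \<bullet> x \<ge> 0} \<or> x \<in> \<sigma> \<inter> {x. l \<bullet> x \<le> 0}" using \<sigma> by auto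
    then show "x \<in> \<Union>(cut_cones l (cones F))" using cut_conesI[OF \<sigma>(1)] h by blast
  qed
qed

lemma refines_cut: "refines 2 (cut l F) F"
  unfolding refines_def cones_cut
  using tropical_cut F Union_cut weight_cut[OF pure_F] by (auto simp: cut_cones_def)

lemma product_weight_cut_old:
  assumes T: "\<And>\<sigma>. \<sigma> \<in> cones F \<Longrightarrow> linear_on_cone \<sigma> T" and a: "prim a" "ray a \<in> cones F"
  shows "product_weight T (cut l F) (ray a) = product_weight T F (ray a)"
proof -
  have 1: "(\<Sum>\<sigma>\<in>facet_star (cut_cones l (cones F)) (ray a). weight (cut l F) \<sigma> *\<^sub>R lattice_normal \<sigma> (ray a)) =
        (\<Sum>\<sigma>\<in>facet_star (cones F) (ray a). weight F \<sigma> *\<^sub>R lattice_normal \<sigma> (ray a))"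
    by (rule cut_star_sum_old[OF a, where g = "\<lambda>w \<sigma>. w *\<^sub>R lattice_normal \<sigma> (ray a)"])
       (simp add: cone2_near_gen(4)[OF link_prim(3)])
  have 2: "(\<Sum>\<sigma>\<in>facet_star (cut_cones l (cones F)) (ray a). weight (cut l F) \<sigma> * linear_extension \<sigma> T (lattice_normal \<sigma> (ray a))) =
        (\<Sum>\<sigma>\<in>facet_star (cones F) (ray a). weight F \<sigma> * linear_extension \<sigma> T (lattice_normal \<sigma> (ray a)))"
  proof (rule cut_star_sum_old[OF a, where g = "\<lambda>w \<sigma>. w * linear_extension \<sigma> T (lattice_normal \<sigma> (ray a))"])
    fix b assume "b \<in> link (cones F) a"
    note b = link_prim[OF this]
    obtain L where L: "linear L" "\<And>x. x \<in> cone2 a b \<Longrightarrow> L x = T x"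
      using T[OF b(4)] by (auto simp: linear_on_cone_def)
    have v: "lattice_normal (cone2 a b) (ray a) \<in> span (cone2 a b)"
      using lattice_normal_cone2(2)[OF prim_lattice[OF a(1)] b(2,3)] by (simp add: span_cone2)
    have "linear_extension (cone2 a b) T (lattice_normal (cone2 a b) (ray a)) = L (lattice_normal (cone2 a b) (ray a))"
      by (rule linear_extension_eq[OF L v])
    moreover have "linear_extension (cone2 a (near_gen l a b)) T (lattice_normal (cone2 a b) (ray a)) = L (lattice_normal (cone2 a b) (ray a))"
      by (rule linear_extension_eq[OF L(1)]) (use L(2) v cone2_near_gen(2,3)[OF b(3)] in auto)
    ultimately show "weight F (cone2 a b) * linear_extension (cone2 a (near_gen l a b)) T (lattice_normal (cone2 a (near_gen l a b)) (ray a)) =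
      weight F (cone2 a b) * linear_extension (cone2 a b) T (lattice_normal (cone2 a b) (ray a))"
      by (simp add: cone2_near_gen(4)[OF b(3)])
  qed
  show ?thesis unfolding product_weight_def cones_cut 1 2 ..
qed

text \<open>On both sides of the new ray \<open>T\<close> is given by one linear function, so the
  star sum equals its value at the balancing vector, which is exactly the correction term that is
  subtracted.\<close>

lemma product_weight_cut_new:
  assumes T: "\<And>\<sigma>. \<sigma> \<in> cones F \<Longrightarrow> linear_on_cone \<sigma> T"
    and e: "prim e" "ray e \<in> cut_cones l (cones F)" "ray e \<notin> cones F"
  shows "product_weight T (cut l F) (ray e) = 0"
proof -
  let ?S = "facet_star (cut_cones l (cones F)) (ray e)"
  \<comment> \<open>Pair-valued summands make one instance yield the vector sum and the scalar sum
    with the same \<open>v\<close> and \<open>v'\<close>; \<open>fst\<close> and \<open>snd\<close>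
    separate them below.\<close>
  obtain \<sigma> v v' where \<sigma>: "\<sigma> \<in> cones F" "ray e \<subseteq> \<sigma>" and v: "v \<in> span \<sigma>" "v' \<in> span \<sigma>" "v + v' \<in> span {e}"
    and sub: "\<And>\<tau>. \<tau> \<in> ?S \<Longrightarrow> \<tau> \<subseteq> \<sigma> \<and> span \<tau> = span \<sigma>"
    and sum: "\<And>g :: real \<Rightarrow> real^'n \<Rightarrow> (real^'n) \<times> real. (\<Sum>\<tau>\<in>?S.
       g (weight (cut l F) \<tau>) (lattice_normal \<tau> (ray e))) = g (weight F \<sigma>) v + g (weight F \<sigma>) v'"
    by (rule cut_star_sum_new[OF e, where 'c = "(real^'n) \<times> real"]) (rule that)
  obtain L where L: "linear L" "\<And>x. x \<in> \<sigma> \<Longrightarrow> L x = T x"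
    using T[OF \<sigma>(1)] by (auto simp: linear_on_cone_def)
  interpret L: linear L by (rule L)
  have s1: "(\<Sum>\<tau>\<in>?S. weight (cut l F) \<tau> *\<^sub>R lattice_normal \<tau> (ray e)) = weight F \<sigma> *\<^sub>R (v + v')"
    using sum[of "\<lambda>w x. (w *\<^sub>R x, 0)", THEN arg_cong[of _ _ fst]]
    by (simp add: fst_sum scaleR_add_right)
  have s2: "(\<Sum>\<tau>\<in>?S. weight (cut l F) \<tau> * L (lattice_normal \<tau> (ray e))) = weight F \<sigma> * L (v + v')"
    using sum[of "\<lambda>w x. (0, w * L x)", THEN arg_cong[of _ _ snd]]
    by (simp add: snd_sum L.add distrib_left)
  have ln: "lattice_normal \<tau> (ray e) \<in> span \<tau>" if "\<tau> \<in> ?S" for \<tau>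
  proof -
    have "\<tau> \<in> cone2 e ` link (cut_cones l (cones F)) e"
      using that facet_star_ray[OF pure_fan_cut[OF pure_F l] e(1)] by simp
    then obtain b where "b \<in> link (cut_cones l (cones F)) e" "\<tau> = cone2 e b" by blast
    then show ?thesis
      using lattice_normal_cone2(2)[OF prim_lattice[OF e(1)] link_prim(2,3)] by (simp add: span_cone2)
  qed
  have le: "linear_extension \<tau> T (lattice_normal \<tau> (ray e)) = L (lattice_normal \<tau> (ray e))" if "\<tau> \<in> ?S" for \<tau>
    by (rule linear_extension_eq[OF L(1) _ ln[OF that]]) (use L(2) sub[OF that] in auto)
  have "linear_extension (ray e) T (weight F \<sigma> *\<^sub>R (v + v')) = L (weight F \<sigma> *\<^sub>R (v + v'))"
    by (rule linear_extension_eq[OF L(1)]) (use L(2) \<sigma>(2) v(3) in \<open>auto simp: span_ray intro: span_scale\<close>)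
  then show ?thesis unfolding product_weight_def cones_cut s1
    using s2 le by (simp add: L.scale)
qed

end

section \<open>Cycles and their weighted supports\<close>

text \<open>The part of the support that carries weight \<open>w\<close>. As a function of
  \<open>w\<close> this is a complete invariant of a 2-cycle, see
  \<open>fan_equiv_2\<close>.\<close>

definition level :: "'n::finite weighted_fan \<Rightarrow> real \<Rightarrow> (real^'n) set" where
  "level F w = \<Union>{\<sigma> \<in> cones_of_dim (cones F) 2. weight F \<sigma> = w}"

lemma closed_level:
  fixes F :: "'n::finite weighted_fan"
  assumes "pure_fan 2 (cones F)" shows "closed (level F w)"
  unfolding level_def
proof (rule closed_Union)
  show "finite {\<sigma> \<in> cones_of_dim (cones F) 2. weight F \<sigma> = w}"
    using fan_finite[OF assms] by (simp add: cones_of_dim_def)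
  show "\<forall>T\<in>{\<sigma> \<in> cones_of_dim (cones F) 2. weight F \<sigma> = w}. closed T"
    using fan_2cone[OF assms] closed_cone2 by (metis (no_types, lifting) mem_Collect_eq)
qed

lemma cone2_subset_closed:
  fixes a b :: "real^'n"
  assumes "closed C" "\<And>s t. s > 0 \<Longrightarrow> t > 0 \<Longrightarrow> s *\<^sub>R a + t *\<^sub>R b \<in> C"
  shows "cone2 a b \<subseteq> C"
proof
  fix x assume "x \<in> cone2 a b"
  then obtain s t where x: "x = s *\<^sub>R a + t *\<^sub>R b" "0 \<le> s" "0 \<le> t" by (auto simp: cone2_def)
  let ?f = "\<lambda>n. (s + inverse (real (Suc n))) *\<^sub>R a + (t + inverse (real (Suc n))) *\<^sub>R b"
  have "?f \<longlonglongrightarrow> (s + 0) *\<^sub>R a + (t + 0) *\<^sub>R b"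
    by (intro tendsto_intros LIMSEQ_inverse_real_of_nat)
  then have "?f \<longlonglongrightarrow> x" using x by simp
  moreover have "?f n \<in> C" for n using x by (intro assms(2)) (auto intro: add_nonneg_pos)
  ultimately show "x \<in> C" using closed_sequentially[OF assms(1), of ?f x] by simp
qed

lemma refines_cone: "refines k H F \<Longrightarrow> \<sigma> \<in> cones H \<Longrightarrow> \<exists>\<tau>\<in>cones F. \<sigma> \<subseteq> \<tau>"
  by (simp add: refines_def)

lemma refines_weight:
  "refines k H F \<Longrightarrow> \<sigma>' \<in> cones_of_dim (cones H) k \<Longrightarrow> \<sigma> \<in> cones_of_dim (cones F) k \<Longrightarrow>
    \<sigma>' \<subseteq> \<sigma> \<Longrightarrow> weight H \<sigma>' = weight F \<sigma>"
  by (simp add: refines_def)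

lemma refines_tropical: "refines k H F \<Longrightarrow> tropical_fan k H" "refines k H F \<Longrightarrow> tropical_fan k F"
  by (simp_all add: refines_def)

lemma refines_Union: "refines k H F \<Longrightarrow> \<Union>(cones H) = \<Union>(cones F)"
  by (simp add: refines_def)

lemma refinesI:
  assumes "tropical_fan k H" "tropical_fan k F" "\<Union>(cones H) = \<Union>(cones F)"
    and "\<And>\<sigma>. \<sigma> \<in> cones H \<Longrightarrow> \<exists>\<tau>\<in>cones F. \<sigma> \<subseteq> \<tau>"
    and "\<And>\<sigma>' \<sigma>. \<sigma>' \<in> cones_of_dim (cones H) k \<Longrightarrow> \<sigma> \<in> cones_of_dim (cones F) k \<Longrightarrow>
      \<sigma>' \<subseteq> \<sigma> \<Longrightarrow> weight H \<sigma>' = weight F \<sigma>"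
  shows "refines k H F"
  using assms by (simp add: refines_def)

text \<open>One inclusion follows from the parents of the refined cones. For the other, a 2-cone of
  \<open>H\<close> through an interior point of a cone of \<open>F\<close> has that cone as parent
  and so carries its weight; closedness adds the boundary.\<close>

lemma level_refines:
  assumes "refines 2 H F" shows "level H = level F"
proof (intro ext equalityI subsetI)
  have P: "pure_fan 2 (cones H)" "pure_fan 2 (cones F)"
    using refines_tropical[OF assms] by (simp_all add: tropical_pure)
  have ref: "\<exists>\<sigma>\<in>cones_of_dim (cones F) 2. \<sigma>' \<subseteq> \<sigma> \<and> weight H \<sigma>' = weight F \<sigma>"
    if \<sigma>': "\<sigma>' \<in> cones_of_dim (cones H) 2" for \<sigma>'
  proof -
    obtain \<sigma> where \<sigma>: "\<sigma> \<in> cones F" "\<sigma>' \<subseteq> \<sigma>"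
      using refines_cone[OF assms] cones_of_dimD[OF \<sigma>'] by metis
    have "dim \<sigma> = 2" using dim_subset[OF \<sigma>(2)] fan_dim_le[OF P(2) \<sigma>(1)] \<sigma>' by (simp add: cones_of_dim_def)
    then have "\<sigma> \<in> cones_of_dim (cones F) 2" using \<sigma> by (simp add: cones_of_dim_def)
    then show ?thesis using \<sigma>(2) refines_weight[OF assms \<sigma>'] by metis
  qed
  fix w x
  show "x \<in> level F w" if x: "x \<in> level H w"
  proof -
    obtain \<sigma>' where s: "\<sigma>' \<in> cones_of_dim (cones H) 2" "weight H \<sigma>' = w" "x \<in> \<sigma>'"
      using x by (auto simp: level_def)
    obtain \<sigma> where "\<sigma> \<in> cones_of_dim (cones F) 2" "\<sigma>' \<subseteq> \<sigma>" "weight H \<sigma>' = weight F \<sigma>"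
      using ref[OF s(1)] by blast
    then show ?thesis using s by (auto simp: level_def)
  qed
  assume "x \<in> level F w"
  then obtain \<sigma> where \<sigma>: "\<sigma> \<in> cones_of_dim (cones F) 2" "weight F \<sigma> = w" "x \<in> \<sigma>"
    by (auto simp: level_def)
  obtain a b where ab: "gram a b > 0" "\<sigma> = cone2 a b" using fan_2cone[OF P(2) \<sigma>(1)] by blast
  have "cone2 a b \<subseteq> level H w"
  proof (rule cone2_subset_closed[OF closed_level[OF P(1)]])
    fix s t :: real assume st: "s > 0" "t > 0"
    let ?y = "s *\<^sub>R a + t *\<^sub>R b"
    have y: "?y \<in> \<sigma>" unfolding ab using st by (intro cone2I) auto
    have "?y \<in> \<Union>(cones H)" unfolding refines_Union[OF assms] using y cones_of_dimD[OF \<sigma>(1)] by blast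
    then obtain \<tau> where \<tau>: "\<tau> \<in> cones_of_dim (cones H) 2" "?y \<in> \<tau>"
      using fan_maximal[OF P(1)] by (metis UnionE subsetD)
    obtain \<rho> where \<rho>: "\<rho> \<in> cones_of_dim (cones F) 2" "\<tau> \<subseteq> \<rho>" "weight H \<tau> = weight F \<rho>"
      using ref[OF \<tau>(1)] by blast
    have "\<rho> = cone2 a b"
      using interior_cone_eq[OF P(2) _ ab(1) _ st] \<rho> \<tau>(2) \<sigma>(1) ab(2) by (auto simp: cones_of_dim_def)
    then show "?y \<in> level H w" using \<tau> \<rho>(3) \<sigma>(2) ab(2) unfolding level_def by blast
  qed
  then show "x \<in> level H w" using \<sigma>(3) ab(2) by blast
qed

section \<open>Iterated cuts and common refinements\<close>

definition cuts :: "(real^'n) list \<Rightarrow> 'n::finite weighted_fan \<Rightarrow> 'n weighted_fan" where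
  "cuts ls F = fold cut ls F"

lemma cuts_Nil [simp]: "cuts [] F = F"
  and cuts_Cons [simp]: "cuts (l # ls) F = cuts ls (cut l F)"
  by (simp_all add: cuts_def)

lemma tropical_cuts:
  "tropical_fan 2 F \<Longrightarrow> set ls \<subseteq> lattice_points \<Longrightarrow> tropical_fan 2 (cuts ls F)"
  by (induction ls arbitrary: F) (auto simp: tropical_cut)

lemma level_cuts:
  "tropical_fan 2 F \<Longrightarrow> set ls \<subseteq> lattice_points \<Longrightarrow> level (cuts ls F) = level F"
  by (induction ls arbitrary: F) (auto simp: tropical_cut level_refines[OF refines_cut])

lemma cuts_subset:
  "\<sigma> \<in> cones (cuts ls F) \<Longrightarrow> \<exists>\<tau>\<in>cones F. \<sigma> \<subseteq> \<tau>"
proof (induction ls arbitrary: F)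
  case (Cons l ls)
  obtain \<tau> where "\<tau> \<in> cones (cut l F)" "\<sigma> \<subseteq> \<tau>" using Cons.IH[of "cut l F"] Cons.prems by fastforce
  then show ?case by (auto simp: cut_cones_def)
qed auto

lemma signed_cuts:
  "\<sigma> \<in> cones (cuts ls F) \<Longrightarrow> l \<in> set ls \<Longrightarrow> signed l \<sigma>"
proof (induction ls arbitrary: F)
  case (Cons k ls)
  obtain \<tau> where "\<tau> \<in> cones (cut k F)" "\<sigma> \<subseteq> \<tau>"
    using cuts_subset[of \<sigma> ls "cut k F"] Cons.prems by fastforce
  then have "signed k \<sigma>" using signed_cut signed_subset by (metis cones_cut)
  then show ?case using Cons by auto
qed auto

lemma subset_cuts:
  assumes "\<And>l. l \<in> set ls \<Longrightarrow> signed l \<sigma>" "\<tau> \<in> cones F" "\<sigma> \<subseteq> \<tau>"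
  shows "\<exists>\<rho>\<in>cones (cuts ls F). \<sigma> \<subseteq> \<rho>"
  using assms
proof (induction ls arbitrary: F \<tau>)
  case (Cons l ls)
  obtain A where "A \<in> halves l" "\<sigma> \<subseteq> A" using signed_half Cons.prems(1) by (metis list.set_intros(1))
  then have "\<tau> \<inter> A \<in> cones (cut l F)" "\<sigma> \<subseteq> \<tau> \<inter> A" using Cons.prems cut_conesI by auto
  then show ?case using Cons.IH[of "\<tau> \<inter> A" "cut l F"] Cons.prems(1) by simp
qed auto

text \<open>\<open>gram a b\<close> times the coordinate vector of a point minus its orthogonal projection
  to the plane of \<open>a\<close> and \<open>b\<close> is given by the covectors \<open>plane_eq a b i\<close>.\<close>

definition plane_eq :: "real^'n \<Rightarrow> real^'n \<Rightarrow> 'n \<Rightarrow> real^'n" where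
  "plane_eq a b i = gram a b *\<^sub>R axis i 1 - (perp b a $ i) *\<^sub>R a - (perp a b $ i) *\<^sub>R b"

lemma plane_eq_inner:
  fixes x :: "real^'n"
  shows "plane_eq a b i \<bullet> x = gram a b * x $ i - perp b a $ i * (a \<bullet> x) - perp a b $ i * (b \<bullet> x)"
  by (simp add: plane_eq_def inner_diff_left inner_axis' )

lemma plane_eq_span:
  fixes x :: "real^'n"
  assumes "gram a b > 0" "\<And>i. plane_eq a b i \<bullet> x = 0"
  shows "x \<in> span {a, b}"
proof -
  have "gram a b *\<^sub>R x = (a \<bullet> x) *\<^sub>R perp b a + (b \<bullet> x) *\<^sub>R perp a b"
    using assms(2) by (simp add: vec_eq_iff plane_eq_inner algebra_simps)
  moreover have "perp a b \<in> span {a, b}" "perp b a \<in> span {a, b}"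
    unfolding perp_def by (auto intro!: span_diff span_scale intro: span_base)
  ultimately have "gram a b *\<^sub>R x \<in> span {a, b}" by (simp add: span_add span_scale)
  then have "(1 / gram a b) *\<^sub>R gram a b *\<^sub>R x \<in> span {a, b}" by (rule span_scale)
  then show ?thesis using assms(1) by simp
qed

lemma plane_eq_lattice:
  assumes "a \<in> lattice_points" "b \<in> lattice_points"
  shows "plane_eq a b i \<in> lattice_points"
proof -
  have "perp a b $ i \<in> \<int>" "perp b a $ i \<in> \<int>"
    using lattice_perp[OF assms] lattice_perp[OF assms(2,1)] by (auto simp: lattice_points_def)
  then show ?thesis unfolding plane_eq_def
    by (intro lattice_diff lattice_scaleR lattice_axis lattice_gram assms)
qed

text \<open>Covectors whose signs decide membership in \<open>cone2 a b\<close>: equations of the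
  plane, and one inequality for each boundary ray.\<close>

definition separators :: "real^'n \<Rightarrow> real^'n \<Rightarrow> (real^'n) set" where
  "separators a b = {perp a b, perp b a} \<union> range (plane_eq a b)"

lemma signed_cone2_zero:
  fixes u w :: "real^'n"
  assumes "signed l (cone2 u w)" "s > 0" "t > 0" "l \<bullet> (s *\<^sub>R u + t *\<^sub>R w) = 0" "x \<in> cone2 u w"
  shows "l \<bullet> x = 0"
proof -
  have "(l \<bullet> u \<ge> 0 \<and> l \<bullet> w \<ge> 0) \<or> (l \<bullet> u \<le> 0 \<and> l \<bullet> w \<le> 0)"
    using assms(1) cone2_mem[of u w] cone2_mem[of w u] unfolding signed_def by blast
  moreover have "s * (l \<bullet> u) + t * (l \<bullet> w) = 0" using assms(4) by (simp add: inner_add_right)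
  ultimately have "s * (l \<bullet> u) = 0 \<and> t * (l \<bullet> w) = 0"
    using assms(2,3) by (smt (verit) mult_nonneg_nonneg mult_nonneg_nonpos)
  then have "l \<bullet> u = 0" "l \<bullet> w = 0" using assms(2,3) by auto
  then show ?thesis using assms(5) by (auto simp: cone2_def inner_add_right)
qed

lemma signed_cone2_nonneg:
  fixes u w :: "real^'n"
  assumes "signed l (cone2 u w)" "s > 0" "t > 0" "l \<bullet> (s *\<^sub>R u + t *\<^sub>R w) \<ge> 0" "x \<in> cone2 u w"
  shows "l \<bullet> x \<ge> 0"
proof (cases "l \<bullet> (s *\<^sub>R u + t *\<^sub>R w) = 0")
  case True
  then show ?thesis using signed_cone2_zero[OF assms(1-3) True assms(5)] by simp
next
  case False
  have "s *\<^sub>R u + t *\<^sub>R w \<in> cone2 u w" using assms by (intro cone2I) auto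
  then show ?thesis using assms False unfolding signed_def by force
qed

text \<open>A covector of constant sign on a cone that vanishes, or is nonnegative, at an interior
  point does so on the whole cone. Hence all conditions for membership spread from one interior
  point.\<close>

lemma separated_subset:
  fixes a b u w :: "real^'n"
  assumes "gram a b > 0" "\<And>l. l \<in> separators a b \<Longrightarrow> signed l (cone2 u w)"
    and "s > 0" "t > 0" "s *\<^sub>R u + t *\<^sub>R w \<in> cone2 a b"
  shows "cone2 u w \<subseteq> cone2 a b"
proof
  fix x assume x: "x \<in> cone2 u w"
  let ?y = "s *\<^sub>R u + t *\<^sub>R w"
  have "plane_eq a b i \<bullet> ?y = 0" for i
  proof -
    obtain p q where y: "?y = p *\<^sub>R a + q *\<^sub>R b" using assms(5) by (auto simp: cone2_def)
    have "perp b a $ i * (a \<bullet> a) + perp a b $ i * (b \<bullet> a) = gram a b * a $ i"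
      "perp b a $ i * (a \<bullet> b) + perp a b $ i * (b \<bullet> b) = gram a b * b $ i"
      by (simp_all add: perp_def gram_def inner_commute[of b a] power2_eq_square algebra_simps)
    then have "plane_eq a b i \<bullet> a = 0" "plane_eq a b i \<bullet> b = 0"
      by (simp_all add: plane_eq_inner algebra_simps)
    then show ?thesis unfolding y by (simp add: inner_add_right)
  qed
  then have "plane_eq a b i \<bullet> x = 0" for i
    using signed_cone2_zero[OF assms(2) assms(3,4) _ x, of "plane_eq a b i"] by (simp add: separators_def)
  then have "x \<in> span {a, b}" by (rule plane_eq_span[OF assms(1)])
  moreover have "perp a b \<bullet> x \<ge> 0" "perp b a \<bullet> x \<ge> 0"
    using signed_cone2_nonneg[OF assms(2) assms(3,4) _ x, of "perp a b"]
      signed_cone2_nonneg[OF assms(2) assms(3,4) _ x, of "perp b a"]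
      perp_nonneg_cone2[OF assms(5)] by (simp_all add: separators_def)
  ultimately show "x \<in> cone2 a b" using cone2_functionals[OF assms(1)] by blast
qed

definition separating :: "(real^'n) set \<Rightarrow> 'n::finite weighted_fan \<Rightarrow> bool" where
  "separating S F \<longleftrightarrow> (\<forall>\<tau>\<in>cones_of_dim (cones F) 2.
     \<exists>a b. gram a b > 0 \<and> \<tau> = cone2 a b \<and> separators a b \<subseteq> S)"

lemma separating_mono:
  assumes "separating S F" "S \<subseteq> T" shows "separating T F"
  unfolding separating_def
proof
  fix \<tau> assume "\<tau> \<in> cones_of_dim (cones F) 2"
  then obtain a b where "gram a b > 0" "\<tau> = cone2 a b" "separators a b \<subseteq> S"
    using assms(1) unfolding separating_def by metis
  then show "\<exists>a b. gram a b > 0 \<and> \<tau> = cone2 a b \<and> separators a b \<subseteq> T"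
    using assms(2) by (intro exI[of _ a] exI[of _ b]) simp
qed

lemma ex_separating_list:
  fixes F :: "'n::finite weighted_fan"
  assumes P: "pure_fan 2 (cones F)"
  obtains ls where "set ls \<subseteq> lattice_points"
    "separating (set ls) F"
proof -
  have "\<forall>\<tau>\<in>cones_of_dim (cones F) 2. \<exists>S. finite S \<and> S \<subseteq> lattice_points \<and>
      (\<exists>a b. gram a b > 0 \<and> \<tau> = cone2 a b \<and> separators a b \<subseteq> S)"
  proof
    fix \<tau> assume "\<tau> \<in> cones_of_dim (cones F) 2"
    then obtain a b where ab: "prim a" "prim b" "gram a b > 0" "\<tau> = cone2 a b"
      using fan_2cone[OF P] by blast
    have "separators a b \<subseteq> lattice_points" "finite (separators a b)"
      using prim_lattice[OF ab(1)] prim_lattice[OF ab(2)]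
      by (auto simp: separators_def lattice_perp plane_eq_lattice)
    then show "\<exists>S. finite S \<and> S \<subseteq> lattice_points \<and>
      (\<exists>a b. gram a b > 0 \<and> \<tau> = cone2 a b \<and> separators a b \<subseteq> S)" using ab by blast
  qed
  then obtain S where S: "\<And>\<tau>. \<tau> \<in> cones_of_dim (cones F) 2 \<Longrightarrow> finite (S \<tau>) \<and> S \<tau> \<subseteq> lattice_points \<and>
      (\<exists>a b. gram a b > 0 \<and> \<tau> = cone2 a b \<and> separators a b \<subseteq> S \<tau>)" by metis
  have fin: "finite (cones_of_dim (cones F) 2)" using fan_finite[OF P] by (simp add: cones_of_dim_def)
  have S': "finite (S \<tau>)" "S \<tau> \<subseteq> lattice_points" if "\<tau> \<in> cones_of_dim (cones F) 2" for \<tau>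
    using S[OF that] by simp_all
  have "finite (\<Union>(S ` cones_of_dim (cones F) 2))" using S'(1) fin by simp
  then obtain ls where ls: "set ls = \<Union>(S ` cones_of_dim (cones F) 2)" using finite_list by blast
  show ?thesis
  proof (rule that[of ls])
    show "set ls \<subseteq> lattice_points" unfolding ls using S'(2) by (simp add: UN_least)
    show "separating (set ls) F"
      unfolding separating_def
    proof
      fix \<tau> assume \<tau>: "\<tau> \<in> cones_of_dim (cones F) 2"
      obtain a b where "gram a b > 0" "\<tau> = cone2 a b" "separators a b \<subseteq> S \<tau>" using S[OF \<tau>] by metis
      moreover have "S \<tau> \<subseteq> set ls" using \<tau> unfolding ls by auto
      ultimately show "\<exists>a b. gram a b > 0 \<and> \<tau> = cone2 a b \<and> separators a b \<subseteq> set ls"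
        by (intro exI[of _ a] exI[of _ b]) simp
    qed
  qed
qed

text \<open>Equal levels place the interior point \<open>u + w\<close> of \<open>\<sigma>\<close> in
  a 2-cone of \<open>G\<close>. The separators of that cone have constant sign on
  \<open>\<sigma>\<close>, so all of \<open>\<sigma>\<close> lies in it.\<close>

lemma cuts_cone_subset:
  fixes F G :: "'n::finite weighted_fan"
  assumes F: "tropical_fan 2 F" and G: "tropical_fan 2 G" and lev: "level F = level G"
    and ls: "set ls \<subseteq> lattice_points"
    and sep: "separating (set ls) G"
    and \<sigma>: "\<sigma> \<in> cones_of_dim (cones (cuts ls F)) 2"
  shows "\<exists>\<rho>\<in>cones (cuts ls G). \<sigma> \<subseteq> \<rho>"
proof -
  have P': "pure_fan 2 (cones (cuts ls F))" using tropical_cuts[OF F ls] by (rule tropical_pure)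
  obtain u w where uw: "gram u w > 0" "\<sigma> = cone2 u w" using fan_2cone[OF P' \<sigma>] by blast
  have "u + w \<in> \<sigma>" unfolding uw(2) using cone2I[of 1 1 u w] by simp
  then have "u + w \<in> level (cuts ls F) (weight (cuts ls F) \<sigma>)" using \<sigma> by (auto simp: level_def)
  then have "u + w \<in> level G (weight (cuts ls F) \<sigma>)" using level_cuts[OF F ls] lev by simp
  then obtain \<tau> where \<tau>: "\<tau> \<in> cones_of_dim (cones G) 2" "u + w \<in> \<tau>" by (auto simp: level_def)
  obtain a b where ab: "gram a b > 0" "\<tau> = cone2 a b" "separators a b \<subseteq> set ls"
    using sep \<tau>(1) unfolding separating_def by metis
  have sg: "signed l \<sigma>" if "l \<in> set ls" for l
    using signed_cuts[OF _ that] \<sigma> by (auto simp: cones_of_dim_def)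
  have "\<sigma> \<subseteq> \<tau>" unfolding ab(2) uw(2)
    by (rule separated_subset[OF ab(1), of u w 1 1]) (use sg ab \<tau>(2) uw(2) in auto)
  then show ?thesis using subset_cuts[of ls \<sigma> \<tau> G] sg \<tau>(1) by (auto simp: cones_of_dim_def)
qed

lemma pure_fan_eqI:
  fixes \<Phi> \<Psi> :: "(real^'n) set set"
  assumes "pure_fan k \<Phi>" "pure_fan k \<Psi>" "cones_of_dim \<Phi> k = cones_of_dim \<Psi> k"
  shows "\<Phi> = \<Psi>"
proof -
  have "\<Phi>' \<subseteq> \<Psi>'" if P: "pure_fan k \<Phi>'" "pure_fan k \<Psi>'" "cones_of_dim \<Phi>' k = cones_of_dim \<Psi>' k"
    for \<Phi>' \<Psi>' :: "(real^'n) set set"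
  proof
    fix \<tau> assume \<tau>: "\<tau> \<in> \<Phi>'"
    obtain \<sigma> where \<sigma>: "\<sigma> \<in> cones_of_dim \<Phi>' k" "\<tau> \<subseteq> \<sigma>" using fan_maximal[OF P(1) \<tau>] by blast
    have "\<tau> face_of \<sigma>" using fan_subset_face[OF P(1) \<tau> _ \<sigma>(2)] \<sigma>(1) by (simp add: cones_of_dim_def)
    moreover have "\<tau> \<noteq> {}" using fan_0_mem[OF P(1) \<tau>] by blast
    moreover have "\<sigma> \<in> \<Psi>'" using \<sigma>(1) P(3) by (auto simp: cones_of_dim_def)
    ultimately show "\<tau> \<in> \<Psi>'" using fan_face[OF P(2)] by blast
  qed
  then show ?thesis using assms by (metis subset_antisym)
qed

lemma weight_level:
  fixes F :: "'n::finite weighted_fan"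
  assumes P: "pure_fan 2 (cones F)" and "\<sigma> \<in> cones_of_dim (cones F) 2" "\<sigma> \<subseteq> level F w"
  shows "weight F \<sigma> = w"
proof -
  obtain u v where uv: "gram u v > 0" "\<sigma> = cone2 u v" using fan_2cone[OF P assms(2)] by blast
  have m: "1 *\<^sub>R u + 1 *\<^sub>R v \<in> cone2 u v" by (rule cone2I) auto
  then obtain \<tau> where \<tau>: "\<tau> \<in> cones_of_dim (cones F) 2" "weight F \<tau> = w" "1 *\<^sub>R u + 1 *\<^sub>R v \<in> \<tau>"
    using assms(3) uv(2) unfolding level_def by blast
  have "\<tau> = \<sigma>" unfolding uv(2)
    by (rule interior_cone_eq[OF P _ uv(1), of _ 1 1]) (use \<tau> assms(2) uv in \<open>auto simp: cones_of_dim_def\<close>)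
  then show ?thesis using \<tau> by simp
qed

text \<open>After the cuts each 2-cone of one fan lies in one of the other and back again; an
  inclusion between 2-cones of a single fan is an equality, so the 2-cones coincide. Their weights
  are read off from the levels.\<close>

lemma cuts_eq:
  fixes F G :: "'n::finite weighted_fan"
  assumes F: "tropical_fan 2 F" and G: "tropical_fan 2 G" and lev: "level F = level G"
    and ls: "set ls \<subseteq> lattice_points"
    and sepF: "separating (set ls) F"
    and sepG: "separating (set ls) G"
  shows "cuts ls F = cuts ls G"
proof -
  let ?H = "cuts ls F" and ?K = "cuts ls G"
  have T: "tropical_fan 2 ?H" "tropical_fan 2 ?K" using tropical_cuts ls F G by blast+
  note P = T[THEN tropical_pure]
  have lev': "level ?H = level ?K" using level_cuts ls F G lev by metis
  have sub: "cones_of_dim (cones (cuts ls F)) 2 \<subseteq> cones_of_dim (cones (cuts ls G)) 2"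
    if F: "tropical_fan 2 F" and G: "tropical_fan 2 G" and lev: "level F = level G"
    and sepF: "separating (set ls) F"
    and sepG: "separating (set ls) G"
    for F G :: "'n::finite weighted_fan"
  proof
    have P: "pure_fan 2 (cones (cuts ls F))" "pure_fan 2 (cones (cuts ls G))"
      using tropical_cuts ls F G tropical_pure by blast+
    fix \<sigma> assume \<sigma>: "\<sigma> \<in> cones_of_dim (cones (cuts ls F)) 2"
    then obtain \<rho>0 where \<rho>0: "\<rho>0 \<in> cones (cuts ls G)" "\<sigma> \<subseteq> \<rho>0"
      using cuts_cone_subset[OF F G lev ls sepG] by blast
    obtain \<rho> where "\<rho> \<in> cones_of_dim (cones (cuts ls G)) 2" "\<rho>0 \<subseteq> \<rho>" using fan_maximal[OF P(2) \<rho>0(1)] by blast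
    then have \<rho>: "\<rho> \<in> cones_of_dim (cones (cuts ls G)) 2" "\<sigma> \<subseteq> \<rho>" using \<rho>0 by auto
    obtain \<pi> where \<pi>: "\<pi> \<in> cones (cuts ls F)" "\<rho> \<subseteq> \<pi>"
      using cuts_cone_subset[OF G F lev[symmetric] ls sepF \<rho>(1)] by blast
    have "\<sigma> = \<pi>"
      using cone2_subset_eq[OF P(1) order_refl, of \<sigma> \<pi>] \<sigma> \<pi> \<rho>(2) by (auto simp: cones_of_dim_def)
    then have "\<sigma> = \<rho>" using \<pi>(2) \<rho>(2) by blast
    then show "\<sigma> \<in> cones_of_dim (cones (cuts ls G)) 2" using \<rho>(1) by simp
  qed
  have C2: "cones_of_dim (cones ?H) 2 = cones_of_dim (cones ?K) 2"
    using sub[OF F G lev sepF sepG] sub[OF G F lev[symmetric] sepG sepF] by blast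
  have c: "cones ?H = cones ?K" by (rule pure_fan_eqI[OF P C2])
  have "weight ?H \<sigma> = weight ?K \<sigma>" for \<sigma>
  proof (cases "\<sigma> \<in> cones_of_dim (cones ?H) 2")
    case True
    then have "\<sigma> \<subseteq> level ?H (weight ?H \<sigma>)" by (auto simp: level_def)
    then show ?thesis using weight_level[OF P(2), of \<sigma> "weight ?H \<sigma>"] True C2 lev' by simp
  next
    case False
    then show ?thesis using tropical_weight_0[OF T(1)] tropical_weight_0[OF T(2)] C2 by simp
  qed
  then show ?thesis using c by (simp add: weighted_fan.expand ext)
qed

text \<open>The weights are compared through \<open>level\<close>, which spares the search for an
  intermediate cone of \<open>H\<close>.\<close>

lemma refines_trans:
  assumes "refines 2 K H" "refines 2 H F" shows "refines 2 K F"
proof -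
  have T: "tropical_fan 2 K" "tropical_fan 2 F" using assms refines_tropical by blast+
  have lev: "level K = level F" using level_refines assms by metis
  have w: "weight K \<sigma>' = weight F \<sigma>"
    if \<sigma>: "\<sigma>' \<in> cones_of_dim (cones K) 2" "\<sigma> \<in> cones_of_dim (cones F) 2" "\<sigma>' \<subseteq> \<sigma>" for \<sigma> \<sigma>'
  proof (rule weight_level[OF tropical_pure[OF T(1)] \<sigma>(1)])
    show "\<sigma>' \<subseteq> level K (weight F \<sigma>)" unfolding lev using \<sigma> by (auto simp: level_def)
  qed
  have "\<exists>\<tau>\<in>cones F. \<sigma> \<subseteq> \<tau>" if "\<sigma> \<in> cones K" for \<sigma>
    using refines_cone[OF assms(1) that] refines_cone[OF assms(2)] by (meson subset_trans)
  then show ?thesis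
    using refines_Union[OF assms(1)] refines_Union[OF assms(2)] by (intro refinesI[OF T _ _ w]) simp_all
qed

lemma refines_refl:
  assumes "tropical_fan 2 F" shows "refines 2 F F"
proof -
  have "weight F \<sigma>' = weight F \<sigma>"
    if \<sigma>: "\<sigma>' \<in> cones_of_dim (cones F) 2" "\<sigma> \<in> cones_of_dim (cones F) 2" "\<sigma>' \<subseteq> \<sigma>" for \<sigma> \<sigma>'
    by (rule weight_level[OF tropical_pure[OF assms] \<sigma>(1)]) (use \<sigma> in \<open>auto simp: level_def\<close>)
  then show ?thesis by (intro refinesI[OF assms assms refl]) blast
qed

lemma refines_cuts:
  "tropical_fan 2 F \<Longrightarrow> set ls \<subseteq> lattice_points \<Longrightarrow> refines 2 (cuts ls F) F"
proof (induction ls arbitrary: F)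
  case (Cons l ls)
  have l: "l \<in> lattice_points" "set ls \<subseteq> lattice_points" using Cons.prems by auto
  have "refines 2 (cuts ls (cut l F)) (cut l F)" "refines 2 (cut l F) F"
    using Cons.IH[OF tropical_cut[OF Cons.prems(1) l(1)] l(2)] refines_cut[OF Cons.prems(1) l(1)] by auto
  from refines_trans[OF this] show ?case by simp
qed (simp add: refines_refl)

text \<open>This trades the existence of a common refinement for the equality of an invariant.
  Conversely, cutting both fans along the separators of both makes them equal, and the result
  refines each.\<close>

lemma fan_equiv_2:
  "fan_equiv 2 = {(F, G). tropical_fan 2 F \<and> tropical_fan 2 G \<and> level F = level G}"
proof (intro equalityI subrelI)
  fix F G :: "'n::finite weighted_fan"
  assume "(F, G) \<in> fan_equiv 2"
  then obtain H where H: "refines 2 H F" "refines 2 H G" by (auto simp: fan_equiv_def)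
  then have "level F = level G" using level_refines by metis
  then show "(F, G) \<in> {(F, G). tropical_fan 2 F \<and> tropical_fan 2 G \<and> level F = level G}"
    using H refines_tropical by blast
next
  fix F G :: "'n::finite weighted_fan"
  assume "(F, G) \<in> {(F, G). tropical_fan 2 F \<and> tropical_fan 2 G \<and> level F = level G}"
  then have T: "tropical_fan 2 F" "tropical_fan 2 G" "level F = level G" by auto
  obtain ls where ls: "set ls \<subseteq> lattice_points" "separating (set ls) F"
    using ex_separating_list[OF tropical_pure[OF T(1)]] by blast
  obtain ks where ks: "set ks \<subseteq> lattice_points" "separating (set ks) G"
    using ex_separating_list[OF tropical_pure[OF T(2)]] by blast
  have "cuts (ls @ ks) F = cuts (ls @ ks) G"
    by (rule cuts_eq) (use T ls ks in \<open>auto intro: separating_mono\<close>)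
  moreover have "refines 2 (cuts (ls @ ks) F) F" "refines 2 (cuts (ls @ ks) G) G"
    using refines_cuts[of _ "ls @ ks"] T ls(1) ks(1) by simp_all
  ultimately show "(F, G) \<in> fan_equiv 2" by (auto simp: fan_equiv_def)
qed

section \<open>Finitely many cycles in finitely many planes\<close>

text \<open>Applied to the balancing condition, \<open>perp a b\<close> kills the span of
  \<open>a\<close> and is positive on the normal of \<open>b\<close>, so some neighbour
  \<open>c\<close> lies on the other side. All cones at \<open>a\<close> lie in one plane, so
  \<open>b\<close> and \<open>c\<close> are the only neighbours; their normals are opposite, which
  forces equal weights.\<close>

lemma opposite_cone:
  fixes F :: "'n::finite weighted_fan"
  assumes F: "tropical_fan 2 F" and a: "prim a" and b: "b \<in> link (cones F) a"
    and plane: "\<And>c. c \<in> link (cones F) a \<Longrightarrow> span {a, c} = span {a, b}"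
  obtains c where "c \<in> link (cones F) a" "perp a b \<bullet> c < 0"
    "weight F (cone2 a c) = weight F (cone2 a b)"
proof -
  note P = tropical_pure[OF F] and B = link_prim[OF b]
  let ?L = "link (cones F) a" and ?q = "perp a b"
  define v where "v c = lattice_normal (cone2 a c) (ray a)" for c
  have al: "a \<in> lattice_points" using a by (rule prim_lattice)
  have ra: "ray a \<in> cones F" using fan_faces_of_cone2[OF P B(4,3)] by simp
  have w: "weight F (cone2 a c) > 0" if "c \<in> ?L" for c
    using tropical_weight_pos[OF F link_prim(5)[OF that]] by simp
  have qv: "\<exists>t>0. ?q \<bullet> v c = t * (?q \<bullet> c)" if c: "c \<in> ?L" for c
  proof -
    obtain s t where "v c = s *\<^sub>R a + t *\<^sub>R c" "t > 0"
      using lattice_normal_cone2(4)[OF al link_prim(2,3)[OF c]] unfolding v_def by blast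
    then show ?thesis by (auto simp: inner_add_right)
  qed
  have "(\<Sum>\<sigma>\<in>facet_star (cones F) (ray a). weight F \<sigma> *\<^sub>R lattice_normal \<sigma> (ray a)) \<in> span (ray a)"
    using F ra dim_ray[OF prim_nz[OF a]] unfolding tropical_fan_def by simp
  then have "(\<Sum>c\<in>?L. weight F (cone2 a c) *\<^sub>R v c) \<in> span {a}"
    unfolding facet_star_ray[OF P a] span_ray sum.reindex[OF link_inj] by (simp add: v_def)
  then obtain r where "(\<Sum>c\<in>?L. weight F (cone2 a c) *\<^sub>R v c) = r *\<^sub>R a" by (auto simp: in_span1)
  then have "?q \<bullet> (\<Sum>c\<in>?L. weight F (cone2 a c) *\<^sub>R v c) = 0" by simp
  then have sum0: "(\<Sum>c\<in>?L. weight F (cone2 a c) * (?q \<bullet> v c)) = 0" by (simp add: inner_sum_right)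
  have qb: "?q \<bullet> v b > 0" using lattice_normal_cone2(5)[OF al B(2,3)] by (simp add: v_def)
  obtain c where c: "c \<in> ?L" "?q \<bullet> c < 0"
  proof (rule ccontr)
    assume "\<not> thesis"
    then have "?q \<bullet> c \<ge> 0" if "c \<in> ?L" for c using that \<open>\<And>c. c \<in> ?L \<Longrightarrow> ?q \<bullet> c < 0 \<Longrightarrow> thesis\<close> by force
    then have "weight F (cone2 a c) * (?q \<bullet> v c) \<ge> 0" if "c \<in> ?L" for c
      using qv[OF that] w[OF that] that by (auto intro!: mult_nonneg_nonneg)
    then have "weight F (cone2 a b) * (?q \<bullet> v b) = 0"
      using sum_nonneg_eq_0_iff[OF finite_link[OF P], of a "\<lambda>c. weight F (cone2 a c) * (?q \<bullet> v c)"] sum0 b by blast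
    then show False using w[OF b] qb by simp
  qed
  note C = link_prim[OF c(1)]
  have "?L = {b, c}"
  proof (intro equalityI subsetI)
    fix d assume d: "d \<in> ?L"
    note D = link_prim[OF d]
    have ds: "d \<in> span {a, b}" "d \<in> span {a, c}"
      using plane[OF d] plane[OF c(1)] span_base[of d "{a, d}"] by auto
    obtain x y where xy: "d = x *\<^sub>R a + y *\<^sub>R c" using ds(2) by (auto simp: in_span2)
    have "y \<noteq> 0" using D(3) unfolding xy gram_shift by auto
    then consider "y < 0" | "y > 0" by linarith
    then show "d \<in> {b, c}"
    proof cases
      case 1
      then have "?q \<bullet> d > 0" unfolding xy using c(2) by (simp add: inner_add_right mult_neg_neg)
      then have "cone2 a d = cone2 a b" by (intro same_side_cone_eq[OF P B(4) D(4) B(3) D(3) ds(1)])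
      then show ?thesis using link_inj[of a "cones F"] b d by (auto dest: inj_onD)
    next
      case 2
      then have "perp a c \<bullet> d > 0" unfolding xy using C(3) by simp
      then have "cone2 a d = cone2 a c" by (intro same_side_cone_eq[OF P C(4) D(4) C(3) D(3) ds(2)])
      then show ?thesis using link_inj[of a "cones F"] c(1) d by (auto dest: inj_onD)
    qed
  qed (use b c in auto)
  moreover have "b \<noteq> c" using c(2) B(3) by auto
  ultimately have 1: "weight F (cone2 a b) * (?q \<bullet> v b) + weight F (cone2 a c) * (?q \<bullet> v c) = 0"
    using sum0 by simp
  have "v b + v c \<in> span {a}" unfolding v_def
    by (rule opposite_lattice_normals[OF al B(2) C(2) B(3) C(3) _ c(2)]) (use plane[OF c(1)] in simp)
  then obtain r where "v b + v c = r *\<^sub>R a" by (auto simp: in_span1)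
  then have "?q \<bullet> (v b + v c) = 0" by simp
  then have "?q \<bullet> v c = - (?q \<bullet> v b)" by (simp add: inner_add_right)
  then have "(weight F (cone2 a b) - weight F (cone2 a c)) * (?q \<bullet> v b) = 0" using 1 by (simp add: algebra_simps)
  then have "weight F (cone2 a c) = weight F (cone2 a b)" using qb by simp
  then show ?thesis using that c by blast
qed

text \<open>At an interior point of a 2-cone this cone is a neighbourhood in \<open>P\<close>. At a
  point of a boundary ray it becomes one together with the opposite cone, which has the same
  weight.\<close>

lemma level_open_in_plane:
  fixes F :: "'n::finite weighted_fan"
  assumes F: "tropical_fan 2 F" and z: "z \<in> level F k" "z \<noteq> 0"
    and plane: "\<And>\<sigma>. \<sigma> \<in> cones_of_dim (cones F) 2 \<Longrightarrow> z \<in> \<sigma> \<Longrightarrow> span \<sigma> = P"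
  obtains N where "open N" "z \<in> N" "N \<inter> P \<subseteq> level F k"
proof -
  note thesisI = that and PF = tropical_pure[OF F]
  obtain \<sigma> where \<sigma>: "\<sigma> \<in> cones_of_dim (cones F) 2" "weight F \<sigma> = k" "z \<in> \<sigma>"
    using z(1) by (auto simp: level_def)
  obtain u w where uw: "prim u" "prim w" "gram u w > 0" "\<sigma> = cone2 u w" using fan_2cone[OF PF \<sigma>(1)] by blast
  obtain s t where st: "z = s *\<^sub>R u + t *\<^sub>R w" "0 \<le> s" "0 \<le> t" using \<sigma>(3) uw(4) by (auto simp: cone2_def)
  have op: "open {y. q \<bullet> y > 0}" for q :: "real^'n" by (rule open_halfspace_gt)
  have boundary: ?thesis
    if a: "prim a" "prim b" "gram a b > 0" "\<sigma> = cone2 a b" and s: "s > 0" "z = s *\<^sub>R a" for a b s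
  proof -
    have c2: "cone2 a b \<in> cones_of_dim (cones F) 2" using \<sigma>(1) a(4) by simp
    have b: "b \<in> link (cones F) a" using a c2 by (simp add: link_def cones_of_dim_def)
    have Pab: "span {a, b} = P" using plane[OF \<sigma>(1,3)] a(4) by (simp add: span_cone2)
    have zc: "z \<in> cone2 a c" for c using s cone2I[of s 0 a c] by simp
    have pl: "span {a, c} = span {a, b}" if "c \<in> link (cones F) a" for c
      using plane[OF link_prim(5)[OF that] zc] Pab by (simp add: span_cone2)
    obtain c where c: "c \<in> link (cones F) a" "perp a b \<bullet> c < 0" "weight F (cone2 a c) = weight F (cone2 a b)"
      using opposite_cone[OF F a(1) b pl] by blast
    note C = link_prim[OF c(1)]
    have sub: "cone2 a b \<subseteq> level F k" "cone2 a c \<subseteq> level F k"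
      using c2 C(5) \<sigma>(2) a(4) c(3) by (auto simp: level_def)
    \<comment> \<open>The two halfspaces ask for a positive coordinate along \<open>a\<close>, once
      with respect to \<open>a\<close> and \<open>b\<close>, once with respect to \<open>a\<close>
      and \<open>c\<close>.\<close>
    show ?thesis
    proof (rule thesisI[of "{y. perp b a \<bullet> y > 0} \<inter> {y. perp c a \<bullet> y > 0}"])
      show "open ({y. perp b a \<bullet> y > 0} \<inter> {y. perp c a \<bullet> y > 0})" using op by blast
      show "z \<in> {y. perp b a \<bullet> y > 0} \<inter> {y. perp c a \<bullet> y > 0}"
        using s a(3) C(3) by (simp add: gram_commute)
      show "{y. perp b a \<bullet> y > 0} \<inter> {y. perp c a \<bullet> y > 0} \<inter> P \<subseteq> level F k"
      proof
        fix y assume y: "y \<in> {y. perp b a \<bullet> y > 0} \<inter> {y. perp c a \<bullet> y > 0} \<inter> P"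
        have ys: "y \<in> span {a, b}" "y \<in> span {a, c}" using y Pab pl[OF c(1)] by auto
        obtain p q where pq: "y = p *\<^sub>R a + q *\<^sub>R c" using ys(2) by (auto simp: in_span2)
        show "y \<in> level F k"
        proof (cases "q \<ge> 0")
          case True
          then have "perp a c \<bullet> y \<ge> 0" unfolding pq using C(3) by simp
          then have "y \<in> cone2 a c" using cone2_functionals[OF C(3) ys(2)] y by auto
          then show ?thesis using sub by blast
        next
          case False
          then have "perp a b \<bullet> y \<ge> 0" unfolding pq using c(2)
            by (simp add: inner_add_right mult_nonpos_nonpos)
          then have "y \<in> cone2 a b" using cone2_functionals[OF a(3) ys(1)] y by auto
          then show ?thesis using sub by blast
        qed
      qed
    qed
  qed
  consider "s > 0" "t > 0" | "s > 0" "t = 0" | "s = 0" "t > 0" using st z(2) by fastforce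
  then show ?thesis
  proof cases
    case 1
    show ?thesis
    proof (rule that[of "{y. perp u w \<bullet> y > 0} \<inter> {y. perp w u \<bullet> y > 0}"])
      show "open ({y. perp u w \<bullet> y > 0} \<inter> {y. perp w u \<bullet> y > 0})" using op by blast
      show "z \<in> {y. perp u w \<bullet> y > 0} \<inter> {y. perp w u \<bullet> y > 0}"
        unfolding st(1) using 1 uw(3) by simp
      show "{y. perp u w \<bullet> y > 0} \<inter> {y. perp w u \<bullet> y > 0} \<inter> P \<subseteq> level F k"
      proof
        fix y assume y: "y \<in> {y. perp u w \<bullet> y > 0} \<inter> {y. perp w u \<bullet> y > 0} \<inter> P"
        then have "y \<in> span {u, w}" using plane[OF \<sigma>(1,3)] uw(4) by (simp add: span_cone2)
        then have "y \<in> \<sigma>" using cone2_functionals[OF uw(3)] y uw(4) by auto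
        then show "y \<in> level F k" using \<sigma> by (auto simp: level_def)
      qed
    qed
  next
    case 2
    then show ?thesis using boundary[OF uw, of s] st(1) by simp
  next
    case 3
    then show ?thesis
      using boundary[OF uw(2,1), of t] st(1) uw(3,4) by (simp add: gram_commute cone2_commute)
  qed
qed

text \<open>Covectors vanishing on all of \<open>P\<close> are exempt, so that one finite set
  \<open>\<Lambda>\<close> can serve for all planes at once.\<close>

definition generic :: "(real^'n) set \<Rightarrow> (real^'n) set \<Rightarrow> real^'n \<Rightarrow> bool" where
  "generic \<Lambda> P x \<longleftrightarrow> x \<in> P \<and> (\<forall>\<mu>\<in>\<Lambda>. (\<exists>y\<in>P. \<mu> \<bullet> y \<noteq> 0) \<longrightarrow> \<mu> \<bullet> x \<noteq> 0)"

definition sign_pattern :: "(real^'n) set \<Rightarrow> real^'n \<Rightarrow> (real^'n) set \<times> (real^'n) set" where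
  "sign_pattern \<Lambda> x = ({\<mu>\<in>\<Lambda>. \<mu> \<bullet> x > 0}, {\<mu>\<in>\<Lambda>. \<mu> \<bullet> x < 0})"

text \<open>The first clause keeps generic points away from 0, the second keeps a generic point of
  one plane off all the other planes.\<close>

definition separates_planes :: "(real^'n) set \<Rightarrow> (real^'n) set set \<Rightarrow> bool" where
  "separates_planes \<Lambda> \<P> \<longleftrightarrow>
     (\<forall>P\<in>\<P>. \<exists>\<mu>\<in>\<Lambda>. \<exists>y\<in>P. \<mu> \<bullet> y \<noteq> 0) \<and>
     (\<forall>P\<in>\<P>. \<forall>P'\<in>\<P>. P \<noteq> P' \<longrightarrow> (\<exists>\<mu>\<in>\<Lambda>. (\<forall>y\<in>P'. \<mu> \<bullet> y = 0) \<and> (\<exists>y\<in>P. \<mu> \<bullet> y \<noteq> 0)))"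

text \<open>Along the segment from \<open>x\<close> to \<open>y\<close> no covector that matters
  changes sign, so every point is generic and lies in 2-cones with span \<open>P\<close> only. On
  the segment the level is then both closed and relatively open, and the segment is
  connected.\<close>

lemma level_constant_on_cells:
  fixes F :: "'n::finite weighted_fan"
  assumes F: "tropical_fan 2 F" and planes: "\<And>\<sigma>. \<sigma> \<in> cones_of_dim (cones F) 2 \<Longrightarrow> span \<sigma> \<in> \<P>"
    and \<Lambda>: "separates_planes \<Lambda> \<P>" and P: "P \<in> \<P>" "subspace P"
    and xy: "generic \<Lambda> P x" "generic \<Lambda> P y" "sign_pattern \<Lambda> x = sign_pattern \<Lambda> y"
    and x: "x \<in> level F k"
  shows "y \<in> level F k"
proof -
  let ?S = "closed_segment x y"
  have gen: "generic \<Lambda> P z" if z: "z \<in> ?S" for z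
  proof -
    obtain u where u: "z = (1 - u) *\<^sub>R x + u *\<^sub>R y" "0 \<le> u" "u \<le> 1"
      using z by (auto simp: in_segment)
    have "z \<in> P" unfolding u(1) using xy P(2) by (simp add: generic_def subspace_add subspace_scale)
    moreover have "\<mu> \<bullet> z \<noteq> 0" if \<mu>: "\<mu> \<in> \<Lambda>" "\<exists>y\<in>P. \<mu> \<bullet> y \<noteq> 0" for \<mu>
    proof -
      have nz: "\<mu> \<bullet> x \<noteq> 0" "\<mu> \<bullet> y \<noteq> 0" using xy \<mu> by (auto simp: generic_def)
      have "(\<mu> \<bullet> x > 0) = (\<mu> \<bullet> y > 0)" using xy(3) \<mu>(1) by (auto simp: sign_pattern_def)
      then consider "\<mu> \<bullet> x > 0" "\<mu> \<bullet> y > 0" | "- \<mu> \<bullet> x > 0" "- \<mu> \<bullet> y > 0" using nz by force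
      then show ?thesis
      proof cases
        case 1
        then have "(1 - u) * (\<mu> \<bullet> x) + u * (\<mu> \<bullet> y) > 0"
          using u by (cases "u = 0") (auto intro: add_nonneg_pos)
        then show ?thesis by (simp add: u(1) inner_add_right)
      next
        case 2
        then have "(1 - u) * (- \<mu> \<bullet> x) + u * (- \<mu> \<bullet> y) > 0"
          using u by (cases "u = 0") (auto intro!: add_nonneg_pos simp del: inner_minus_left)
        then show ?thesis by (simp add: u(1) inner_add_right)
      qed
    qed
    ultimately show ?thesis by (simp add: generic_def)
  qed
  \<comment> \<open>The relative openness in \<open>P\<close> is expressed by an open set whose
    points in \<open>P\<close> all belong to the level.\<close>
  define U where "U = \<Union>{N. open N \<and> N \<inter> P \<subseteq> level F k}"
  have "open U" unfolding U_def by (rule open_Union) auto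
  moreover have "open (- level F k)" using closed_level[OF tropical_pure[OF F]] by (simp add: open_Compl)
  moreover have "U \<inter> - level F k \<inter> ?S = {}"
    using gen unfolding U_def generic_def by blast
  moreover have "?S \<subseteq> U \<union> - level F k"
  proof
    fix z assume z: "z \<in> ?S"
    show "z \<in> U \<union> - level F k"
    proof (cases "z \<in> level F k")
      case True
      have "\<exists>\<mu>\<in>\<Lambda>. \<exists>y\<in>P. \<mu> \<bullet> y \<noteq> 0" using \<Lambda> P(1) unfolding separates_planes_def by simp
      then have "z \<noteq> 0" using gen[OF z] unfolding generic_def by auto
      moreover have "span \<sigma> = P" if \<sigma>: "\<sigma> \<in> cones_of_dim (cones F) 2" "z \<in> \<sigma>" for \<sigma>
      proof (rule ccontr)
        assume "span \<sigma> \<noteq> P"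
        then obtain \<mu> where "\<mu> \<in> \<Lambda>" "\<forall>y\<in>span \<sigma>. \<mu> \<bullet> y = 0" "\<exists>y\<in>P. \<mu> \<bullet> y \<noteq> 0"
          using \<Lambda> P(1) planes[OF \<sigma>(1)] unfolding separates_planes_def by metis
        moreover have "z \<in> span \<sigma>" using \<sigma>(2) by (rule span_base)
        ultimately show False using gen[OF z] unfolding generic_def by blast
      qed
      ultimately obtain N where "open N" "z \<in> N" "N \<inter> P \<subseteq> level F k"
        using level_open_in_plane[OF F True] by blast
      then show ?thesis unfolding U_def by blast
    qed simp
  qed
  ultimately have "U \<inter> ?S = {} \<or> - level F k \<inter> ?S = {}"
    using connectedD[OF connected_segment(1)] by blast
  moreover have "x \<in> U"
    using \<open>?S \<subseteq> U \<union> - level F k\<close> x ends_in_segment(1)[of x y] by blast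
  ultimately show ?thesis using ends_in_segment[of x y] by blast
qed

lemma avoid_finitely_many:
  fixes A :: "(real \<times> real) set" and e :: real
  assumes "finite A" "(0, 0) \<notin> A" "e > 0"
  obtains r where "0 < r" "r < e" "\<And>c d. (c, d) \<in> A \<Longrightarrow> c + r * d \<noteq> 0"
proof -
  have "finite (\<Union>(c, d)\<in>A. {r. c + r * d = 0})"
  proof (rule finite_UN_I[OF assms(1)], clarify)
    fix c d assume "(c, d) \<in> A"
    then have "c \<noteq> 0 \<or> d \<noteq> 0" using assms(2) by auto
    then have "{r. c + r * d = 0} \<subseteq> {- c / d}" by (cases "d = 0") (auto simp: field_simps)
    then show "finite {r. c + r * d = 0}" using finite_subset by blast
  qed
  moreover have "infinite {0<..<e}" using assms(3) by (simp add: infinite_Ioo)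
  ultimately obtain r where "r \<in> {0<..<e}" "r \<notin> (\<Union>(c, d)\<in>A. {r. c + r * d = 0})"
    by (meson finite_subset subsetI)
  then show ?thesis using that[of r] by auto
qed

text \<open>Some \<open>g\<close> in the cone is a zero of no relevant covector. Along
  \<open>x + \<eta> *\<^sub>R g\<close> each such covector excludes at most one
  \<open>\<eta>\<close>, so generic points of the cone come arbitrarily close to
  \<open>x\<close>.\<close>

lemma generic_dense_cone2:
  fixes C :: "(real^'n) set"
  assumes "closed C" "finite \<Lambda>" "gram a b > 0"
    and sub: "\<And>y. y \<in> cone2 a b \<Longrightarrow> generic \<Lambda> (span {a, b}) y \<Longrightarrow> y \<in> C"
  shows "cone2 a b \<subseteq> C"
proof
  let ?P = "span {a, b}"
  define \<Lambda>' where "\<Lambda>' = {\<mu>\<in>\<Lambda>. \<exists>y\<in>?P. \<mu> \<bullet> y \<noteq> 0}"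
  have fin: "finite \<Lambda>'" using assms(2) by (simp add: \<Lambda>'_def)
  have inP: "y \<in> ?P" if "y \<in> cone2 a b" for y using that by (auto simp: cone2_def in_span2)
  have nz: "\<not> (\<mu> \<bullet> a = 0 \<and> \<mu> \<bullet> b = 0)" if "\<mu> \<in> \<Lambda>'" for \<mu>
    using that by (auto simp: \<Lambda>'_def in_span2 inner_add_right)
  obtain r where r: "0 < r" "r < 1" "\<And>c d. (c, d) \<in> (\<lambda>l. (l \<bullet> a, l \<bullet> b)) ` \<Lambda>' \<Longrightarrow> c + r * d \<noteq> 0"
    by (rule avoid_finitely_many[of "(\<lambda>l. (l \<bullet> a, l \<bullet> b)) ` \<Lambda>'" 1]) (use fin nz in auto)
  define g where "g = 1 *\<^sub>R a + r *\<^sub>R b"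
  have gc: "g \<in> cone2 a b" unfolding g_def using r by (intro cone2I) auto
  have gg: "\<mu> \<bullet> g \<noteq> 0" if "\<mu> \<in> \<Lambda>'" for \<mu> using r(3) that by (force simp: g_def inner_add_right)
  fix x assume x: "x \<in> cone2 a b"
  show "x \<in> C"
  proof (rule ccontr)
    assume "x \<notin> C"
    then obtain e where e: "e > 0" "ball x e \<subseteq> - C"
      using assms(1) open_contains_ball[of "- C"] by (auto simp: open_Compl)
    have gn: "norm g > 0" using gc gram_pos_nz[OF assms(3)] gg
    proof -
      have "g \<noteq> 0"
      proof
        assume "g = 0"
        then have "1 *\<^sub>R a + r *\<^sub>R b = 0 *\<^sub>R a + 0 *\<^sub>R b" by (simp add: g_def)
        from comb_unique[OF assms(3) this] show False by simp
      qed
      then show ?thesis by simp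
    qed
    obtain \<eta> where \<eta>: "0 < \<eta>" "\<eta> < e / norm g"
      "\<And>c d. (c, d) \<in> (\<lambda>l. (l \<bullet> x, l \<bullet> g)) ` \<Lambda>' \<Longrightarrow> c + \<eta> * d \<noteq> 0"
      by (rule avoid_finitely_many[of "(\<lambda>l. (l \<bullet> x, l \<bullet> g)) ` \<Lambda>'" "e / norm g"])
        (use fin gg e gn in auto)
    let ?y = "x + \<eta> *\<^sub>R g"
    have yc: "?y \<in> cone2 a b"
      using x gc \<eta>(1)
      by (intro convex_cone_add[OF convex_cone_cone2] convex_cone_scaleR[OF convex_cone_cone2]) simp_all
    have "\<mu> \<bullet> ?y \<noteq> 0" if "\<mu> \<in> \<Lambda>'" for \<mu> using \<eta>(3) that by (force simp: inner_add_right)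
    then have "generic \<Lambda> ?P ?y" using inP[OF yc] by (auto simp: generic_def \<Lambda>'_def)
    then have "?y \<in> C" using sub yc by blast
    moreover have "dist x ?y < e" using \<eta> gn by (simp add: dist_norm field_simps)
    ultimately show False using e(2) by auto
  qed
qed

text \<open>Two distinct planes are told apart by the component, orthogonal to the second, of a
  vector of the first that is not in the second.\<close>

lemma ex_separates_planes:
  fixes \<P> :: "(real^'n) set set"
  assumes "finite \<P>" and sub: "\<And>P. P \<in> \<P> \<Longrightarrow> subspace P \<and> dim P = 2"
  obtains \<Lambda> where "finite \<Lambda>" "separates_planes \<Lambda> \<P>"
proof -
  have 1: "\<forall>P\<in>\<P>. \<exists>\<mu>. \<exists>y\<in>P. \<mu> \<bullet> y \<noteq> 0"
  proof
    fix P assume "P \<in> \<P>"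
    then have "\<not> P \<subseteq> {0}" using sub[of P] dim_subset[of P "{0}"] by auto
    then obtain y where "y \<in> P" "y \<bullet> y \<noteq> 0" by auto
    then show "\<exists>\<mu>. \<exists>y\<in>P. \<mu> \<bullet> y \<noteq> 0" by blast
  qed
  have 2: "\<forall>p\<in>\<P> \<times> \<P>. \<exists>\<mu>. fst p \<noteq> snd p \<longrightarrow>
    (\<forall>y\<in>snd p. \<mu> \<bullet> y = 0) \<and> (\<exists>y\<in>fst p. \<mu> \<bullet> y \<noteq> 0)"
  proof clarify
    fix P P' assume P: "P \<in> \<P>" "P' \<in> \<P>"
    show "\<exists>\<mu>. fst (P, P') \<noteq> snd (P, P') \<longrightarrow>
       (\<forall>y\<in>snd (P, P'). \<mu> \<bullet> y = 0) \<and> (\<exists>y\<in>fst (P, P'). \<mu> \<bullet> y \<noteq> 0)"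
    proof (cases "P = P'")
      case False
      then have "\<not> P \<subseteq> P'" using subspace_dim_equal[of P P'] sub P by auto
      then obtain x where x: "x \<in> P" "x \<notin> P'" by blast
      have sp: "span P' = P'" using sub P(2) by (simp add: span_eq_iff)
      obtain y z where yz: "y \<in> P'" "\<And>w. w \<in> P' \<Longrightarrow> orthogonal z w" "x = y + z"
        using orthogonal_subspace_decomp_exists[of P' x] unfolding sp by blast
      have "z \<noteq> 0" using x yz by auto
      then have "z \<bullet> x \<noteq> 0" using yz(2)[OF yz(1)] unfolding yz(3) by (simp add: orthogonal_def inner_add_right)
      then have "(\<forall>y\<in>P'. z \<bullet> y = 0) \<and> (\<exists>y\<in>P. z \<bullet> y \<noteq> 0)" using x yz(2) by (auto simp: orthogonal_def)
      then show ?thesis by auto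
    qed simp
  qed
  obtain f where f: "\<forall>P\<in>\<P>. \<exists>y\<in>P. f P \<bullet> y \<noteq> 0" using bchoice[OF 1] by blast
  obtain h where h: "\<forall>p\<in>\<P> \<times> \<P>. fst p \<noteq> snd p \<longrightarrow>
    (\<forall>y\<in>snd p. h p \<bullet> y = 0) \<and> (\<exists>y\<in>fst p. h p \<bullet> y \<noteq> 0)" using bchoice[OF 2] by blast
  show ?thesis
  proof (rule that[of "f ` \<P> \<union> h ` (\<P> \<times> \<P>)"])
    show "finite (f ` \<P> \<union> h ` (\<P> \<times> \<P>))" using assms(1) by simp
    show "separates_planes (f ` \<P> \<union> h ` (\<P> \<times> \<P>)) \<P>"
      unfolding separates_planes_def
    proof (intro conjI ballI impI)
      fix P assume "P \<in> \<P>"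
      then show "\<exists>\<mu>\<in>f ` \<P> \<union> h ` (\<P> \<times> \<P>). \<exists>y\<in>P. \<mu> \<bullet> y \<noteq> 0" using f by blast
    next
      fix P P' assume "P \<in> \<P>" "P' \<in> \<P>" "P \<noteq> P'"
      then have m: "(P, P') \<in> \<P> \<times> \<P>" "fst (P, P') \<noteq> snd (P, P')" by auto
      then have "(\<forall>y\<in>P'. h (P, P') \<bullet> y = 0) \<and> (\<exists>y\<in>P. h (P, P') \<bullet> y \<noteq> 0)"
        using h[rule_format, OF m] by simp
      then show "\<exists>\<mu>\<in>f ` \<P> \<union> h ` (\<P> \<times> \<P>). (\<forall>y\<in>P'. \<mu> \<bullet> y = 0) \<and> (\<exists>y\<in>P. \<mu> \<bullet> y \<noteq> 0)"
        using m(1) by blast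
    qed
  qed
qed

text \<open>The set \<open>inv F\<close> records which triples of plane, sign pattern and weight
  occur at generic points, and it ranges over a finite set. It determines the levels, which are
  constant on cells and closed, while generic points are dense in each 2-cone.\<close>

lemma finite_levels:
  fixes \<P> :: "(real^'n::finite) set set"
  assumes "finite \<P>" and sub: "\<And>P. P \<in> \<P> \<Longrightarrow> subspace P \<and> dim P = 2" and "finite W"
  shows "finite (level ` {F. tropical_fan 2 F \<and>
    (\<forall>\<sigma>\<in>cones_of_dim (cones F) 2. span \<sigma> \<in> \<P> \<and> weight F \<sigma> \<in> W)})" (is "finite (level ` ?A)")
proof -
  obtain \<Lambda> where \<Lambda>: "finite \<Lambda>" "separates_planes \<Lambda> \<P>" using ex_separates_planes[OF assms(1,2)] by blast
  define inv where "inv F = {(P, sign_pattern \<Lambda> x, k) | P x k.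
     P \<in> \<P> \<and> generic \<Lambda> P x \<and> x \<in> level F k \<and> k \<in> W}" for F :: "'n weighted_fan"
  have "inv F \<subseteq> \<P> \<times> (Pow \<Lambda> \<times> Pow \<Lambda>) \<times> W" for F
    by (auto simp: inv_def sign_pattern_def)
  then have "inv ` ?A \<subseteq> Pow (\<P> \<times> (Pow \<Lambda> \<times> Pow \<Lambda>) \<times> W)" by blast
  moreover have "finite (Pow (\<P> \<times> (Pow \<Lambda> \<times> Pow \<Lambda>) \<times> W))" using \<Lambda>(1) assms(1,3) by simp
  ultimately have fin: "finite (inv ` ?A)" by (rule finite_subset)
  have le: "level F k \<subseteq> level G k" if F: "F \<in> ?A" and G: "G \<in> ?A" and eq: "inv F = inv G" for F G k
  proof
    fix x assume "x \<in> level F k"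
    then obtain \<sigma> where \<sigma>: "\<sigma> \<in> cones_of_dim (cones F) 2" "weight F \<sigma> = k" "x \<in> \<sigma>"
      by (auto simp: level_def)
    have T: "tropical_fan 2 F" "tropical_fan 2 G" using F G by auto
    obtain a b where ab: "gram a b > 0" "\<sigma> = cone2 a b" using fan_2cone[OF tropical_pure[OF T(1)] \<sigma>(1)] by blast
    have P: "span {a, b} \<in> \<P>" "k \<in> W" using F \<sigma>(1,2) ab(2) by (auto simp: span_cone2)
    have "cone2 a b \<subseteq> level G k"
    proof (rule generic_dense_cone2[OF closed_level[OF tropical_pure[OF T(2)]] \<Lambda>(1) ab(1)])
      fix y assume y: "y \<in> cone2 a b" "generic \<Lambda> (span {a, b}) y"
      have "y \<in> level F k" using y(1) \<sigma> ab(2) by (auto simp: level_def)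
      then have "(span {a, b}, sign_pattern \<Lambda> y, k) \<in> inv F" using y P unfolding inv_def by blast
      then have "(span {a, b}, sign_pattern \<Lambda> y, k) \<in> inv G" using eq by simp
      then obtain z where z: "generic \<Lambda> (span {a, b}) z" "sign_pattern \<Lambda> z = sign_pattern \<Lambda> y" "z \<in> level G k"
        unfolding inv_def by auto
      show "y \<in> level G k"
        by (rule level_constant_on_cells[OF T(2) _ \<Lambda>(2) P(1) subspace_span z(1) y(2) z(2,3)]) (use G in auto)
    qed
    then show "x \<in> level G k" using \<sigma>(3) ab(2) by blast
  qed
  have "level F = level G" if "F \<in> ?A" "G \<in> ?A" "inv F = inv G" for F G
    using le[OF that] le[OF that(2,1) that(3)[symmetric]] by (intro ext) blast
  \<comment> \<open>Fans with equal \<open>inv\<close> have equal levels, so \<open>level\<close>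
    factors through the finite image of \<open>inv\<close>.\<close>
  then have "\<exists>f. \<forall>F\<in>?A. level F = f (inv F)"
    by (intro exI[of _ "\<lambda>i. level (SOME F. F \<in> ?A \<and> inv F = i)"]) (metis (mono_tags, lifting) someI_ex)
  then obtain f where "\<forall>F\<in>?A. level F = f (inv F)" by blast
  then have "level ` ?A \<subseteq> f ` inv ` ?A" by blast
  then show ?thesis using fin finite_surj by blast
qed

section \<open>The intersection pairing of a fan\<close>

definition gens :: "(real^'n) set set \<Rightarrow> (real^'n) set" where
  "gens \<Phi> = {u. prim u \<and> ray u \<in> \<Phi>}"

text \<open>For primitive \<open>a\<close>, a nonzero value is the weight of the cone divided by its
  lattice index. These are the off-diagonal entries of the matrix of the form.\<close>

definition edge :: "'n::finite weighted_fan \<Rightarrow> real^'n \<Rightarrow> real^'n \<Rightarrow> real" where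
  "edge F a b = (if b \<in> link (cones F) a then weight F (cone2 a b) * tcoef a b else 0)"

text \<open>By balancing the weighted sum of the neighbours is a multiple of \<open>a\<close>, and
  the inner product with \<open>a\<close> extracts the factor. For a smooth complete planar fan with
  weights 1 it is minus the self-intersection of the toric divisor of \<open>a\<close>.\<close>

definition self_coef :: "'n::finite weighted_fan \<Rightarrow> real^'n \<Rightarrow> real" where
  "self_coef F a = (\<Sum>b\<in>gens (cones F). edge F a b * (a \<bullet> b)) / (a \<bullet> a)"

text \<open>The weight of \<open>ray a\<close> in the product with \<open>T\<close>, rewritten so
  that only values of \<open>T\<close> at generators enter; this extends it to functions that are
  not linear on the cones.\<close>

definition ray_weight :: "'n::finite weighted_fan \<Rightarrow> (real^'n \<Rightarrow> real) \<Rightarrow> real^'n \<Rightarrow> real" where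
  "ray_weight F T a = (\<Sum>b\<in>gens (cones F). edge F a b * T b) - self_coef F a * T a"

definition pairing :: "'n::finite weighted_fan \<Rightarrow> (real^'n \<Rightarrow> real) \<Rightarrow> (real^'n \<Rightarrow> real) \<Rightarrow> real" where
  "pairing F S T = (\<Sum>a\<in>gens (cones F). S a * ray_weight F T a)"

lemma gensD: "a \<in> gens \<Phi> \<Longrightarrow> prim a" "a \<in> gens \<Phi> \<Longrightarrow> ray a \<in> \<Phi>"
  by (auto simp: gens_def)

lemma inj_on_ray: "inj_on ray (gens \<Phi>)"
  by (auto intro!: inj_onI prim_unique dest: gensD)

lemma cones_of_dim_1:
  assumes "pure_fan k \<Phi>" "k \<le> 2" shows "cones_of_dim \<Phi> 1 = ray ` gens \<Phi>"
proof
  show "cones_of_dim \<Phi> 1 \<subseteq> ray ` gens \<Phi>"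
  proof
    fix \<rho> assume \<rho>: "\<rho> \<in> cones_of_dim \<Phi> 1"
    obtain u where "prim u" "\<rho> = ray u" using fan_1cone[OF assms \<rho>] by blast
    then show "\<rho> \<in> ray ` gens \<Phi>" using cones_of_dimD[OF \<rho>] by (auto simp: gens_def)
  qed
  show "ray ` gens \<Phi> \<subseteq> cones_of_dim \<Phi> 1"
    by (auto simp: cones_of_dim_def gens_def dim_ray prim_nz)
qed

lemma finite_gens:
  assumes "pure_fan k \<Phi>" shows "finite (gens \<Phi>)"
proof -
  have "ray ` gens \<Phi> \<subseteq> \<Phi>" by (auto simp: gens_def)
  then show ?thesis by (rule finite_imageD[OF finite_subset inj_on_ray]) (rule fan_finite[OF assms])
qed

lemma link_subset_gens:
  assumes "pure_fan k \<Phi>" shows "link \<Phi> a \<subseteq> gens \<Phi>"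
proof
  fix b assume "b \<in> link \<Phi> a"
  note b = link_prim[OF this]
  show "b \<in> gens \<Phi>" using b(1) fan_faces_of_cone2(2)[OF assms b(4,3)] by (simp add: gens_def)
qed

lemma sum_edge:
  fixes f :: "real^'n \<Rightarrow> real"
  assumes "pure_fan 2 (cones F)"
  shows "(\<Sum>b\<in>gens (cones F). edge F a b * f b) =
    (\<Sum>b\<in>link (cones F) a. weight F (cone2 a b) * tcoef a b * f b)"
  by (rule sum.mono_neutral_cong_right)
    (use finite_gens[OF assms] link_subset_gens[OF assms] in \<open>auto simp: edge_def\<close>)

lemma edge_commute:
  assumes "prim a" "prim b" shows "edge F a b = edge F b a"
proof -
  have "b \<in> link (cones F) a \<longleftrightarrow> a \<in> link (cones F) b"
    using assms by (simp add: link_def gram_commute cone2_commute)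
  then show ?thesis using tcoef_commute[OF assms] link_prim(3)[of b "cones F" a]
    by (simp add: edge_def cone2_commute)
qed

lemma edge_nonneg:
  assumes "tropical_fan 2 F" "prim a" shows "edge F a b \<ge> 0"
proof (cases "b \<in> link (cones F) a")
  case True
  note b = link_prim[OF True]
  have "tcoef a b > 0" using lattice_normal_tcoef[OF prim_lattice[OF assms(2)] b(2,3)] by blast
  moreover have "weight F (cone2 a b) > 0" using tropical_weight_pos[OF assms(1) b(5)] by simp
  ultimately show ?thesis by (simp add: edge_def)
qed (simp add: edge_def)

text \<open>Each normal is split along \<open>a\<close> and its neighbour. The coefficients
  \<open>s b\<close> and \<open>r\<close> depend on the chosen normals; together they form
  \<open>self_coef\<close>, which does not.\<close>

lemma star_coordinates:
  fixes F :: "'n::finite weighted_fan"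
  assumes F: "tropical_fan 2 F" and a: "a \<in> gens (cones F)"
  obtains s r where
    "\<And>b. b \<in> link (cones F) a \<Longrightarrow> lattice_normal (cone2 a b) (ray a) = s b *\<^sub>R a + tcoef a b *\<^sub>R b"
    "(\<Sum>\<sigma>\<in>facet_star (cones F) (ray a). weight F \<sigma> *\<^sub>R lattice_normal \<sigma> (ray a)) = r *\<^sub>R a"
    "(\<Sum>b\<in>gens (cones F). edge F a b *\<^sub>R b) = self_coef F a *\<^sub>R a"
    "self_coef F a = r - (\<Sum>b\<in>link (cones F) a. weight F (cone2 a b) * s b)"
proof -
  note P = tropical_pure[OF F]
  let ?L = "link (cones F) a"
  have pa: "prim a" "ray a \<in> cones F" "a \<noteq> 0" using a gensD prim_nz by blast+
  have "\<forall>b\<in>?L. \<exists>s. lattice_normal (cone2 a b) (ray a) = s *\<^sub>R a + tcoef a b *\<^sub>R b"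
    using lattice_normal_tcoef[OF prim_lattice[OF pa(1)] link_prim(2,3)] by metis
  then obtain s where s: "\<And>b. b \<in> ?L \<Longrightarrow> lattice_normal (cone2 a b) (ray a) = s b *\<^sub>R a + tcoef a b *\<^sub>R b"
    by metis
  have "(\<Sum>\<sigma>\<in>facet_star (cones F) (ray a). weight F \<sigma> *\<^sub>R lattice_normal \<sigma> (ray a)) \<in> span (ray a)"
    using F pa dim_ray[OF pa(3)] unfolding tropical_fan_def by simp
  then obtain r where r: "(\<Sum>\<sigma>\<in>facet_star (cones F) (ray a). weight F \<sigma> *\<^sub>R lattice_normal \<sigma> (ray a)) = r *\<^sub>R a"
    by (auto simp: span_ray in_span1)
  define c where "c = r - (\<Sum>b\<in>?L. weight F (cone2 a b) * s b)"
  have "r *\<^sub>R a = (\<Sum>b\<in>?L. weight F (cone2 a b) *\<^sub>R (s b *\<^sub>R a + tcoef a b *\<^sub>R b))"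
    unfolding r[symmetric] facet_star_ray[OF P pa(1)] sum.reindex[OF link_inj] by (simp add: s)
  also have "\<dots> = (\<Sum>b\<in>?L. weight F (cone2 a b) * s b) *\<^sub>R a + (\<Sum>b\<in>?L. edge F a b *\<^sub>R b)"
    by (simp add: scaleR_add_right sum.distrib scaleR_sum_left edge_def)
  finally have "(\<Sum>b\<in>?L. edge F a b *\<^sub>R b) = c *\<^sub>R a" by (simp add: c_def scaleR_diff_left)
  moreover have "(\<Sum>b\<in>gens (cones F). edge F a b *\<^sub>R b) = (\<Sum>b\<in>?L. edge F a b *\<^sub>R b)"
    by (rule sum.mono_neutral_right)
      (use finite_gens[OF P] link_subset_gens[OF P] in \<open>auto simp: edge_def\<close>)
  ultimately have e: "(\<Sum>b\<in>gens (cones F). edge F a b *\<^sub>R b) = c *\<^sub>R a" by simp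
  have "(\<Sum>b\<in>gens (cones F). edge F a b * (a \<bullet> b)) = a \<bullet> (\<Sum>b\<in>gens (cones F). edge F a b *\<^sub>R b)"
    by (simp add: inner_sum_right)
  then have "self_coef F a = c" unfolding self_coef_def e using pa(3) by simp
  then show ?thesis using that[OF s r] e c_def by simp
qed

lemma edge_balance:
  assumes "tropical_fan 2 F" "a \<in> gens (cones F)"
  shows "(\<Sum>b\<in>gens (cones F). edge F a b *\<^sub>R b) = self_coef F a *\<^sub>R a"
  using star_coordinates[OF assms] by metis

text \<open>The linear extensions are evaluated in the coordinates of
  \<open>star_coordinates\<close>; the multiples of \<open>T a\<close> from the star and from the
  correction term combine to minus \<open>self_coef\<close>.\<close>

lemma product_weight_eq:
  fixes F :: "'n::finite weighted_fan"
  assumes F: "tropical_fan 2 F" and a: "a \<in> gens (cones F)"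
    and T: "\<And>\<sigma>. \<sigma> \<in> cones F \<Longrightarrow> linear_on_cone \<sigma> T"
  shows "product_weight T F (ray a) = ray_weight F T a"
proof -
  note P = tropical_pure[OF F]
  let ?L = "link (cones F) a"
  have pa: "prim a" "ray a \<in> cones F" using a gensD by blast+
  obtain s r where s: "\<And>b. b \<in> ?L \<Longrightarrow> lattice_normal (cone2 a b) (ray a) = s b *\<^sub>R a + tcoef a b *\<^sub>R b"
    and r: "(\<Sum>\<sigma>\<in>facet_star (cones F) (ray a). weight F \<sigma> *\<^sub>R lattice_normal \<sigma> (ray a)) = r *\<^sub>R a"
    and c: "self_coef F a = r - (\<Sum>b\<in>?L. weight F (cone2 a b) * s b)"
    by (rule star_coordinates[OF F a]) (rule that)
  have ext: "linear_extension (cone2 a b) T (lattice_normal (cone2 a b) (ray a)) = s b * T a + tcoef a b * T b"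
    if b: "b \<in> ?L" for b
  proof -
    obtain L where L: "linear L" "\<And>x. x \<in> cone2 a b \<Longrightarrow> L x = T x"
      using T[OF link_prim(4)[OF b]] by (auto simp: linear_on_cone_def)
    have "linear_extension (cone2 a b) T (lattice_normal (cone2 a b) (ray a)) = L (s b *\<^sub>R a + tcoef a b *\<^sub>R b)"
      unfolding s[OF b] by (rule linear_extension_eq[OF L]) (auto simp: span_cone2 in_span2)
    then show ?thesis using L(2)[of a] L(2)[of b] by (simp add: linear_add[OF L(1)] linear_scale[OF L(1)])
  qed
  have er: "linear_extension (ray a) T (r *\<^sub>R a) = r * T a"
  proof -
    obtain L where L: "linear L" "\<And>x. x \<in> ray a \<Longrightarrow> L x = T x"
      using T[OF pa(2)] by (auto simp: linear_on_cone_def)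
    have "linear_extension (ray a) T (r *\<^sub>R a) = L (r *\<^sub>R a)"
      by (rule linear_extension_eq[OF L]) (auto simp: span_ray in_span1)
    then show ?thesis using L(2)[of a] by (simp add: linear_scale[OF L(1)])
  qed
  have "(\<Sum>\<sigma>\<in>facet_star (cones F) (ray a). weight F \<sigma> * linear_extension \<sigma> T (lattice_normal \<sigma> (ray a))) =
    (\<Sum>b\<in>?L. weight F (cone2 a b) * (s b * T a + tcoef a b * T b))"
    unfolding facet_star_ray[OF P pa(1)] sum.reindex[OF link_inj] by (simp add: ext)
  also have "\<dots> = (\<Sum>b\<in>?L. weight F (cone2 a b) * s b) * T a + (\<Sum>b\<in>gens (cones F). edge F a b * T b)"
    unfolding sum_edge[OF P] by (simp add: distrib_left sum.distrib sum_distrib_right mult.assoc)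
  finally show ?thesis unfolding product_weight_def r er ray_weight_def c by (simp add: algebra_simps)
qed

lemma pairing_commute: "pairing F S T = pairing F T S"
proof -
  let ?G = "gens (cones F)"
  have "(\<Sum>a\<in>?G. \<Sum>b\<in>?G. S a * (edge F a b * T b)) = (\<Sum>b\<in>?G. \<Sum>a\<in>?G. S a * (edge F a b * T b))"
    by (rule sum.swap)
  also have "\<dots> = (\<Sum>b\<in>?G. \<Sum>a\<in>?G. T b * (edge F b a * S a))"
  proof (intro sum.cong refl)
    fix a b assume "b \<in> ?G" "a \<in> ?G"
    then have "edge F a b = edge F b a" using edge_commute gensD(1) by blast
    then show "S a * (edge F a b * T b) = T b * (edge F b a * S a)" by simp
  qed
  finally show ?thesis
    by (simp add: pairing_def ray_weight_def right_diff_distrib sum_subtractf sum_distrib_left mult_ac)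
qed

lemma ray_weight_add: "ray_weight F (\<lambda>x. S x + T x) a = ray_weight F S a + ray_weight F T a"
  by (simp add: ray_weight_def distrib_left sum.distrib)

lemma ray_weight_diff: "ray_weight F (\<lambda>x. S x - T x) a = ray_weight F S a - ray_weight F T a"
  by (simp add: ray_weight_def right_diff_distrib sum_subtractf)

lemma ray_weight_linear:
  assumes "tropical_fan 2 F" "a \<in> gens (cones F)"
  shows "ray_weight F (\<lambda>x. p \<bullet> x) a = 0"
proof -
  have "(\<Sum>b\<in>gens (cones F). edge F a b * (p \<bullet> b)) = p \<bullet> (\<Sum>b\<in>gens (cones F). edge F a b *\<^sub>R b)"
    by (simp add: inner_sum_right)
  then show ?thesis unfolding ray_weight_def edge_balance[OF assms] by simp
qed

lemma pairing_linear:
  assumes "tropical_fan 2 F"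
  shows "pairing F S (\<lambda>x. p \<bullet> x) = 0" "pairing F (\<lambda>x. p \<bullet> x) S = 0"
proof -
  show "pairing F S (\<lambda>x. p \<bullet> x) = 0" using ray_weight_linear[OF assms] by (simp add: pairing_def)
  then show "pairing F (\<lambda>x. p \<bullet> x) S = 0" by (simp add: pairing_commute)
qed

lemma pairing_add: "pairing F R (\<lambda>x. S x + T x) = pairing F R S + pairing F R T"
  by (simp add: pairing_def ray_weight_add distrib_left sum.distrib)

lemma pairing_diff: "pairing F R (\<lambda>x. S x - T x) = pairing F R S - pairing F R T"
  by (simp add: pairing_def ray_weight_diff right_diff_distrib sum_subtractf)

text \<open>The balancing of the product. Its inner product with \<open>z\<close> is the pairing of
  \<open>T\<close> with a linear function, which is zero by symmetry and the balancing of
  \<open>F\<close>.\<close>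

lemma sum_ray_weight_vector:
  assumes "tropical_fan 2 F"
  shows "(\<Sum>a\<in>gens (cones F). ray_weight F T a *\<^sub>R a) = 0"
proof (rule vector_eq_rdot[THEN iffD1], intro allI)
  fix z :: "real^'a"
  have "z \<bullet> (\<Sum>a\<in>gens (cones F). ray_weight F T a *\<^sub>R a) = pairing F (\<lambda>x. z \<bullet> x) T"
    by (simp add: inner_sum_right pairing_def mult.commute)
  also have "\<dots> = 0" by (rule pairing_linear(2)[OF assms])
  finally show "(\<Sum>a\<in>gens (cones F). ray_weight F T a *\<^sub>R a) \<bullet> z = 0 \<bullet> z"
    by (simp add: inner_commute)
qed

text \<open>Passing from the linear minorant to \<open>T\<close> keeps the value at \<open>a\<close>
  and raises the values at the neighbours, whose coefficients are nonnegative; the linear function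
  itself has weight 0.\<close>

lemma ray_weight_nonneg:
  assumes F: "tropical_fan 2 F" and a: "a \<in> gens (cones F)"
    and q: "q \<bullet> a = T a" "\<And>b. q \<bullet> b \<le> T b"
  shows "ray_weight F T a \<ge> 0"
proof -
  have "0 = ray_weight F (\<lambda>x. q \<bullet> x) a" using ray_weight_linear[OF F a] by simp
  also have "\<dots> \<le> ray_weight F T a"
    unfolding ray_weight_def q(1)
    by (intro diff_right_mono sum_mono mult_left_mono q(2) edge_nonneg[OF F] gensD(1)[OF a])
  finally show ?thesis .
qed

text \<open>The degree of the iterated product, still in terms of \<open>product_weight\<close>,
  because for these weights the behaviour under cuts is known.\<close>

definition product_sum :: "'n::finite weighted_fan \<Rightarrow> (real^'n \<Rightarrow> real) \<Rightarrow> (real^'n \<Rightarrow> real) \<Rightarrow> real" where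
  "product_sum F S T = (\<Sum>a\<in>gens (cones F). S a * product_weight T F (ray a))"

lemma product_sum_eq_pairing:
  assumes "tropical_fan 2 F" "\<And>\<sigma>. \<sigma> \<in> cones F \<Longrightarrow> linear_on_cone \<sigma> T"
  shows "product_sum F S T = pairing F S T"
  using product_weight_eq[OF assms(1) _ assms(2)] by (simp add: product_sum_def pairing_def)

text \<open>Old rays keep their product weight and new rays get weight 0, so the values of
  \<open>S\<close> on the new rays do not enter.\<close>

lemma product_sum_cut:
  assumes F: "tropical_fan 2 F" and l: "l \<in> lattice_points"
    and T: "\<And>\<sigma>. \<sigma> \<in> cones F \<Longrightarrow> linear_on_cone \<sigma> T"
  shows "product_sum (cut l F) S T = product_sum F S T"
  unfolding product_sum_def
proof (rule sum.mono_neutral_cong_right)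
  show "finite (gens (cones (cut l F)))"
    using finite_gens[OF tropical_pure[OF tropical_cut[OF F l]]] .
  show "gens (cones F) \<subseteq> gens (cones (cut l F))"
  proof
    fix a assume a: "a \<in> gens (cones F)"
    have "signed l (ray a)" by (auto simp: signed_def ray_def zero_le_mult_iff mult_le_0_iff)
    then show "a \<in> gens (cones (cut l F))" using a signed_mem_cut by (auto simp: gens_def)
  qed
  show "\<forall>a\<in>gens (cones (cut l F)) - gens (cones F). S a * product_weight T (cut l F) (ray a) = 0"
    using product_weight_cut_new[OF F l T] by (auto simp: gens_def)
  show "\<And>a. a \<in> gens (cones F) \<Longrightarrow> S a * product_weight T (cut l F) (ray a) = S a * product_weight T F (ray a)"
    using product_weight_cut_old[OF F l T] by (auto simp: gens_def)
qed

lemma linear_on_cuts: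
  assumes "\<And>\<sigma>. \<sigma> \<in> cones F \<Longrightarrow> linear_on_cone \<sigma> T" "\<sigma> \<in> cones (cuts ls F)"
  shows "linear_on_cone \<sigma> T"
  using cuts_subset[OF assms(2)] assms(1) linear_on_subset by blast

lemma product_sum_cuts:
  assumes "tropical_fan 2 F" "set ls \<subseteq> lattice_points"
    and "\<And>\<sigma>. \<sigma> \<in> cones F \<Longrightarrow> linear_on_cone \<sigma> T"
  shows "product_sum (cuts ls F) S T = product_sum F S T"
  using assms
proof (induction ls arbitrary: F)
  case (Cons l ls)
  have l: "l \<in> lattice_points" "set ls \<subseteq> lattice_points" using Cons.prems(2) by auto
  have "linear_on_cone \<sigma> T" if "\<sigma> \<in> cones (cut l F)" for \<sigma>
    using linear_on_cuts[OF Cons.prems(3), of F \<sigma> "[l]"] that by simp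
  then have "product_sum (cuts ls (cut l F)) S T = product_sum (cut l F) S T"
    using Cons.IH[OF tropical_cut[OF Cons.prems(1) l(1)] l(2)] by blast
  then show ?case using product_sum_cut[OF Cons.prems(1) l(1) Cons.prems(3)] by simp
qed simp

section \<open>Tropical regular functions and products\<close>

lemma is_max_of_ge: "is_max_of T A \<Longrightarrow> q \<in> A \<Longrightarrow> q \<bullet> x \<le> T x"
  by (auto simp: is_max_of_def intro!: Max_ge)

lemma is_max_of_attained:
  assumes "is_max_of T A" obtains q where "q \<in> A" "T x = q \<bullet> x"
proof -
  have "T x \<in> (\<lambda>l. l \<bullet> x) ` A" using assms Max_in[of "(\<lambda>l. l \<bullet> x) ` A"] by (simp add: is_max_of_def)
  then show ?thesis using that by blast
qed

lemma is_max_of_lattice: "is_max_of T A \<Longrightarrow> q \<in> A \<Longrightarrow> q \<in> lattice_points"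
  by (auto simp: is_max_of_def)

lemma is_max_of_scale:
  assumes "is_max_of T A" "s \<ge> 0" "q \<in> A" "T x = q \<bullet> x"
  shows "T (s *\<^sub>R x) = q \<bullet> (s *\<^sub>R x)"
proof (rule antisym)
  obtain p where p: "p \<in> A" "T (s *\<^sub>R x) = p \<bullet> (s *\<^sub>R x)" using is_max_of_attained[OF assms(1)] by blast
  have "p \<bullet> x \<le> q \<bullet> x" using is_max_of_ge[OF assms(1) p(1), of x] assms(4) by simp
  then show "T (s *\<^sub>R x) \<le> q \<bullet> (s *\<^sub>R x)" using p(2) assms(2) by (simp add: mult_left_mono)
qed (rule is_max_of_ge[OF assms(1,3)])

lemma is_max_of_linear_ray:
  assumes "is_max_of T A" shows "linear_on_cone (ray a) T"
proof -
  obtain q where q: "q \<in> A" "T a = q \<bullet> a" using is_max_of_attained[OF assms] by blast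
  have "\<forall>x\<in>ray a. q \<bullet> x = T x" using is_max_of_scale[OF assms _ q] by (auto simp: ray_def)
  moreover have "linear (\<lambda>x. q \<bullet> x)" by (rule bounded_linear.linear[OF bounded_linear_inner_right])
  ultimately show ?thesis unfolding linear_on_cone_def by blast
qed

text \<open>A covector attaining the maximum at \<open>a + b\<close> is at most \<open>T\<close> at
  \<open>a\<close> and at \<open>b\<close>, while the sums agree by linearity. So it attains the
  maximum at both generators and represents \<open>T\<close> on the cone by a lattice
  covector.\<close>

lemma is_max_of_linear_cone2:
  assumes "is_max_of T A" "linear_on_cone (cone2 a b) T"
  obtains q where "q \<in> A" "\<And>x. x \<in> cone2 a b \<Longrightarrow> q \<bullet> x = T x"
proof -
  obtain L where L: "linear L" "\<And>x. x \<in> cone2 a b \<Longrightarrow> L x = T x"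
    using assms(2) by (auto simp: linear_on_cone_def)
  obtain q where q: "q \<in> A" "T (a + b) = q \<bullet> (a + b)" using is_max_of_attained[OF assms(1)] by blast
  have "a + b \<in> cone2 a b" using cone2I[of 1 1 a b] by simp
  then have "T (a + b) = T a + T b"
    using L(2)[of "a + b"] L(2)[of a] L(2)[of b] by (simp add: linear_add[OF L(1)])
  then have "q \<bullet> a = T a" "q \<bullet> b = T b"
    using q(2) is_max_of_ge[OF assms(1) q(1), of a] is_max_of_ge[OF assms(1) q(1), of b]
    by (simp_all add: inner_add_right)
  moreover have "T (s *\<^sub>R a + t *\<^sub>R b) = s * T a + t * T b" if "0 \<le> s" "0 \<le> t" for s t
    using L(2)[OF cone2I[OF that, of a b]] L(2)[of a] L(2)[of b]
    by (simp add: linear_add[OF L(1)] linear_scale[OF L(1)])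
  ultimately have "q \<bullet> x = T x" if "x \<in> cone2 a b" for x
    using that by (auto simp: cone2_def inner_add_right)
  then show ?thesis using that q(1) by blast
qed

text \<open>If all differences have constant sign on \<open>\<sigma>\<close>, any two covectors are
  comparable there, and a largest one equals \<open>T\<close>.\<close>

lemma is_max_of_signed_linear:
  assumes "is_max_of T A" "\<And>p q. p \<in> A \<Longrightarrow> q \<in> A \<Longrightarrow> signed (p - q) \<sigma>"
  shows "linear_on_cone \<sigma> T"
proof -
  have max: "\<exists>m\<in>B. \<forall>q\<in>B. \<forall>x\<in>\<sigma>. q \<bullet> x \<le> m \<bullet> x" if "finite B" "B \<noteq> {}" "B \<subseteq> A" for B
    using that
  proof (induction B rule: finite_ne_induct)
    case (insert p B)
    then obtain m where m: "m \<in> B" "\<forall>q\<in>B. \<forall>x\<in>\<sigma>. q \<bullet> x \<le> m \<bullet> x" by auto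
    have "signed (p - m) \<sigma>" using assms(2) insert.prems m(1) by auto
    then consider "\<forall>x\<in>\<sigma>. p \<bullet> x \<ge> m \<bullet> x" | "\<forall>x\<in>\<sigma>. p \<bullet> x \<le> m \<bullet> x"
      by (auto simp: signed_def inner_diff_left)
    then show ?case
    proof cases
      case 1
      then have "\<forall>q\<in>insert p B. \<forall>x\<in>\<sigma>. q \<bullet> x \<le> p \<bullet> x" using m(2) by (auto intro: order_trans)
      then show ?thesis by blast
    next
      case 2
      then have "\<forall>q\<in>insert p B. \<forall>x\<in>\<sigma>. q \<bullet> x \<le> m \<bullet> x" using m(2) by auto
      then show ?thesis using m(1) by blast
    qed
  qed auto
  have "finite A" "A \<noteq> {}" using assms(1) by (simp_all add: is_max_of_def)
  from max[OF this order_refl] obtain m where m: "m \<in> A" "\<forall>q\<in>A. \<forall>x\<in>\<sigma>. q \<bullet> x \<le> m \<bullet> x"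
    by blast
  have "m \<bullet> x = T x" if "x \<in> \<sigma>" for x
  proof -
    obtain q where "q \<in> A" "T x = q \<bullet> x" using is_max_of_attained[OF assms(1)] by blast
    then show ?thesis using m that is_max_of_ge[OF assms(1) m(1), of x] by force
  qed
  moreover have "linear (\<lambda>x. m \<bullet> x)" by (rule bounded_linear.linear[OF bounded_linear_inner_right])
  ultimately show ?thesis unfolding linear_on_cone_def by blast
qed

lemma is_max_of_ray_weight_nonneg:
  assumes "tropical_fan 2 F" "a \<in> gens (cones F)" "is_max_of T A"
  shows "ray_weight F T a \<ge> 0"
proof -
  obtain q where q: "q \<in> A" "T a = q \<bullet> a" using is_max_of_attained[OF assms(3)] by blast
  show ?thesis
    by (rule ray_weight_nonneg[OF assms(1,2), of q]) (use q is_max_of_ge[OF assms(3) q(1)] in auto)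
qed

text \<open>All linear extensions involved are given by covectors of \<open>A\<close>, which are
  integral on lattice normals and on the balancing vector.\<close>

lemma product_weight_Ints:
  fixes F :: "'n::finite weighted_fan"
  assumes F: "tropical_fan 2 F" and a: "a \<in> gens (cones F)" and T: "is_max_of T A"
    and lin: "\<And>\<sigma>. \<sigma> \<in> cones F \<Longrightarrow> linear_on_cone \<sigma> T"
  shows "product_weight T F (ray a) \<in> \<int>"
proof -
  note P = tropical_pure[OF F]
  let ?L = "link (cones F) a"
  let ?z = "\<Sum>\<sigma>\<in>facet_star (cones F) (ray a). weight F \<sigma> *\<^sub>R lattice_normal \<sigma> (ray a)"
  have pa: "prim a" "ray a \<in> cones F" "a \<noteq> 0" "a \<in> lattice_points"
    using a gensD prim_nz prim_lattice by blast+
  have lin_q: "linear (\<lambda>x. q \<bullet> x)" for q :: "real^'n"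
    by (rule bounded_linear.linear[OF bounded_linear_inner_right])
  have w: "weight F (cone2 a b) \<in> \<int>" if "b \<in> ?L" for b
    using tropical_weight_pos[OF F link_prim(5)[OF that]] Nats_subset_Ints by blast
  have e: "linear_extension (cone2 a b) T (lattice_normal (cone2 a b) (ray a)) \<in> \<int>" if b: "b \<in> ?L" for b
  proof -
    obtain q where q: "q \<in> A" "\<And>x. x \<in> cone2 a b \<Longrightarrow> q \<bullet> x = T x"
      using is_max_of_linear_cone2[OF T lin[OF link_prim(4)[OF b]]] by blast
    note V = lattice_normal_cone2[OF pa(4) link_prim(2,3)[OF b]]
    have "linear_extension (cone2 a b) T (lattice_normal (cone2 a b) (ray a)) =
      q \<bullet> lattice_normal (cone2 a b) (ray a)"
      by (rule linear_extension_eq[OF lin_q q(2)]) (use V(2) in \<open>auto simp: span_cone2\<close>)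
    then show ?thesis using lattice_inner[OF is_max_of_lattice[OF T q(1)] V(1)] by simp
  qed
  have z: "?z = (\<Sum>b\<in>?L. weight F (cone2 a b) *\<^sub>R lattice_normal (cone2 a b) (ray a))"
    unfolding facet_star_ray[OF P pa(1)] sum.reindex[OF link_inj] by simp
  have zl: "?z \<in> lattice_points" unfolding z
    by (intro lattice_sum lattice_scaleR w lattice_normal_cone2(1)[OF pa(4) link_prim(2,3)])
  have zs: "?z \<in> span (ray a)" using F pa dim_ray[OF pa(3)] unfolding tropical_fan_def by simp
  obtain q where q: "q \<in> A" "T a = q \<bullet> a" using is_max_of_attained[OF T] by blast
  have "linear_extension (ray a) T ?z = q \<bullet> ?z"
    by (rule linear_extension_eq[OF lin_q _ zs]) (use is_max_of_scale[OF T _ q] in \<open>auto simp: ray_def\<close>)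
  then have 1: "linear_extension (ray a) T ?z \<in> \<int>"
    using lattice_inner[OF is_max_of_lattice[OF T q(1)] zl] by simp
  have 2: "(\<Sum>\<sigma>\<in>facet_star (cones F) (ray a). weight F \<sigma> * linear_extension \<sigma> T (lattice_normal \<sigma> (ray a))) \<in> \<int>"
    unfolding facet_star_ray[OF P pa(1)] sum.reindex[OF link_inj]
    by (auto intro!: Ints_sum Ints_mult w e)
  show ?thesis unfolding product_weight_def by (rule Ints_diff[OF 2 1])
qed

lemma Ints_nonneg_Nats: "(x::real) \<in> \<int> \<Longrightarrow> x \<ge> 0 \<Longrightarrow> x \<in> \<nat>"
  by (metis Ints_cases Nats_altdef2 Ints_of_int mem_Collect_eq)

lemma ray_subset_eq:
  assumes "u \<in> ray w" "u \<noteq> 0" shows "ray u = ray w"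
proof -
  obtain s where "u = s *\<^sub>R w" "s \<ge> 0" using assms(1) by (auto simp: ray_def)
  then show ?thesis using ray_scale[of s w] assms(2) by (cases "s = 0") auto
qed

lemma lattice_normal_gen: "a \<in> gens \<Phi> \<Longrightarrow> lattice_normal (ray a) {0} = a"
  by (simp add: lattice_normal_prim gensD(1))

section \<open>Cycles of dimension at most 1\<close>

text \<open>In dimension at most 1 the refinement relation is trivial: a ray cannot be subdivided.\<close>

lemma cone_generic_point:
  fixes \<Phi> :: "(real^'n) set set"
  assumes "pure_fan k \<Phi>" "k \<le> 1" "\<sigma> \<in> cones_of_dim \<Phi> k"
  obtains x where "x \<in> \<sigma>"
    "\<And>\<Psi> \<tau>. pure_fan k \<Psi> \<Longrightarrow> \<tau> \<in> cones_of_dim \<Psi> k \<Longrightarrow> x \<in> \<tau> \<Longrightarrow> \<sigma> = \<tau>"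
proof -
  have k2: "k \<le> 2" using assms(2) by simp
  consider "k = 0" | "k = 1" using assms(2) by linarith
  then show ?thesis
  proof cases
    case 1
    have z: "\<tau> = {0}" if "pure_fan k \<Psi>" "\<tau> \<in> cones_of_dim \<Psi> k" for \<Psi> :: "(real^'n) set set" and \<tau>
      by (rule fan_cone_cases[OF that(1) k2, of \<tau>]) (use cones_of_dimD[OF that(2)] 1 in auto)
    show ?thesis using that[of 0] z[OF assms(1,3)] z by simp
  next
    case 2
    obtain u where u: "prim u" "\<sigma> = ray u" using fan_1cone[OF assms(1) k2] assms(3) 2 by blast
    show ?thesis
    proof (rule that[of u])
      fix \<Psi> :: "(real^'n) set set" and \<tau> assume \<tau>: "pure_fan k \<Psi>" "\<tau> \<in> cones_of_dim \<Psi> k" "u \<in> \<tau>"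
      obtain w where "prim w" "\<tau> = ray w" using fan_1cone[OF \<tau>(1) k2] \<tau>(2) 2 by blast
      then show "\<sigma> = \<tau>" using \<tau>(3) u ray_subset_eq prim_nz by metis
    qed (use u in simp)
  qed
qed

lemma refines_low_dim:
  fixes H G :: "'n::finite weighted_fan"
  assumes "refines k H G" "k \<le> 1" shows "H = G"
proof -
  note T = refines_tropical[OF assms(1)]
  note P = T[THEN tropical_pure]
  have up: "\<sigma> \<in> cones_of_dim (cones G) k \<and> weight H \<sigma> = weight G \<sigma>"
    if \<sigma>: "\<sigma> \<in> cones_of_dim (cones H) k" for \<sigma>
  proof -
    obtain \<tau> where \<tau>: "\<tau> \<in> cones G" "\<sigma> \<subseteq> \<tau>" using refines_cone[OF assms(1)] cones_of_dimD[OF \<sigma>] by blast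
    have "dim \<tau> = k" using dim_subset[OF \<tau>(2)] fan_dim_le[OF P(2) \<tau>(1)] cones_of_dimD[OF \<sigma>] by simp
    then have \<tau>': "\<tau> \<in> cones_of_dim (cones G) k" using \<tau> by (simp add: cones_of_dim_def)
    obtain x where x: "x \<in> \<sigma>" "\<And>\<Psi> \<tau>. pure_fan k \<Psi> \<Longrightarrow> \<tau> \<in> cones_of_dim \<Psi> k \<Longrightarrow> x \<in> \<tau> \<Longrightarrow> \<sigma> = \<tau>"
      using cone_generic_point[OF P(1) assms(2) \<sigma>] by blast
    have "\<sigma> = \<tau>" using x \<tau>(2) P(2) \<tau>' by blast
    then show ?thesis using \<tau>' refines_weight[OF assms(1) \<sigma> \<tau>'] by simp
  qed
  have down: "\<sigma> \<in> cones_of_dim (cones H) k" if \<sigma>: "\<sigma> \<in> cones_of_dim (cones G) k" for \<sigma>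
  proof -
    obtain x where x: "x \<in> \<sigma>" "\<And>\<Psi> \<tau>. pure_fan k \<Psi> \<Longrightarrow> \<tau> \<in> cones_of_dim \<Psi> k \<Longrightarrow> x \<in> \<tau> \<Longrightarrow> \<sigma> = \<tau>"
      using cone_generic_point[OF P(2) assms(2) \<sigma>] by blast
    have "x \<in> \<Union>(cones H)" unfolding refines_Union[OF assms(1)] using x(1) cones_of_dimD[OF \<sigma>] by blast
    then obtain \<rho> where "\<rho> \<in> cones H" "x \<in> \<rho>" by blast
    then obtain \<tau> where \<tau>: "\<tau> \<in> cones_of_dim (cones H) k" "x \<in> \<tau>" using fan_maximal[OF P(1)] by blast
    then show ?thesis using x(2)[OF P(1) \<tau>] by simp
  qed
  have C: "cones_of_dim (cones H) k = cones_of_dim (cones G) k" using up down by blast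
  have "cones H = cones G" by (rule pure_fan_eqI[OF P C])
  moreover have "weight H \<sigma> = weight G \<sigma>" for \<sigma>
    using up[of \<sigma>] tropical_weight_0[OF T(1), of \<sigma>] tropical_weight_0[OF T(2), of \<sigma>] C by metis
  ultimately show ?thesis by (simp add: weighted_fan.expand ext)
qed

lemma refines_refl_low_dim:
  fixes G :: "'n::finite weighted_fan"
  assumes G: "tropical_fan k G" and "k \<le> 1" shows "refines k G G"
proof (rule refinesI[OF G G refl])
  note P = tropical_pure[OF G]
  fix \<sigma>' \<sigma> assume \<sigma>: "\<sigma>' \<in> cones_of_dim (cones G) k" "\<sigma> \<in> cones_of_dim (cones G) k" "\<sigma>' \<subseteq> \<sigma>"
  obtain x where "x \<in> \<sigma>'" "\<And>\<Psi> \<tau>. pure_fan k \<Psi> \<Longrightarrow> \<tau> \<in> cones_of_dim \<Psi> k \<Longrightarrow> x \<in> \<tau> \<Longrightarrow> \<sigma>' = \<tau>"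
    using cone_generic_point[OF P assms(2) \<sigma>(1)] by blast
  then have "\<sigma>' = \<sigma>" using P \<sigma> by blast
  then show "weight G \<sigma>' = weight G \<sigma>" by simp
qed blast

text \<open>Classes in these dimensions are singletons, so the choices of representatives in the
  second product and in \<open>origin_weight\<close> are forced.\<close>

lemma fan_equiv_low_dim:
  fixes G :: "'n::finite weighted_fan"
  assumes "tropical_fan k G" "k \<le> 1" shows "fan_equiv k `` {G} = {G}"
proof
  show "fan_equiv k `` {G} \<subseteq> {G}"
  proof
    fix K assume "K \<in> fan_equiv k `` {G}"
    then obtain H where "refines k H G" "refines k H K" by (auto simp: fan_equiv_def)
    then show "K \<in> {G}" using refines_low_dim[OF _ assms(2)] by blast
  qed
  show "{G} \<subseteq> fan_equiv k `` {G}"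
    using refines_refl_low_dim[OF assms] by (auto simp: fan_equiv_def)
qed

lemma pure_fan_subfan:
  fixes \<Phi> :: "(real^'n) set set"
  assumes "pure_fan k \<Phi>" "S \<subseteq> cones_of_dim \<Phi> j"
  shows "pure_fan j {\<rho>\<in>\<Phi>. \<exists>\<tau>\<in>S. \<rho> \<subseteq> \<tau>}"
  unfolding pure_fan_def rational_fan_def
proof (intro conjI ballI allI impI)
  let ?\<Psi> = "{\<rho>\<in>\<Phi>. \<exists>\<tau>\<in>S. \<rho> \<subseteq> \<tau>}"
  show "finite ?\<Psi>" using fan_finite[OF assms(1)] by simp
  fix \<sigma> assume \<sigma>: "\<sigma> \<in> ?\<Psi>"
  show "rational_polyhedral_cone \<sigma>" "strongly_convex_cone \<sigma>"
    using \<sigma> assms(1) unfolding pure_fan_def rational_fan_def by auto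
  show "\<tau> \<in> ?\<Psi>" if \<tau>: "\<tau> face_of \<sigma> \<and> \<tau> \<noteq> {}" for \<tau>
  proof -
    have "\<tau> \<in> \<Phi>" using fan_face[OF assms(1)] \<sigma> \<tau> by blast
    moreover have "\<tau> \<subseteq> \<sigma>" using \<tau> face_of_imp_subset by blast
    ultimately show ?thesis using \<sigma> by auto
  qed
  show "\<sigma> \<inter> \<sigma>' face_of \<sigma>" if "\<sigma>' \<in> ?\<Psi>" for \<sigma>'
    using fan_Int_face[OF assms(1)] \<sigma> that by simp
  show "\<sigma> \<inter> \<sigma>' face_of \<sigma>'" if "\<sigma>' \<in> ?\<Psi>" for \<sigma>'
    using fan_Int_face[OF assms(1), of \<sigma>' \<sigma>] \<sigma> that by (simp add: Int_commute)
  obtain \<tau> where \<tau>: "\<tau> \<in> S" "\<sigma> \<subseteq> \<tau>" using \<sigma> by blast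
  have "\<tau> \<in> \<Phi> \<and> dim \<tau> = j" using \<tau>(1) assms(2) cones_of_dimD by blast
  then have "\<tau> \<in> cones_of_dim ?\<Psi> j" using \<tau>(1) by (auto simp: cones_of_dim_def)
  then show "\<exists>\<tau>\<in>cones_of_dim ?\<Psi> j. \<sigma> \<subseteq> \<tau>" using \<tau>(2) by blast
qed

section \<open>The 1-cycle of a product and its degree\<close>

context
  fixes F :: "'n::finite weighted_fan" and T :: "real^'n \<Rightarrow> real" and A :: "(real^'n) set"
  assumes F: "tropical_fan 2 F" and T: "is_max_of T A"
    and lin: "\<And>\<sigma>. \<sigma> \<in> cones F \<Longrightarrow> linear_on_cone \<sigma> T"
begin

lemma product_weight_nonneg: "a \<in> gens (cones F) \<Longrightarrow> product_weight T F (ray a) \<ge> 0"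
  using product_weight_eq[OF F _ lin] is_max_of_ray_weight_nonneg[OF F _ T] by simp

lemma cones_product_fan: "cones (product_fan 1 T F) = {\<rho>\<in>cones F. \<exists>\<tau>\<in>{\<tau>\<in>cones_of_dim (cones F) 1. product_weight T F \<tau> \<noteq> 0}. \<rho> \<subseteq> \<tau>}"
  by (auto simp: product_fan_def)

lemma pure_product_fan: "pure_fan 1 (cones (product_fan 1 T F))"
  unfolding cones_product_fan by (rule pure_fan_subfan[OF tropical_pure[OF F]]) auto

lemma gens_product_fan: "gens (cones (product_fan 1 T F)) = {a\<in>gens (cones F). product_weight T F (ray a) \<noteq> 0}"
proof -
  have C1: "cones_of_dim (cones F) 1 = ray ` gens (cones F)"
    by (rule cones_of_dim_1[OF tropical_pure[OF F]]) simp
  show ?thesis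
  proof (intro equalityI subsetI)
    fix a assume "a \<in> gens (cones (product_fan 1 T F))"
    then have a: "prim a" "ray a \<in> cones (product_fan 1 T F)" using gensD by blast+
    then obtain \<tau> where \<tau>: "\<tau> \<in> cones_of_dim (cones F) 1" "product_weight T F \<tau> \<noteq> 0" "ray a \<subseteq> \<tau>"
      unfolding cones_product_fan by blast
    then obtain b where b: "b \<in> gens (cones F)" "\<tau> = ray b" using C1 by blast
    have "ray a = ray b" using \<tau>(3) b(2) ray_mem(1)[of a] by (intro ray_subset_eq prim_nz a) auto
    then have "a = b" using prim_unique a(1) gensD(1)[OF b(1)] by blast
    then show "a \<in> {a\<in>gens (cones F). product_weight T F (ray a) \<noteq> 0}" using b \<tau>(2) by simp
  next
    fix a assume a: "a \<in> {a\<in>gens (cones F). product_weight T F (ray a) \<noteq> 0}"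
    then have "ray a \<in> cones_of_dim (cones F) 1" using C1 by blast
    then have "ray a \<in> cones (product_fan 1 T F)" unfolding cones_product_fan using a gensD(2) by blast
    then show "a \<in> gens (cones (product_fan 1 T F))" using a gensD(1) by (simp add: gens_def)
  qed
qed

lemma weight_product_fan: "a \<in> gens (cones F) \<Longrightarrow> weight (product_fan 1 T F) (ray a) = product_weight T F (ray a)"
  using cones_of_dim_1[OF tropical_pure[OF F]] by (simp add: product_fan_def)

lemma rays_product_fan: "cones_of_dim (cones (product_fan 1 T F)) 1 = ray ` gens (cones (product_fan 1 T F))"
  by (rule cones_of_dim_1[OF pure_product_fan]) simp

lemma facet_star_0_product_fan:
  assumes "{0} \<in> cones (product_fan 1 T F)" shows "facet_star (cones (product_fan 1 T F)) {0} = ray ` gens (cones (product_fan 1 T F))"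
  unfolding facet_star_def using rays_product_fan by (auto simp: zero_face_ray)

text \<open>Balancing at the origin leaves no room, as the span of \<open>{0}\<close> is trivial:
  the weighted generators must sum to 0 exactly. Restoring the rays of weight 0 reduces this to
  \<open>sum_ray_weight_vector\<close>.\<close>

lemma star_sum_product_fan: "(\<Sum>\<sigma>\<in>ray ` gens (cones (product_fan 1 T F)). weight (product_fan 1 T F) \<sigma> *\<^sub>R lattice_normal \<sigma> {0}) = 0"
proof -
  have "(\<Sum>\<sigma>\<in>ray ` gens (cones (product_fan 1 T F)). weight (product_fan 1 T F) \<sigma> *\<^sub>R lattice_normal \<sigma> {0}) =
    (\<Sum>a\<in>gens (cones (product_fan 1 T F)). weight (product_fan 1 T F) (ray a) *\<^sub>R a)"
    by (subst sum.reindex[OF inj_on_ray]) (simp add: lattice_normal_gen)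
  also have "\<dots> = (\<Sum>a\<in>gens (cones F). ray_weight F T a *\<^sub>R a)"
    by (rule sum.mono_neutral_cong_left)
      (use gens_product_fan weight_product_fan product_weight_eq[OF F _ lin] finite_gens[OF tropical_pure[OF F]] in auto)
  finally show ?thesis using sum_ray_weight_vector[OF F] by simp
qed

lemma tropical_product_fan: "tropical_fan 1 (product_fan 1 T F)"
  unfolding tropical_fan_def
proof (intro conjI ballI allI impI)
  show "pure_fan 1 (cones (product_fan 1 T F))" by (rule pure_product_fan)
next
  fix \<sigma> assume "\<sigma> \<in> cones_of_dim (cones (product_fan 1 T F)) 1"
  then obtain a where a: "a \<in> gens (cones F)" "product_weight T F (ray a) \<noteq> 0" "\<sigma> = ray a"
    unfolding rays_product_fan gens_product_fan by blast
  then have "product_weight T F (ray a) \<in> \<nat>"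
    using Ints_nonneg_Nats product_weight_Ints[OF F a(1) T lin] product_weight_nonneg by blast
  then show "weight (product_fan 1 T F) \<sigma> \<in> \<nat>" "weight (product_fan 1 T F) \<sigma> > 0"
    using weight_product_fan a product_weight_nonneg[OF a(1)] by simp_all
next
  fix \<sigma> assume \<sigma>: "\<sigma> \<notin> cones_of_dim (cones (product_fan 1 T F)) 1"
  show "weight (product_fan 1 T F) \<sigma> = 0"
  proof (rule ccontr)
    assume "weight (product_fan 1 T F) \<sigma> \<noteq> 0"
    then have s: "\<sigma> \<in> cones_of_dim (cones F) 1" "product_weight T F \<sigma> \<noteq> 0"
      by (auto simp: product_fan_def split: if_splits)
    then have "\<sigma> \<in> cones_of_dim (cones (product_fan 1 T F)) 1" unfolding cones_product_fan by (auto simp: cones_of_dim_def)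
    then show False using \<sigma> by simp
  qed
next
  fix \<tau> assume \<tau>: "\<tau> \<in> cones (product_fan 1 T F)" "Suc (dim \<tau>) = 1"
  have "\<tau> = {0}"
    by (rule fan_cone_cases[OF pure_product_fan _ \<tau>(1)]) (use \<tau>(2) in auto)
  then show "(\<Sum>\<sigma>\<in>facet_star (cones (product_fan 1 T F)) \<tau>. weight (product_fan 1 T F) \<sigma> *\<^sub>R lattice_normal \<sigma> \<tau>) \<in> span \<tau>"
    using facet_star_0_product_fan \<tau>(1) star_sum_product_fan by simp
qed

text \<open>A maximum of covectors is linear on every ray, so the second product can be taken on the
  product fan as it is.\<close>

lemma linear_on_product_fan:
  assumes S: "is_max_of S B" and \<sigma>: "\<sigma> \<in> cones (product_fan 1 T F)" shows "linear_on_cone \<sigma> S"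
proof (rule fan_cone_cases[OF pure_product_fan _ \<sigma>])
  assume "\<sigma> = {0}"
  then show ?thesis using is_max_of_linear_ray[OF S, of 0] by simp
next
  fix u assume "\<sigma> = ray u"
  then show ?thesis using is_max_of_linear_ray[OF S, of u] by simp
next
  assume "dim \<sigma> = 2"
  then show ?thesis using fan_dim_le[OF pure_product_fan \<sigma>] by simp
qed simp

lemma product_weight_product_fan_0:
  assumes S: "is_max_of S B" and z: "{0} \<in> cones (product_fan 1 T F)"
  shows "product_weight S (product_fan 1 T F) {0} = product_sum F S T"
proof -
  have lin_q: "linear (\<lambda>x. q \<bullet> x)" for q :: "real^'n"
    by (rule bounded_linear.linear[OF bounded_linear_inner_right])
  have S0: "S 0 = 0" using is_max_of_attained[OF S, of 0] by auto
  have e0: "linear_extension {0} S 0 = 0"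
    using linear_extension_eq[OF lin_q[of 0], of "{0}" S 0] S0 by simp
  have ea: "linear_extension (ray a) S a = S a" for a
  proof -
    obtain q where q: "q \<in> B" "S a = q \<bullet> a" using is_max_of_attained[OF S] by blast
    have "linear_extension (ray a) S a = q \<bullet> a"
      by (rule linear_extension_eq[OF lin_q])
        (use is_max_of_scale[OF S _ q] in \<open>auto simp: ray_def span_base intro!: span_base exI[of _ 1]\<close>)
    then show ?thesis using q by simp
  qed
  have "product_weight S (product_fan 1 T F) {0} =
    (\<Sum>\<sigma>\<in>ray ` gens (cones (product_fan 1 T F)). weight (product_fan 1 T F) \<sigma> * linear_extension \<sigma> S (lattice_normal \<sigma> {0}))"
    unfolding product_weight_def facet_star_0_product_fan[OF z] star_sum_product_fan e0 by simp
  also have "\<dots> = (\<Sum>a\<in>gens (cones (product_fan 1 T F)). weight (product_fan 1 T F) (ray a) * S a)"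
    by (subst sum.reindex[OF inj_on_ray]) (simp add: lattice_normal_gen ea)
  also have "\<dots> = product_sum F S T"
    unfolding product_sum_def
    by (rule sum.mono_neutral_cong_left)
      (use gens_product_fan weight_product_fan finite_gens[OF tropical_pure[OF F]] in auto)
  finally show ?thesis .
qed

text \<open>Any covector of \<open>B\<close> is a linear minorant of \<open>S\<close> and pairs to 0
  with \<open>T\<close>, while the weights of \<open>T\<close> are nonnegative. With integrality
  this makes the origin a legitimate weighted cone of a 0-fan.\<close>

lemma product_sum_nonneg_Ints:
  assumes S: "is_max_of S B"
  shows "product_sum F S T \<in> \<int>" "product_sum F S T \<ge> 0"
proof -
  show "product_sum F S T \<in> \<int>"
    unfolding product_sum_def
  proof (intro Ints_sum Ints_mult)
    fix a assume a: "a \<in> gens (cones F)"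
    show "product_weight T F (ray a) \<in> \<int>" by (rule product_weight_Ints[OF F a T lin])
    obtain q where q: "q \<in> B" "S a = q \<bullet> a" using is_max_of_attained[OF S] by blast
    then show "S a \<in> \<int>"
      using lattice_inner[OF is_max_of_lattice[OF S q(1)] prim_lattice[OF gensD(1)[OF a]]] by simp
  qed
  obtain q where q: "q \<in> B" using is_max_of_attained[OF S] by blast
  have "0 = pairing F (\<lambda>x. q \<bullet> x) T" using pairing_linear[OF F] by simp
  also have "\<dots> \<le> pairing F S T"
    unfolding pairing_def
    by (intro sum_mono mult_right_mono is_max_of_ge[OF S q] is_max_of_ray_weight_nonneg[OF F _ T])
  finally show "product_sum F S T \<ge> 0" using product_sum_eq_pairing[OF F lin] by simp
qed

text \<open>The class of the product fan is a singleton and so is the class of the resulting 0-fan,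
  hence both uses of \<open>SOME\<close> evaluate.\<close>

lemma intersection_number_product:
  assumes S: "is_max_of S B"
  shows "origin_weight (cycle_product 0 S (fan_equiv 1 `` {product_fan 1 T F})) = product_sum F S T"
proof -
  let ?Z = "product_fan 0 S (product_fan 1 T F)"
  have some: "(SOME K. K \<in> {product_fan 1 T F} \<and> (\<forall>\<sigma>\<in>cones K. linear_on_cone \<sigma> S)) = product_fan 1 T F"
    using linear_on_product_fan[OF S] by (intro some_equality) auto
  have C0: "cones_of_dim (cones (product_fan 1 T F)) 0 = (if {0} \<in> cones (product_fan 1 T F) then {{0}} else {})"
  proof -
    have "\<sigma> = {0}" if "\<sigma> \<in> cones_of_dim (cones (product_fan 1 T F)) 0" for \<sigma>
      by (rule fan_cone_cases[OF pure_product_fan, of \<sigma>]) (use cones_of_dimD[OF that] in auto)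
    then show ?thesis by (auto simp: cones_of_dim_def)
  qed
  have w: "weight ?Z {0} = product_sum F S T"
  proof (cases "{0} \<in> cones (product_fan 1 T F)")
    case True
    then show ?thesis using C0 product_weight_product_fan_0[OF S True] by (simp add: product_fan_def)
  next
    case False
    \<comment> \<open>Without the origin the product fan is empty, that is, every ray has weight 0;
      the default weight 0 then agrees with the empty degree.\<close>
    have "cones (product_fan 1 T F) = {}" using fan_zero_mem(1)[OF pure_product_fan] False by auto
    then have "gens (cones (product_fan 1 T F)) = {}" by (auto simp: gens_def)
    then have "product_sum F S T = 0" unfolding product_sum_def gens_product_fan by (intro sum.neutral) auto
    moreover have "weight ?Z {0} = 0"
      unfolding product_fan_def[of 0] weighted_fan.sel C0 using False by simp
    ultimately show ?thesis by simp
  qed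
  have cZ: "cones ?Z = {\<rho>\<in>cones (product_fan 1 T F). \<exists>\<tau>\<in>{\<tau>\<in>cones_of_dim (cones (product_fan 1 T F)) 0. product_weight S (product_fan 1 T F) \<tau> \<noteq> 0}. \<rho> \<subseteq> \<tau>}"
    by (auto simp: product_fan_def)
  have pZ: "pure_fan 0 (cones ?Z)" unfolding cZ by (rule pure_fan_subfan[OF pure_product_fan]) auto
  have "tropical_fan 0 ?Z"
    unfolding tropical_fan_def
  proof (intro conjI ballI allI impI)
    show "pure_fan 0 (cones ?Z)" by (rule pZ)
  next
    fix \<sigma> assume \<sigma>: "\<sigma> \<in> cones_of_dim (cones ?Z) 0"
    then obtain \<tau> where \<tau>: "\<tau> \<in> cones_of_dim (cones (product_fan 1 T F)) 0" "product_weight S (product_fan 1 T F) \<tau> \<noteq> 0" "\<sigma> \<subseteq> \<tau>" "\<sigma> \<in> cones (product_fan 1 T F)"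
      unfolding cones_of_dim_def cZ by blast
    then have z: "{0} \<in> cones (product_fan 1 T F)" "\<tau> = {0}" using C0 by (auto split: if_splits)
    have "\<sigma> = {0}" using \<tau>(3) z(2) fan_0_mem[OF pure_product_fan \<tau>(4)] by blast
    moreover have "product_sum F S T \<noteq> 0" using \<tau>(2) z product_weight_product_fan_0[OF S z(1)] by simp
    ultimately show "weight ?Z \<sigma> \<in> \<nat>" "weight ?Z \<sigma> > 0"
      using w product_sum_nonneg_Ints[OF S] Ints_nonneg_Nats by auto
  next
    fix \<sigma> assume \<sigma>: "\<sigma> \<notin> cones_of_dim (cones ?Z) 0"
    show "weight ?Z \<sigma> = 0"
    proof (rule ccontr)
      assume "weight ?Z \<sigma> \<noteq> 0"
      then have s: "\<sigma> \<in> cones_of_dim (cones (product_fan 1 T F)) 0" "product_weight S (product_fan 1 T F) \<sigma> \<noteq> 0"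
        by (auto simp: product_fan_def split: if_splits)
      then have "\<sigma> \<in> cones_of_dim (cones ?Z) 0" unfolding cZ by (auto simp: cones_of_dim_def)
      then show False using \<sigma> by simp
    qed
  qed simp
  then have "fan_equiv 0 `` {?Z} = {?Z}" by (rule fan_equiv_low_dim) simp
  then show ?thesis
    unfolding cycle_product_def fan_equiv_low_dim[OF tropical_product_fan order_refl] some origin_weight_def
    using w by simp
qed

end

lemma cycles_2_mem:
  assumes "C \<in> cycles 2"
  obtains F where "F \<in> C" "\<And>G. G \<in> C \<longleftrightarrow> tropical_fan 2 G \<and> level G = level F" "tropical_fan 2 F"
proof -
  obtain F where F: "tropical_fan 2 F" "C = fan_equiv 2 `` {F}"
    using assms unfolding cycles_def by (auto elim!: quotientE)
  then have "G \<in> C \<longleftrightarrow> tropical_fan 2 G \<and> level G = level F" for G by (auto simp: fan_equiv_2)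
  then show ?thesis using that[of F] F(1) by simp
qed

text \<open>The fan is the one selected in \<open>cycle_product\<close>; cutting along all
  differences of covectors of \<open>T\<close> shows that a candidate exists. It depends on
  \<open>T\<close>, so different intersection numbers may be computed on different fans.\<close>

lemma intersection_number_eq:
  fixes C :: "'n::finite weighted_fan set"
  assumes C: "C \<in> cycles 2" and S: "is_max_of S B" and T: "is_max_of T A"
  obtains F where "F \<in> C" "\<And>\<sigma>. \<sigma> \<in> cones F \<Longrightarrow> linear_on_cone \<sigma> T"
    "intersection_number S T C = product_sum F S T"
proof -
  obtain F0 where F0: "F0 \<in> C" "\<And>G. G \<in> C \<longleftrightarrow> tropical_fan 2 G \<and> level G = level F0" "tropical_fan 2 F0"
    using cycles_2_mem[OF C] by blast
  have "finite ((\<lambda>(p, q). p - q) ` (A \<times> A))" using T by (simp add: is_max_of_def)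
  then obtain ls where ls: "set ls = (\<lambda>(p, q). p - q) ` (A \<times> A)" using finite_list by blast
  have lat: "set ls \<subseteq> lattice_points" unfolding ls using is_max_of_lattice[OF T] by (auto intro: lattice_diff)
  have "signed (p - q) \<sigma>" if "\<sigma> \<in> cones (cuts ls F0)" "p \<in> A" "q \<in> A" for p q \<sigma>
    using signed_cuts[OF that(1), of "p - q"] that ls by auto
  then have "linear_on_cone \<sigma> T" if "\<sigma> \<in> cones (cuts ls F0)" for \<sigma>
    using is_max_of_signed_linear[OF T] that by blast
  moreover have "cuts ls F0 \<in> C" using F0 tropical_cuts level_cuts lat by auto
  ultimately have ex: "\<exists>F. F \<in> C \<and> (\<forall>\<sigma>\<in>cones F. linear_on_cone \<sigma> T)" by blast
  define F where "F = (SOME F. F \<in> C \<and> (\<forall>\<sigma>\<in>cones F. linear_on_cone \<sigma> T))"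
  have F: "F \<in> C" "\<And>\<sigma>. \<sigma> \<in> cones F \<Longrightarrow> linear_on_cone \<sigma> T"
    using someI_ex[OF ex] unfolding F_def by blast+
  have "tropical_fan 2 F" using F0 F(1) by blast
  then have "intersection_number S T C = product_sum F S T"
    unfolding intersection_number_def cycle_product_def[of 1] F_def[symmetric]
    by (rule intersection_number_product[OF _ T F(2) S])
  then show ?thesis using that F by blast
qed

section \<open>Bounding planes and weights\<close>

text \<open>The skew matrix of Pluecker coordinates of the plane of \<open>a\<close> and
  \<open>v\<close>. Its range recovers the plane, and for lattice vectors its entries are
  integers.\<close>

definition bivector :: "real^'n \<Rightarrow> real^'n \<Rightarrow> real^'n^'n" where
  "bivector a v = (\<chi> i j. a $ i * v $ j - v $ i * a $ j)"

lemma bivector_mult: "bivector a v *v x = (v \<bullet> x) *\<^sub>R a - (a \<bullet> x) *\<^sub>R v"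
  by (simp add: vec_eq_iff bivector_def matrix_vector_mult_def inner_vec_def left_diff_distrib
      right_diff_distrib sum_subtractf sum_distrib_left mult_ac)

lemma range_bivector:
  fixes a v :: "real^'n"
  assumes "gram a v > 0" shows "range ((*v) (bivector a v)) = span {a, v}"
proof (intro equalityI subsetI)
  fix y assume "y \<in> range ((*v) (bivector a v))"
  then obtain x where "y = (v \<bullet> x) *\<^sub>R a + (- (a \<bullet> x)) *\<^sub>R v" by (auto simp: bivector_mult)
  then show "y \<in> span {a, v}" unfolding in_span2 by blast
next
  fix y assume "y \<in> span {a, v}"
  then obtain s t where y: "y = s *\<^sub>R a + t *\<^sub>R v" by (auto simp: in_span2)
  let ?x = "(s / gram a v) *\<^sub>R perp a v - (t / gram a v) *\<^sub>R perp v a"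
  have "v \<bullet> ?x = s" "a \<bullet> ?x = - t"
    using assms by (simp_all add: inner_diff_right gram_commute[of v a])
  then have "y = bivector a v *v ?x" unfolding bivector_mult by (simp add: y)
  then show "y \<in> range ((*v) (bivector a v))" by blast
qed

text \<open>Lagrange's identity: the squares of all entries add up to
  \<open>2 * gram a v\<close>.\<close>

lemma bivector_entry_le:
  fixes a v :: "real^'n"
  shows "(bivector a v $ i $ j)\<^sup>2 \<le> 2 * gram a v"
proof -
  let ?f = "\<lambda>i j. (a $ i * v $ j - v $ i * a $ j)\<^sup>2"
  have "(\<Sum>i\<in>UNIV. \<Sum>j\<in>UNIV. ?f i j) =
    (\<Sum>i\<in>UNIV. \<Sum>j\<in>UNIV. (a $ i * a $ i) * (v $ j * v $ j)) + (\<Sum>i\<in>UNIV. \<Sum>j\<in>UNIV. (v $ i * v $ i) * (a $ j * a $ j))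
    - 2 * (\<Sum>i\<in>UNIV. \<Sum>j\<in>UNIV. (a $ i * v $ i) * (a $ j * v $ j))"
    by (simp add: sum.distrib[symmetric] sum_subtractf[symmetric] sum_distrib_left power2_eq_square algebra_simps)
  also have "\<dots> = 2 * gram a v"
    unfolding sum_product[symmetric] gram_def by (simp add: inner_vec_def power2_eq_square)
  finally have s: "(\<Sum>i\<in>UNIV. \<Sum>j\<in>UNIV. ?f i j) = 2 * gram a v" .
  have "?f i j \<le> (\<Sum>j\<in>UNIV. ?f i j)" by (rule member_le_sum) auto
  also have "\<dots> \<le> (\<Sum>i\<in>UNIV. \<Sum>j\<in>UNIV. ?f i j)"
    by (rule member_le_sum[of i UNIV "\<lambda>i. \<Sum>j\<in>UNIV. ?f i j"]) (auto intro: sum_nonneg)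
  finally show ?thesis unfolding s by (simp add: bivector_def)
qed

lemma finite_vectors_over:
  assumes "finite S" shows "finite {x :: 'a^'n. \<forall>i. x $ i \<in> S}"
proof -
  have "{x :: 'a^'n. \<forall>i. x $ i \<in> S} \<subseteq> vec_lambda ` (UNIV \<rightarrow>\<^sub>E S)"
  proof
    fix x :: "'a^'n" assume "x \<in> {x. \<forall>i. x $ i \<in> S}"
    then have "(\<lambda>i. x $ i) \<in> UNIV \<rightarrow>\<^sub>E S" by auto
    then show "x \<in> vec_lambda ` (UNIV \<rightarrow>\<^sub>E S)" by (metis imageI vec_nth_inverse)
  qed
  then show ?thesis using assms by (meson finite_PiE finite_code finite_imageI finite_subset)
qed

text \<open>Each such plane is the range of an integer matrix with bounded entries, and there are
  finitely many of these.\<close>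

lemma finite_planes_bounded_gram:
  "finite {P. \<exists>a v :: real^'n. a \<in> lattice_points \<and> v \<in> lattice_points \<and>
     gram a v > 0 \<and> gram a v \<le> K \<and> P = span {a, v}}" (is "finite ?\<P>")
proof -
  let ?E = "{k \<in> \<int>. \<bar>k\<bar> \<le> sqrt (2 * K)}"
  let ?R = "{x :: real^'n. \<forall>i. x $ i \<in> ?E}"
  have "?\<P> \<subseteq> (\<lambda>B :: real^'n^'n. range ((*v) B)) ` {B. \<forall>i. B $ i \<in> ?R}"
  proof
    fix P assume "P \<in> ?\<P>"
    then obtain a v :: "real^'n" where av: "a \<in> lattice_points" "v \<in> lattice_points"
      "gram a v > 0" "gram a v \<le> K" "P = span {a, v}" by blast
    have "bivector a v $ i $ j \<in> ?E" for i j
    proof -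
      have "(bivector a v $ i $ j)\<^sup>2 \<le> 2 * K" using bivector_entry_le[of a v i j] av(4) by linarith
      then have "\<bar>bivector a v $ i $ j\<bar> \<le> sqrt (2 * K)" using real_le_rsqrt[of "\<bar>bivector a v $ i $ j\<bar>"] by simp
      moreover have "bivector a v $ i $ j \<in> \<int>" using av(1,2) by (auto simp: bivector_def lattice_points_def)
      ultimately show ?thesis by simp
    qed
    then have "bivector a v \<in> {B. \<forall>i. B $ i \<in> ?R}" by simp
    then show "P \<in> (\<lambda>B :: real^'n^'n. range ((*v) B)) ` {B. \<forall>i. B $ i \<in> ?R}"
      using range_bivector[OF av(3)] av(5) by blast
  qed
  moreover have "finite {B :: real^'n^'n. \<forall>i. B $ i \<in> ?R}"
    by (intro finite_vectors_over finite_abs_int_segment)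
  ultimately show ?thesis using finite_surj by blast
qed

text \<open>\<open>M\<^sub>1 + M\<^sub>2\<close> is the support function of the Minkowski sum. A
  ball of radius \<open>e\<close> around \<open>p\<close> inside the sum has, in direction
  \<open>x\<close>, the support value \<open>p \<bullet> x + e * norm x\<close>.\<close>

lemma Newt_sum_growth:
  fixes M\<^sub>1 M\<^sub>2 :: "real^'n \<Rightarrow> real"
  assumes M: "is_max_of M\<^sub>1 A\<^sub>1" "is_max_of M\<^sub>2 A\<^sub>2"
    and dim: "aff_dim (Newt M\<^sub>1 + Newt M\<^sub>2) = int CARD('n)"
  obtains p e where "e > 0" "\<And>x. e * norm x \<le> M\<^sub>1 x + M\<^sub>2 x - p \<bullet> x"
proof -
  let ?N = "Newt M\<^sub>1 + Newt M\<^sub>2"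
  have N: "Newt M\<^sub>1 = convex hull A\<^sub>1" "Newt M\<^sub>2 = convex hull A\<^sub>2" using Newt_eq M by blast+
  have conv: "convex ?N" unfolding N by (intro convex_set_plus convex_convex_hull)
  have "?N \<noteq> {}" using dim by auto
  then have "rel_interior ?N \<noteq> {}" using rel_interior_eq_empty[OF conv] by simp
  then have "interior ?N \<noteq> {}" using interior_rel_interior_gen[of ?N] dim by simp
  then obtain p e where pe: "e > 0" "cball p e \<subseteq> ?N" by (metis all_not_in_conv mem_interior_cball)
  have hull: "u \<bullet> x \<le> T x" if T: "is_max_of T A" and u: "u \<in> convex hull A" for u x and T :: "real^'n \<Rightarrow> real" and A
  proof -
    have "convex hull A \<subseteq> {u. x \<bullet> u \<le> T x}"
    proof (rule hull_minimal)
      show "A \<subseteq> {u. x \<bullet> u \<le> T x}" using is_max_of_ge[OF T] by (auto simp: inner_commute)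
    qed (rule convex_halfspace_le)
    then show ?thesis using u by (auto simp: inner_commute)
  qed
  show ?thesis
  proof (rule that[OF pe(1)])
    fix x :: "real^'n"
    \<comment> \<open>The point of the ball farthest in direction \<open>x\<close>; for
      \<open>x = 0\<close> the quotient is 0 by convention and the point is
      \<open>p\<close>.\<close>
    let ?y = "p + (e / norm x) *\<^sub>R x"
    have "dist p ?y \<le> e" using pe(1) by (simp add: dist_norm)
    then have "?y \<in> ?N" using pe(2) by auto
    then obtain u v where uv: "?y = u + v" "u \<in> Newt M\<^sub>1" "v \<in> Newt M\<^sub>2" by (rule set_plus_elim)
    have "?y \<bullet> x \<le> M\<^sub>1 x + M\<^sub>2 x"
      using hull[OF M(1), of u x] hull[OF M(2), of v x] uv N by (simp add: inner_add_left)
    moreover have "?y \<bullet> x = p \<bullet> x + e * norm x"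
      by (cases "x = 0") (simp_all add: inner_add_left power2_norm_eq_inner[symmetric] power2_eq_square)
    ultimately show "e * norm x \<le> M\<^sub>1 x + M\<^sub>2 x - p \<bullet> x" by simp
  qed
qed

text \<open>The 1-cycle of \<open>M\<close> has bounded mass because its pairing with
  \<open>M\<close> is at most 4. Symmetry exchanges \<open>M\<close> with \<open>max 0 l\<close>,
  which grows at most like \<open>norm l * norm x\<close>, so the 1-cycle of \<open>max 0 l\<close>
  is bounded as well.\<close>

lemma ray_weight_crossing_bound:
  fixes F :: "'n::finite weighted_fan" and M\<^sub>1 M\<^sub>2 :: "real^'n \<Rightarrow> real"
  assumes F: "tropical_fan 2 F" and M: "is_max_of M\<^sub>1 A\<^sub>1" "is_max_of M\<^sub>2 A\<^sub>2"
    and e: "e > 0" "\<And>x. e * norm x \<le> M\<^sub>1 x + M\<^sub>2 x - p \<bullet> x"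
    and J: "pairing F M\<^sub>1 M\<^sub>1 \<le> 1" "pairing F M\<^sub>1 M\<^sub>2 \<le> 1" "pairing F M\<^sub>2 M\<^sub>2 \<le> 1"
    and a: "a \<in> gens (cones F)"
  shows "norm a * ray_weight F (\<lambda>x. max 0 (l \<bullet> x)) a \<le> 4 * norm l / e\<^sup>2"
proof -
  let ?G = "gens (cones F)" and ?m = "\<lambda>x. max 0 (l \<bullet> x)"
  define M where "M = (\<lambda>x. (M\<^sub>1 x + M\<^sub>2 x) - p \<bullet> x)"
  have fin: "finite ?G" by (rule finite_gens[OF tropical_pure[OF F]])
  have Mge: "e * norm x \<le> M x" for x using e(2) by (simp add: M_def)
  have M0: "M x \<ge> 0" for x using Mge[of x] e(1) by (meson mult_nonneg_nonneg norm_ge_zero order_trans less_imp_le)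
  have rM: "ray_weight F M b \<ge> 0" if "b \<in> ?G" for b
    unfolding M_def ray_weight_diff ray_weight_add ray_weight_linear[OF F that]
    using is_max_of_ray_weight_nonneg[OF F that M(1)] is_max_of_ray_weight_nonneg[OF F that M(2)] by simp
  have rm: "ray_weight F ?m b \<ge> 0" if "b \<in> ?G" for b
  proof (cases "l \<bullet> b \<ge> 0")
    case True
    then show ?thesis by (intro ray_weight_nonneg[OF F that, of l]) auto
  next
    case False
    then show ?thesis by (intro ray_weight_nonneg[OF F that, of 0]) auto
  qed
  have half: "pairing F S M = pairing F S M\<^sub>1 + pairing F S M\<^sub>2" for S
    unfolding M_def pairing_diff pairing_add pairing_linear[OF F] by simp
  \<comment> \<open>The linear part drops out, and the four remaining terms are at most 1
    each.\<close>
  have "pairing F M M = (pairing F M\<^sub>1 M\<^sub>1 + pairing F M\<^sub>1 M\<^sub>2) + (pairing F M\<^sub>2 M\<^sub>1 + pairing F M\<^sub>2 M\<^sub>2)"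
    unfolding half[of M] pairing_commute[of F M] half by simp
  then have 4: "pairing F M M \<le> 4" using J pairing_commute[of F M\<^sub>2 M\<^sub>1] by simp
  \<comment> \<open>The weights of \<open>M\<close> are nonnegative, so its growth turns the
    self-pairing into a bound on their total mass.\<close>
  have "e * (\<Sum>b\<in>?G. norm b * ray_weight F M b) = (\<Sum>b\<in>?G. (e * norm b) * ray_weight F M b)"
    by (simp add: sum_distrib_left mult.assoc)
  also have "\<dots> \<le> pairing F M M"
    unfolding pairing_def by (intro sum_mono mult_right_mono Mge rM)
  finally have mass: "(\<Sum>b\<in>?G. norm b * ray_weight F M b) \<le> 4 / e"
    using 4 e(1) by (simp add: field_simps)
  \<comment> \<open>One term of a sum of nonnegative terms is bounded by the whole sum, which
    symmetry then turns into a sum over the weights of \<open>M\<close>.\<close>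
  have "e * norm a * ray_weight F ?m a \<le> M a * ray_weight F ?m a"
    by (intro mult_right_mono Mge rm a)
  also have "\<dots> \<le> (\<Sum>b\<in>?G. M b * ray_weight F ?m b)"
    by (rule member_le_sum[OF a _ fin]) (use M0 rm in auto)
  also have "\<dots> = pairing F ?m M" unfolding pairing_def[symmetric] by (rule pairing_commute)
  also have "\<dots> \<le> (\<Sum>b\<in>?G. (norm l * norm b) * ray_weight F M b)"
    unfolding pairing_def
  proof (intro sum_mono mult_right_mono rM)
    fix b show "?m b \<le> norm l * norm b" using norm_cauchy_schwarz[of l b] by simp
  qed
  also have "\<dots> = norm l * (\<Sum>b\<in>?G. norm b * ray_weight F M b)"
    by (simp add: sum_distrib_left mult.assoc)
  also have "\<dots> \<le> norm l * (4 / e)" by (intro mult_left_mono mass) simp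
  finally have "e * (norm a * ray_weight F ?m a) \<le> 4 * norm l / e" by (simp add: mult_ac)
  then show ?thesis using e(1) by (simp add: power2_eq_square field_simps)
qed

text \<open>The covector \<open>perp a v\<close> vanishes on \<open>a\<close> and its gradient lies in the plane of the cone,
  which makes the crossing bound of that cone as strong as possible.\<close>

lemma cone_bound:
  fixes F :: "'n::finite weighted_fan" and M\<^sub>1 M\<^sub>2 :: "real^'n \<Rightarrow> real"
  assumes F: "tropical_fan 2 F" and M: "is_max_of M\<^sub>1 A\<^sub>1" "is_max_of M\<^sub>2 A\<^sub>2"
    and e: "e > 0" "\<And>x. e * norm x \<le> M\<^sub>1 x + M\<^sub>2 x - p \<bullet> x"
    and J: "pairing F M\<^sub>1 M\<^sub>1 \<le> 1" "pairing F M\<^sub>1 M\<^sub>2 \<le> 1" "pairing F M\<^sub>2 M\<^sub>2 \<le> 1"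
    and \<sigma>: "\<sigma> \<in> cones_of_dim (cones F) 2"
  obtains a v where "a \<in> lattice_points" "v \<in> lattice_points" "gram a v > 0"
    "span \<sigma> = span {a, v}" "weight F \<sigma> * sqrt (gram a v) \<le> 4 / e\<^sup>2"
proof -
  note P = tropical_pure[OF F]
  obtain a b where ab: "prim a" "prim b" "gram a b > 0" "\<sigma> = cone2 a b" using fan_2cone[OF P \<sigma>] by blast
  have b: "b \<in> link (cones F) a" using ab \<sigma> by (simp add: link_def cones_of_dim_def)
  have ag: "a \<in> gens (cones F)" using ab(1) fan_faces_of_cone2(1)[OF P link_prim(4,3)[OF b]] by (simp add: gens_def)
  have bg: "b \<in> gens (cones F)" using link_subset_gens[OF P] b by blast
  have al: "a \<in> lattice_points" "b \<in> lattice_points" using ab prim_lattice by auto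
  define v where "v = lattice_normal (cone2 a b) (ray a)"
  obtain s where s: "v = s *\<^sub>R a + tcoef a b *\<^sub>R b" "tcoef a b > 0"
    unfolding v_def using lattice_normal_tcoef[OF al ab(3)] by blast
  have vl: "v \<in> lattice_points" unfolding v_def by (rule lattice_normal_cone2(1)[OF al ab(3)])
  have g: "gram a v > 0" unfolding s(1) gram_shift using s(2) ab(3) by simp
  let ?l = "perp a v" and ?w = "weight F \<sigma>"
  \<comment> \<open>The normal \<open>v\<close> differs from \<open>tcoef a b *\<^sub>R b\<close> by
    a multiple of \<open>a\<close>, on which the covector vanishes.\<close>
  have lv: "?l \<bullet> v = tcoef a b * (?l \<bullet> b)"
    unfolding s(1) inner_add_right by (simp add: perp_shift)
  then have lb: "tcoef a b * (?l \<bullet> b) = gram a v" by simp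
  have w: "?w > 0" using tropical_weight_pos[OF F \<sigma>] by simp
  have "?w * gram a v = edge F a b * (?l \<bullet> b)" using b lb by (simp add: edge_def ab(4) mult.assoc)
  also have "\<dots> \<le> edge F a b * max 0 (?l \<bullet> b)" by (intro mult_left_mono edge_nonneg[OF F ab(1)]) simp
  also have "\<dots> \<le> (\<Sum>c\<in>gens (cones F). edge F a c * max 0 (?l \<bullet> c))"
    by (rule member_le_sum[OF bg _ finite_gens[OF P]]) (use edge_nonneg[OF F ab(1)] in auto)
  \<comment> \<open>The covector vanishes at \<open>a\<close>, so the diagonal term is 0 and the
    weight is the sum over the neighbours.\<close>
  also have "\<dots> = ray_weight F (\<lambda>x. max 0 (?l \<bullet> x)) a" by (simp add: ray_weight_def)
  finally have "norm a * (?w * gram a v) \<le> norm a * ray_weight F (\<lambda>x. max 0 (?l \<bullet> x)) a"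
    by (intro mult_left_mono) auto
  also have "\<dots> \<le> 4 * norm ?l / e\<^sup>2" by (rule ray_weight_crossing_bound[OF F M e J ag])
  also have "norm ?l = norm a * sqrt (gram a v)"
    using norm_perp[of a v] by (metis norm_ge_zero real_sqrt_abs2 real_sqrt_mult real_sqrt_pow2_iff real_sqrt_unique abs_norm_cancel power2_eq_square)
  also have "norm a * (?w * gram a v) = norm a * (?w * (sqrt (gram a v) * sqrt (gram a v)))"
    using g by simp
  \<comment> \<open>The norm of the covector is \<open>norm a * sqrt (gram a v)\<close>. The same
    factor is split off on the left, and cancelling it removes the dependence on the length of
    \<open>a\<close>.\<close>
  finally have "norm a * sqrt (gram a v) * (?w * sqrt (gram a v)) \<le> norm a * sqrt (gram a v) * (4 / e\<^sup>2)"
    by (simp add: mult_ac)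
  moreover have "norm a * sqrt (gram a v) > 0" using g prim_nz[OF ab(1)] by simp
  ultimately have "?w * sqrt (gram a v) \<le> 4 / e\<^sup>2" by (rule mult_left_le_imp_le)
  moreover have "span \<sigma> = span {a, v}" unfolding ab(4) span_cone2 s(1) using s(2) by (simp add: span_shift)
  ultimately show ?thesis using that al(1) vl g by blast
qed

lemma common_subdivision:
  fixes F G H :: "'n::finite weighted_fan"
  assumes "tropical_fan 2 F" "tropical_fan 2 G" "tropical_fan 2 H" "level F = level G" "level F = level H"
  obtains ls where "set ls \<subseteq> lattice_points" "cuts ls G = cuts ls F" "cuts ls H = cuts ls F"
proof -
  obtain fs where fs: "set fs \<subseteq> lattice_points" "separating (set fs) F"
    using ex_separating_list[OF tropical_pure[OF assms(1)]] by blast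
  obtain gs where gs: "set gs \<subseteq> lattice_points" "separating (set gs) G"
    using ex_separating_list[OF tropical_pure[OF assms(2)]] by blast
  obtain hs where hs: "set hs \<subseteq> lattice_points" "separating (set hs) H"
    using ex_separating_list[OF tropical_pure[OF assms(3)]] by blast
  let ?ls = "fs @ gs @ hs"
  have lat: "set ?ls \<subseteq> lattice_points" using fs gs hs by auto
  have sep: "separating (set ?ls) F" "separating (set ?ls) G" "separating (set ?ls) H"
    using fs gs hs by (auto intro: separating_mono)
  have "cuts ?ls G = cuts ?ls F" by (rule cuts_eq[OF assms(2,1) assms(4)[symmetric] lat sep(2,1)])
  moreover have "cuts ?ls H = cuts ?ls F" by (rule cuts_eq[OF assms(3,1) assms(5)[symmetric] lat sep(3,1)])
  ultimately show ?thesis using that lat by blast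
qed

text \<open>The three intersection numbers may live on three representatives. A common subdivision
  carries all of them, since \<open>product_sum\<close> is invariant under cuts and equals the
  pairing where the function is linear on the cones.\<close>

lemma bounded_representative:
  fixes C :: "'n::finite weighted_fan set"
  assumes C: "C \<in> cycles 2" and M: "is_max_of M\<^sub>1 A\<^sub>1" "is_max_of M\<^sub>2 A\<^sub>2"
    and J: "intersection_number M\<^sub>1 M\<^sub>1 C \<le> 1" "intersection_number M\<^sub>1 M\<^sub>2 C \<le> 1"
      "intersection_number M\<^sub>2 M\<^sub>2 C \<le> 1"
  obtains H where "tropical_fan 2 H" "\<And>G. G \<in> C \<longleftrightarrow> tropical_fan 2 G \<and> level G = level H"
    "pairing H M\<^sub>1 M\<^sub>1 \<le> 1" "pairing H M\<^sub>1 M\<^sub>2 \<le> 1" "pairing H M\<^sub>2 M\<^sub>2 \<le> 1"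
proof -
  obtain F0 where F0: "F0 \<in> C" "\<And>G. G \<in> C \<longleftrightarrow> tropical_fan 2 G \<and> level G = level F0"
    using cycles_2_mem[OF C] by blast
  obtain F where F: "F \<in> C" "\<And>\<sigma>. \<sigma> \<in> cones F \<Longrightarrow> linear_on_cone \<sigma> M\<^sub>1"
    "intersection_number M\<^sub>1 M\<^sub>1 C = product_sum F M\<^sub>1 M\<^sub>1"
    using intersection_number_eq[OF C M(1) M(1)] by blast
  obtain G where G: "G \<in> C" "\<And>\<sigma>. \<sigma> \<in> cones G \<Longrightarrow> linear_on_cone \<sigma> M\<^sub>2"
    "intersection_number M\<^sub>1 M\<^sub>2 C = product_sum G M\<^sub>1 M\<^sub>2"
    using intersection_number_eq[OF C M(1) M(2)] by blast
  obtain K where K: "K \<in> C" "\<And>\<sigma>. \<sigma> \<in> cones K \<Longrightarrow> linear_on_cone \<sigma> M\<^sub>2"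
    "intersection_number M\<^sub>2 M\<^sub>2 C = product_sum K M\<^sub>2 M\<^sub>2"
    using intersection_number_eq[OF C M(2) M(2)] by blast
  have T: "tropical_fan 2 F" "tropical_fan 2 G" "tropical_fan 2 K" "level F = level G" "level F = level K"
    "level F = level F0"
    using F0(2)[of F] F0(2)[of G] F0(2)[of K] F(1) G(1) K(1) by simp_all
  obtain ls where ls: "set ls \<subseteq> lattice_points" "cuts ls G = cuts ls F" "cuts ls K = cuts ls F"
    using common_subdivision[OF T(1-5)] by blast
  have eq: "pairing (cuts ls F') S T = product_sum F' S T"
    if F': "tropical_fan 2 F'" "\<And>\<sigma>. \<sigma> \<in> cones F' \<Longrightarrow> linear_on_cone \<sigma> T" for F' S T
    using product_sum_cuts[OF F'(1) ls(1) F'(2)] linear_on_cuts[OF F'(2)]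
      product_sum_eq_pairing[OF tropical_cuts[OF F'(1) ls(1)]] by metis
  show ?thesis
  proof (rule that[of "cuts ls F"])
    show "tropical_fan 2 (cuts ls F)" by (rule tropical_cuts[OF T(1) ls(1)])
    show "\<And>G. G \<in> C \<longleftrightarrow> tropical_fan 2 G \<and> level G = level (cuts ls F)"
      using F0(2) level_cuts[OF T(1) ls(1)] T(6) by simp
    show "pairing (cuts ls F) M\<^sub>1 M\<^sub>1 \<le> 1" using eq[OF T(1) F(2)] F(3) J(1) by simp
    show "pairing (cuts ls F) M\<^sub>1 M\<^sub>2 \<le> 1" using eq[OF T(2) G(2)] G(3) J(2) ls(2) by simp
    show "pairing (cuts ls F) M\<^sub>2 M\<^sub>2 \<le> 1" using eq[OF T(3) K(2)] K(3) J(3) ls(3) by simp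
  qed
qed

theorem theorem1p4:
  fixes M\<^sub>1 M\<^sub>2 :: "real^'n \<Rightarrow> real"
  assumes "tropical_regular M\<^sub>1" and "tropical_regular M\<^sub>2"
    and "aff_dim (Newt M\<^sub>1 + Newt M\<^sub>2) = int CARD('n)"
  shows "finite {C :: 'n weighted_fan set. C \<in> cycles 2 \<and>
           intersection_number M\<^sub>1 M\<^sub>1 C \<le> 1 \<and>
           intersection_number M\<^sub>1 M\<^sub>2 C \<le> 1 \<and>
           intersection_number M\<^sub>2 M\<^sub>2 C \<le> 1}" (is "finite ?X")
proof -
  obtain A\<^sub>1 A\<^sub>2 where M: "is_max_of M\<^sub>1 A\<^sub>1" "is_max_of M\<^sub>2 A\<^sub>2"
    using assms(1,2) by (auto simp: tropical_regular_def)
  obtain p e where e: "e > 0" "\<And>x. e * norm x \<le> M\<^sub>1 x + M\<^sub>2 x - p \<bullet> x"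
    using Newt_sum_growth[OF M assms(3)] by blast
  define K where "K = 4 / e\<^sup>2"
  \<comment> \<open>The square appears because \<open>cone_bound\<close> controls
    \<open>sqrt (gram a v)\<close>, not \<open>gram a v\<close>.\<close>
  define \<P> where "\<P> = {P. \<exists>a v :: real^'n. a \<in> lattice_points \<and> v \<in> lattice_points \<and>
     gram a v > 0 \<and> gram a v \<le> K\<^sup>2 \<and> P = span {a, v}}"
  define W where "W = {k \<in> \<int>. \<bar>k\<bar> \<le> K}"
  define \<F> where "\<F> = {F :: 'n weighted_fan. tropical_fan 2 F \<and>
    (\<forall>\<sigma>\<in>cones_of_dim (cones F) 2. span \<sigma> \<in> \<P> \<and> weight F \<sigma> \<in> W)}"
  have planes: "subspace P \<and> dim P = 2" if P: "P \<in> \<P>" for P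
  proof -
    obtain a v where "gram a v > 0" "P = span {a, v}" using P unfolding \<P>_def by blast
    then show ?thesis using dim_cone2[of a v] by (metis dim_span span_cone2 subspace_span)
  qed
  have fin: "finite (level ` \<F>)"
    unfolding \<F>_def
  proof (rule finite_levels[OF _ planes])
    show "finite \<P>" unfolding \<P>_def by (rule finite_planes_bounded_gram)
    show "finite W" unfolding W_def by (rule finite_abs_int_segment)
  qed
  \<comment> \<open>A cycle consists of all tropical 2-fans with one common \<open>level\<close>
    function, so it is recovered from that function.\<close>
  have "?X \<subseteq> (\<lambda>L. {G. tropical_fan 2 G \<and> level G = L}) ` (level ` \<F>)"
  proof
    fix C assume C: "C \<in> ?X"
    then obtain H where H: "tropical_fan 2 H" "\<And>G. G \<in> C \<longleftrightarrow> tropical_fan 2 G \<and> level G = level H"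
      and J: "pairing H M\<^sub>1 M\<^sub>1 \<le> 1" "pairing H M\<^sub>1 M\<^sub>2 \<le> 1" "pairing H M\<^sub>2 M\<^sub>2 \<le> 1"
      using bounded_representative[OF _ M, of C] by auto
    have "span \<sigma> \<in> \<P> \<and> weight H \<sigma> \<in> W" if \<sigma>: "\<sigma> \<in> cones_of_dim (cones H) 2" for \<sigma>
    proof -
      obtain a v where av: "a \<in> lattice_points" "v \<in> lattice_points" "gram a v > 0"
        "span \<sigma> = span {a, v}" "weight H \<sigma> * sqrt (gram a v) \<le> K"
        unfolding K_def by (rule cone_bound[OF H(1) M e J \<sigma>])
      \<comment> \<open>The weight and the Gram determinant are positive integers, so both factors
        in \<open>weight H \<sigma> * sqrt (gram a v)\<close> are at least 1, and the bound
        \<open>K\<close> on the product bounds each of them.\<close>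
      have "gram a v \<ge> 1" using Ints_ge_1[OF lattice_gram[OF av(1,2)] av(3)] .
      then have g: "sqrt (gram a v) \<ge> 1" by simp
      have w: "weight H \<sigma> \<in> \<int>" "weight H \<sigma> > 0"
        using tropical_weight_pos[OF H(1) \<sigma>] Nats_subset_Ints by auto
      have "weight H \<sigma> \<ge> 1" by (rule Ints_ge_1[OF w])
      then have "sqrt (gram a v) \<le> K"
        using av(5) mult_right_mono[of 1 "weight H \<sigma>" "sqrt (gram a v)"] g by linarith
      then have "(sqrt (gram a v))\<^sup>2 \<le> K\<^sup>2" using g by (intro power_mono) auto
      then have "gram a v \<le> K\<^sup>2" using av(3) by simp
      moreover have "weight H \<sigma> \<le> K"
        using av(5) mult_left_mono[of 1 "sqrt (gram a v)" "weight H \<sigma>"] g w(2) by linarith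
      ultimately show ?thesis using av w unfolding \<P>_def W_def by auto
    qed
    then have "H \<in> \<F>" using H(1) by (simp add: \<F>_def)
    moreover have "C = {G. tropical_fan 2 G \<and> level G = level H}" using H(2) by blast
    ultimately show "C \<in> (\<lambda>L. {G. tropical_fan 2 G \<and> level G = L}) ` (level ` \<F>)" by blast
  qed
  then show ?thesis using fin finite_surj by blast
qed

end
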